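(* Suppose that: (A1) for all $\bar p=(\bar x_t,p)$ in some polytopic set $\mathscr{Y}$, the matrix $Q(p)$ is positive definite, and the quadratic program $$\min_y\ \tfrac12 y^\top Q(p)y+q(\bar p)^\top y\quad\text{s.t.}\quad F(p)y=\phi(\bar p),\ \ G(p)y\le g(\bar p)$$ is feasible and satisfies the linear independence constraint qualification (LICQ); and (A2) the maps $Q(p),q(\bar p),F(p),\phi(\bar p),G(p),g(\bar p)$ are locally Lipschitz and definable. Then the optimizer $z(\bar p)$ of the Lagrange dual problem $$\min_z\ \tfrac12 z^\top H(\bar p)z+h(\bar p)^\top z\quad\text{s.t.}\quad Ez\ge 0$$ is unique and locally Lipschitz definable for any $\bar p\in\mathscr{Y}$. Its conservative Jacobian $\mathcal J_z(\bar p)$ contains elements of the form $-U^{-1}V$, where $$U = J_{P_C}\,(I-\gamma H(\bar p))-I,\qquad V=-\gamma J_{P_C}\,(Az+B),$$ with $J_{P_C}\in\mathcal J_{P_C}\big(z-\gamma(H(\bar p)z+h(\bar p))\big)$, $A\in\mathcal J_H(\bar p)$, $B\in\mathcal J_h(\bar p)$.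
   Context: Here $\bar p=(\bar x_t,p)$ with $\bar x_t\in\mathbb R^{n_x}$, $p\in\mathbb R^{n_p}$, and $\gamma>0$ is a scalar. The primal program has $n_{\rm in}$ inequality and $n_{\rm eq}$ equality constraints. LICQ: at an optimizer $y(\bar p)$, the rows of $G(p)$ associated with the active inequality constraints and the rows of $F(p)$ are linearly independent. Dual data: $z=(\lambda,\mu)\in\mathbb R^{n_{\rm in}+n_{\rm eq}}$, where $\lambda$ and $\mu$ are the multipliers of the inequality and equality constraints, $E=[I\ 0]$ (so $Ez=\lambda$), and (arguments omitted) $$H=\begin{bmatrix}GQ^{-1}G^\top & GQ^{-1}F^\top\\ FQ^{-1}G^\top & FQ^{-1}F^\top\end{bmatrix},\qquad h=\begin{bmatrix}GQ^{-1}q+g\\ FQ^{-1}q+\phi\end{bmatrix}.$$ $C=\{z:Ez\ge0\}$ and $P_C$ is the orthogonal projector onto $C$. In the formulas for $U$ and $V$, $z=z(\bar p)$. Conservative Jacobians: a path is an absolutely continuous function $x:[0,1]\to\mathbb R^n$ which admits a derivative $\dot x$ for almost every $t\in[0,1]$ and for which $x(t)-x(0)$ is the Lebesgue integral of $\dot x$ between $0$ and $t$ for all $t\in[0,1]$. A locally Lipschitz function $\varphi:\mathbb R^n\to\mathbb R^m$ admits $\mathcal J_\varphi:\mathbb R^n\rightrightarrows\mathbb R^{m\times n}$ as a conservative Jacobian if $\mathcal J_\varphi$ is nonempty-valued, outer semicontinuous, locally bounded, and for all paths $x$ and almost all $t\in[0,1]$, $\frac{d}{dt}\varphi(x(t))=\langle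 v,\dot x(t)\rangle$ (the product $v\,\dot x(t)$) for all $v\in\mathcal J_\varphi(x(t))$. $\mathcal J_z,\mathcal J_{P_C},\mathcal J_H,\mathcal J_h$ denote conservative Jacobians of $\bar p\mapsto z(\bar p)$, $P_C$, $H$, $h$. For $A\in\mathcal J_H(\bar p)$, $Az$ denotes the matrix of the linear map $\delta\mapsto(A\delta)z$, where $A\delta$ is a matrix of the size of $H$. Definability: an o-minimal structure on $(\mathbb R,+,\cdot)$ is a collection $\mathcal O=(\mathcal O_n)_{n\in\mathbb N}$, each $\mathcal O_n$ a Boolean subalgebra of the power set of $\mathbb R^n$, such that all semialgebraic subsets of $\mathbb R^n$ belong to $\mathcal O_n$; the elements of $\mathcal O_1$ are precisely the finite unions of points and intervals; $A\in\mathcal O_n$, $B\in\mathcal O_m$ implies $A\times B\in\mathcal O_{n+m}$; and the projection of any $A\in\mathcal O_{n+1}$ onto its first $n$ coordinates belongs to $\mathcal O_n$. A set is definable (in an o-minimal structure) if it belongs to $\mathcal O$; a function is definable if its graph is definable.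
   Formalization: J_{P_C} is additionally required to lie in the Clarke Jacobian of P_C (otherwise U may be singular; such elements are shown to exist), and the conservative Jacobians of z, H and h are taken relative to the set Y; there is at least one inequality and one equality constraint. *)

theory Defs
  imports "HOL-Analysis.Analysis"
begin

section \<open>O-minimal structures and definability\<close>

text \<open>
  An o-minimal structure contains sets of all finite dimensions at once, so points of
  \<open>\<real>\<^sup>n\<close> are real lists of length \<open>n\<close> in this section.
\<close>

definition rspace :: "nat \<Rightarrow> real list set" where
  "rspace n = {xs. length xs = n}"

inductive_set polyfun :: "nat \<Rightarrow> (real list \<Rightarrow> real) set" for n :: nat where
  const: "(\<lambda>_. c) \<in> polyfun n"
| var: "i < n \<Longrightarrow> (\<lambda>xs. xs ! i) \<in> polyfun n"
| add: "f \<in> polyfun n \<Longrightarrow> g \<in> polyfun n \<Longrightarrow> (\<lambda>xs. f xs + g xs) \<in> polyfun n"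
| mult: "f \<in> polyfun n \<Longrightarrow> g \<in> polyfun n \<Longrightarrow> (\<lambda>xs. f xs * g xs) \<in> polyfun n"

inductive_set semialgebraic :: "nat \<Rightarrow> real list set set" for n :: nat where
  eq: "f \<in> polyfun n \<Longrightarrow> {xs \<in> rspace n. f xs = 0} \<in> semialgebraic n"
| pos: "f \<in> polyfun n \<Longrightarrow> {xs \<in> rspace n. f xs > 0} \<in> semialgebraic n"
| compl: "A \<in> semialgebraic n \<Longrightarrow> rspace n - A \<in> semialgebraic n"
| union: "A \<in> semialgebraic n \<Longrightarrow> B \<in> semialgebraic n \<Longrightarrow> A \<union> B \<in> semialgebraic n"

text \<open>
  A singleton is an interval in the sense of \<^const>\<open>is_interval\<close>, so finite unions of points
  and intervals are finite unions of sets satisfying \<^const>\<open>is_interval\<close>.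
\<close>

definition o_minimal :: "(nat \<Rightarrow> real list set set) \<Rightarrow> bool" where
  "o_minimal \<O> \<longleftrightarrow>
    (\<forall>n. \<O> n \<subseteq> Pow (rspace n) \<and> {} \<in> \<O> n \<and>
         (\<forall>A\<in>\<O> n. rspace n - A \<in> \<O> n) \<and> (\<forall>A\<in>\<O> n. \<forall>B\<in>\<O> n. A \<union> B \<in> \<O> n)) \<and>
    (\<forall>n. semialgebraic n \<subseteq> \<O> n) \<and>
    \<O> 1 = {(\<lambda>t. [t]) ` \<Union>\<I> |\<I>. finite \<I> \<and> (\<forall>I\<in>\<I>. is_interval (I :: real set))} \<and>
    (\<forall>n m. \<forall>A\<in>\<O> n. \<forall>B\<in>\<O> m. {xs @ ys |xs ys. xs \<in> A \<and> ys \<in> B} \<in> \<O> (n + m)) \<and>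
    (\<forall>n. \<forall>A\<in>\<O> (n + 1). take n ` A \<in> \<O> n)"

text \<open>
  The order in which the standard basis is enumerated is irrelevant, since every o-minimal
  structure is closed under permutations of coordinates.
\<close>

definition basis_enum :: "'a::euclidean_space list" where
  "basis_enum = (SOME bs. distinct bs \<and> set bs = Basis)"

definition coords :: "'a::euclidean_space \<Rightarrow> real list" where
  "coords x = map (\<lambda>b. x \<bullet> b) basis_enum"

definition definable_on ::
    "(nat \<Rightarrow> real list set set) \<Rightarrow> 'a::euclidean_space set \<Rightarrow> ('a \<Rightarrow> 'b::euclidean_space) \<Rightarrow> bool" where
  "definable_on \<O> S f \<longleftrightarrow> (\<lambda>x. coords x @ coords (f x)) ` S \<in> \<O> (DIM('a) + DIM('b))"


section \<open>Conservative Jacobians\<close>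

definition locally_lipschitz_on :: "'a::metric_space set \<Rightarrow> ('a \<Rightarrow> 'b::metric_space) \<Rightarrow> bool" where
  "locally_lipschitz_on S f \<longleftrightarrow> (\<forall>x\<in>S. \<exists>r>0. \<exists>L. L-lipschitz_on (S \<inter> ball x r) f)"

definition abs_cont_01 :: "(real \<Rightarrow> 'a::euclidean_space) \<Rightarrow> bool" where
  "abs_cont_01 x \<longleftrightarrow>
    (\<forall>\<epsilon>>0. \<exists>\<delta>>0. \<forall>(n::nat) a b.
       (\<forall>i<n. 0 \<le> a i \<and> a i \<le> b i \<and> b i \<le> 1) \<and>
       disjoint_family_on (\<lambda>i. {a i<..<b i}) {..<n} \<and> (\<Sum>i<n. b i - a i) < \<delta> \<longrightarrow>
       (\<Sum>i<n. norm (x (b i) - x (a i))) < \<epsilon>)"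

definition ac_path :: "(real \<Rightarrow> 'a::euclidean_space) \<Rightarrow> bool" where
  "ac_path x \<longleftrightarrow> abs_cont_01 x \<and>
    (\<exists>x'. (AE t in lebesgue_on {0..1}. (x has_vector_derivative x' t) (at t within {0..1})) \<and>
          (\<forall>t\<in>{0..1}. has_bochner_integral (lebesgue_on {0..t}) x' (x t - x 0)))"

text \<open>
  Jacobians are linear maps rather than matrices, so that the notion also applies to functions
  with values in a space of matrices. All conditions are relative to the set \<open>S\<close> on which
  \<open>\<phi>\<close> is considered; \<open>S = UNIV\<close> gives the notion for functions on the whole space.
\<close>

definition conservative_jacobian_on ::
    "'a::euclidean_space set \<Rightarrow> ('a \<Rightarrow> 'b::euclidean_space) \<Rightarrow> ('a \<Rightarrow> ('a \<Rightarrow>\<^sub>L 'b) set) \<Rightarrow> bool" where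
  "conservative_jacobian_on S \<phi> J \<longleftrightarrow>
    locally_lipschitz_on S \<phi> \<and>
    (\<forall>x\<in>S. J x \<noteq> {}) \<and>
    (\<forall>x\<in>S. \<forall>X V v. (\<forall>k::nat. X k \<in> S \<and> V k \<in> J (X k)) \<and> X \<longlonglongrightarrow> x \<and> V \<longlonglongrightarrow> v \<longrightarrow> v \<in> J x) \<and>
    (\<forall>x\<in>S. \<exists>r>0. bounded (\<Union>y\<in>S \<inter> ball x r. J y)) \<and>
    (\<forall>x. ac_path x \<and> x ` {0..1} \<subseteq> S \<longrightarrow>
       (AE t in lebesgue_on {0..1}. \<exists>d. (x has_vector_derivative d) (at t within {0..1}) \<and>
          (\<forall>v\<in>J (x t). ((\<lambda>s. \<phi> (x s)) has_vector_derivative blinfun_apply v d) (at t within {0..1}))))"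

text \<open>
  A conservative Jacobian may be enlarged arbitrarily at isolated points, so one of the projector
  may contain elements that make the matrix \<open>U\<close> of the sensitivity formula singular. Elements
  that also lie in the Clarke Jacobian do not have this defect.
\<close>

definition clarke_jacobian ::
    "('a::euclidean_space \<Rightarrow> 'b::euclidean_space) \<Rightarrow> 'a \<Rightarrow> ('a \<Rightarrow>\<^sub>L 'b) set" where
  "clarke_jacobian f x = convex hull
     {v. \<exists>X D. (\<forall>k::nat. (f has_derivative blinfun_apply (D k)) (at (X k))) \<and> X \<longlonglongrightarrow> x \<and> D \<longlonglongrightarrow> v}"


section \<open>The quadratic program and its dual\<close>

definition positive_definite :: "real^'n^'n \<Rightarrow> bool" where
  "positive_definite M \<longleftrightarrow> transpose M = M \<and> (\<forall>v. v \<noteq> 0 \<longrightarrow> 0 < v \<bullet> (M *v v))"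

definition stack_vec :: "'a^'i \<Rightarrow> 'a^'e \<Rightarrow> 'a^('i + 'e)" where
  "stack_vec u v = (\<chi> r. case r of Inl i \<Rightarrow> u $ i | Inr j \<Rightarrow> v $ j)"

definition block_mat ::
    "real^'c^'i \<Rightarrow> real^'d^'i \<Rightarrow> real^'c^'e \<Rightarrow> real^'d^'e \<Rightarrow> real^('c + 'd)^('i + 'e)" where
  "block_mat A B C D =
     stack_vec (\<chi> i. stack_vec (A $ i) (B $ i)) (\<chi> i. stack_vec (C $ i) (D $ i))"

definition primal_feasible ::
    "real^'y^'e \<Rightarrow> real^'e \<Rightarrow> real^'y^'i \<Rightarrow> real^'i \<Rightarrow> real^'y \<Rightarrow> bool" where
  "primal_feasible F \<phi> G g y \<longleftrightarrow> F *v y = \<phi> \<and> G *v y \<le> g"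

definition primal_optimizer ::
    "real^'y^'y \<Rightarrow> real^'y \<Rightarrow> real^'y^'e \<Rightarrow> real^'e \<Rightarrow> real^'y^'i \<Rightarrow> real^'i \<Rightarrow> real^'y \<Rightarrow> bool" where
  "primal_optimizer Q q F \<phi> G g y \<longleftrightarrow>
     is_arg_min (\<lambda>y. 1/2 * (y \<bullet> (Q *v y)) + q \<bullet> y) (primal_feasible F \<phi> G g) y"

text \<open>
  Linear independence is meant for the rows as a family; injectivity excludes repeated rows,
  which the set of rows alone would not detect.
\<close>

definition licq ::
    "real^'y^'e \<Rightarrow> real^'y^'i \<Rightarrow> real^'i \<Rightarrow> real^'y \<Rightarrow> bool" where
  "licq F G g y \<longleftrightarrow>
     (let K = {Inl i |i. (G *v y) $ i = g $ i} \<union> range Inr;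
          rw = (\<lambda>r. row r (stack_vec G F))
      in inj_on rw K \<and> independent (rw ` K))"

definition dual_H :: "real^'y^'y \<Rightarrow> real^'y^'e \<Rightarrow> real^'y^'i \<Rightarrow> real^('i + 'e)^('i + 'e)" where
  "dual_H Q F G = block_mat
     (G ** matrix_inv Q ** transpose G) (G ** matrix_inv Q ** transpose F)
     (F ** matrix_inv Q ** transpose G) (F ** matrix_inv Q ** transpose F)"

definition dual_h ::
    "real^'y^'y \<Rightarrow> real^'y \<Rightarrow> real^'y^'e \<Rightarrow> real^'e \<Rightarrow> real^'y^'i \<Rightarrow> real^'i \<Rightarrow> real^('i + 'e)" where
  "dual_h Q q F \<phi> G g = stack_vec (G *v (matrix_inv Q *v q) + g) (F *v (matrix_inv Q *v q) + \<phi>)"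

definition E_mat :: "real^('i::finite + 'e::finite)^'i" where
  "E_mat = (\<chi> i. stack_vec (mat 1 $ i) 0)"

definition dual_cone :: "(real^('i::finite + 'e::finite)) set" where
  "dual_cone = {z. 0 \<le> E_mat *v z}"

definition dual_optimizer ::
    "real^('i::finite + 'e::finite)^('i + 'e) \<Rightarrow> real^('i + 'e) \<Rightarrow> real^('i + 'e) \<Rightarrow> bool" where
  "dual_optimizer H h z \<longleftrightarrow>
     is_arg_min (\<lambda>z. 1/2 * (z \<bullet> (H *v z)) + h \<bullet> z) (\<lambda>z. 0 \<le> E_mat *v z) z"

abbreviation proj_cone :: "real^('i::finite + 'e::finite) \<Rightarrow> real^('i + 'e)" where
  "proj_cone \<equiv> closest_point dual_cone"


section \<open>The matrices of the sensitivity formula\<close>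

definition blinfun_of_mat :: "real^'n^'m \<Rightarrow> ((real^'n) \<Rightarrow>\<^sub>L (real^'m))" where
  "blinfun_of_mat M = Blinfun (\<lambda>x. M *v x)"

definition jac_times_vec ::
    "('a::real_normed_vector \<Rightarrow>\<^sub>L (real^'n^'m)) \<Rightarrow> real^'n \<Rightarrow> ('a \<Rightarrow>\<^sub>L (real^'m))" where
  "jac_times_vec A z = Blinfun (\<lambda>\<delta>. blinfun_apply A \<delta> *v z)"

definition U_mat :: "real \<Rightarrow> real^'n^'n \<Rightarrow> ((real^'n) \<Rightarrow>\<^sub>L (real^'n)) \<Rightarrow> real^'n^'n" where
  "U_mat \<gamma> H P = matrix (blinfun_apply P) ** (mat 1 - \<gamma> *\<^sub>R H) - mat 1"

definition V_map ::
    "real \<Rightarrow> ((real^'n) \<Rightarrow>\<^sub>L (real^'n)) \<Rightarrow> ('a::real_normed_vector \<Rightarrow>\<^sub>L (real^'n^'n)) \<Rightarrow>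
     ('a \<Rightarrow>\<^sub>L (real^'n)) \<Rightarrow> real^'n \<Rightarrow> ('a \<Rightarrow>\<^sub>L (real^'n))" where
  "V_map \<gamma> P A B z = - \<gamma> *\<^sub>R (P o\<^sub>L (jac_times_vec A z + B))"

end

theory Submission
  imports Defs
begin

text \<open>
  Write \<open>M = stack_vec G F\<close> and \<open>b = stack_vec g \<phi>\<close>. Then \<open>H = M Q\<^sup>-\<^sup>1 M\<^sup>T\<close>, and for the point
  \<open>y = - Q\<^sup>-\<^sup>1 (q + M\<^sup>T z)\<close> at which the Lagrangian is stationary, the dual gradient \<open>H z + h\<close> is the
  primal slack \<open>b - M y\<close>. So the optimality conditions of the dual program are the KKT conditions of
  the primal one. LICQ is used twice. At the primal optimizer it yields multipliers, hence a dual
  solution. And it makes this solution nondegenerate: \<open>u\<^sup>T H u = 0\<close> means \<open>M\<^sup>T u = 0\<close>, which forces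
  \<open>u = 0\<close> when \<open>u\<close> is supported where the gradient vanishes. Nondegeneracy drives everything else.

  Uniqueness and Lipschitz continuity come from monotonicity of the optimality conditions: it bounds
  the energy \<open>u\<^sup>T H u\<close> of the normalised difference \<open>u\<close> of two solutions by the perturbation of the
  data relative to their distance, and complementarity makes the inactive components of \<open>u\<close> small.
  If the difference quotients of \<open>z\<close> were unbounded, the vectors \<open>u\<close> would accumulate at a unit
  vector that contradicts nondegeneracy (\<open>nondegenerate_no_null_directions\<close>).

  For definability, the graph of \<open>z\<close> is a projection of the set of all KKT points. With the primal
  variable \<open>y\<close> and the values of the six data maps as extra coordinates, this set is cut out by
  polynomial conditions and by the graphs of the data maps.

  For the conservative Jacobian, \<open>z\<close> solves \<open>z = P (w)\<close> with \<open>w = z - \<gamma> (H z + h)\<close> and \<open>P\<close> the projector,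
  which acts componentwise as identity or as positive part. Its Clarke Jacobian at \<open>w\<close> consists of
  diagonal matrices: slope 1 or 0 off the kinks and any slope in \<open>[0, 1]\<close> at a kink. Nondegeneracy
  makes \<open>U\<close> invertible for each of these diagonals (\<open>U_mat_invertible\<close>). The Jacobian of \<open>z\<close> is taken to
  be the set of all \<open>- U\<^sup>-\<^sup>1 V\<close> formed with them. Its graph is closed and locally bounded because
  \<open>U\<^sup>-\<^sup>1\<close> depends continuously on its ingredients.

  The chain rule along a path needs almost everywhere differentiability of \<open>z\<close> along the path. By
  \<open>solution_formula\<close>, \<open>z\<close> agrees at each time with one of finitely many explicit functions of \<open>H\<close> and
  \<open>h\<close>, one for each sign pattern of \<open>w\<close>, and these are differentiable wherever \<open>H\<close> and \<open>h\<close> are. Two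
  differentiable functions that agree at a time with different derivatives agree at no other time
  nearby, and a set of reals has only countably many isolated points, so \<open>z\<close> is differentiable
  at all other good times (\<open>selection_differentiable\<close>). For the same reason, up to countably many
  times, a component of \<open>w\<close> that vanishes has derivative zero. At a kink, therefore, every slope
  gives the same product, and differentiating \<open>z = P (w)\<close> yields the formula for all elements at once.

  Finally, a conservative Jacobian of \<open>P\<close> at \<open>w\<close> contains a Clarke element: arbitrarily close to \<open>w\<close>
  there is an open orthant on which \<open>P\<close> is linear, and a conservative Jacobian contains the limits
  of derivatives of this kind (\<open>conservative_jacobian_contains_derivative_limit\<close>).
\<close>

section \<open>Stacked vectors and matrices\<close>

text \<open>
  The product \<open>transpose M *v u\<close> is the combination of the rows of \<open>M\<close> with coefficients \<open>u\<close>. It is kept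
  in this form because linear independence of the rows is a statement about such combinations.
\<close>

declare transpose_matrix_vector [simp del]

lemma stack_vec_nth [simp]:
  "stack_vec u v $ Inl i = u $ i" "stack_vec u v $ Inr j = v $ j"
  by (simp_all add: stack_vec_def)

lemma all_sum_type: "(\<forall>r. P r) \<longleftrightarrow> (\<forall>i. P (Inl i)) \<and> (\<forall>j. P (Inr j))"
  by (metis sum.exhaust)

lemma sum_UNIV_sum_type:
  fixes f :: "'i::finite + 'e::finite \<Rightarrow> 'a::comm_monoid_add"
  shows "(\<Sum>r\<in>UNIV. f r) = (\<Sum>i\<in>UNIV. f (Inl i)) + (\<Sum>j\<in>UNIV. f (Inr j))"
  unfolding UNIV_Plus_UNIV[symmetric] by (subst sum.Plus) auto

lemma E_mat_mult_nth [simp]: "(E_mat *v z) $ i = z $ Inl i"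
  for z :: "real^('i::finite + 'e::finite)"
  by (simp add: E_mat_def matrix_vector_mult_def sum_UNIV_sum_type mat_def if_distrib if_distribR
      cong: if_cong)

lemma E_mat_nonneg_iff: "0 \<le> E_mat *v z \<longleftrightarrow> (\<forall>i. 0 \<le> z $ Inl i)"
  for z :: "real^('i::finite + 'e::finite)"
  by (simp add: less_eq_vec_def)

lemma stack_vec_mult_vec: "stack_vec A B *v y = stack_vec (A *v y) (B *v y)"
  by (simp add: vec_eq_iff all_sum_type matrix_vector_mult_def)

lemma stack_vec_add: "stack_vec a b + stack_vec c d = stack_vec (a + c) (b + d)"
  by (simp add: vec_eq_iff all_sum_type)

text \<open>
  The dual Hessian is the Gram matrix of all constraint rows with respect to the inner product
  of \<open>Q\<^sup>-\<^sup>1\<close>. This form, without blocks, is the one in which LICQ can be applied.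
\<close>

lemma dual_H_factorisation:
  "dual_H Q F G = stack_vec G F ** matrix_inv Q ** transpose (stack_vec G F)"
proof -
  have "stack_vec G F ** X = stack_vec (G ** X) (F ** X)" for X :: "real^_^_"
    by (simp add: vec_eq_iff all_sum_type matrix_matrix_mult_def)
  then show ?thesis
    unfolding dual_H_def block_mat_def
    by (simp add: vec_eq_iff all_sum_type matrix_matrix_mult_def transpose_def)
qed

lemma dual_h_factorisation:
  "dual_h Q q F \<phi> G g = stack_vec G F *v (matrix_inv Q *v q) + stack_vec g \<phi>"
  by (simp add: dual_h_def stack_vec_mult_vec stack_vec_add)

lemma matrix_inv_mult:
  fixes A :: "real^'n^'n"
  assumes "invertible A"
  shows "A ** matrix_inv A = mat 1" "matrix_inv A ** A = mat 1"
  using assms unfolding invertible_def matrix_inv_def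
  by (metis (mono_tags, lifting) someI_ex)+

lemma matrix_inv_vec:
  fixes A :: "real^'n^'n"
  assumes "invertible A"
  shows "A *v (matrix_inv A *v x) = x" "matrix_inv A *v (A *v x) = x"
  by (simp_all add: matrix_vector_mul_assoc matrix_inv_mult[OF assms])

lemma invertible_iff_no_kernel:
  fixes A :: "real^'n^'n"
  shows "invertible A \<longleftrightarrow> (\<forall>v. A *v v = 0 \<longrightarrow> v = 0)"
  by (simp add: invertible_left_inverse matrix_left_invertible_ker)

lemma positive_definite_invertible: "positive_definite A \<Longrightarrow> invertible A"
  unfolding positive_definite_def invertible_iff_no_kernel by force

lemma symmetric_matrix_dot:
  fixes A :: "real^'n^'n"
  assumes "transpose A = A"
  shows "x \<bullet> (A *v y) = (A *v x) \<bullet> y"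
  using dot_lmul_matrix[of x A y] assms by (metis transpose_matrix_vector)

lemma dot_matrix_transpose: "x \<bullet> (A *v y) = (transpose A *v x) \<bullet> y"
  for A :: "real^'n^'m"
  using dot_lmul_matrix[of x A y] by (simp add: transpose_matrix_vector)

lemma mult_minus_vec: "A *v (- x) = - (A *v x)" for A :: "real^'n^'m"
  using matrix_vector_mult_diff_distrib[of A 0 x] by simp

section \<open>Optimality conditions of the dual program\<close>

text \<open>
  A mixed linear complementarity problem. It expresses that the negative gradient \<open>- (H z + h)\<close> of the
  dual objective is normal to the dual cone at \<open>z\<close>.
\<close>

definition lcp_solution :: "real^('i::finite + 'e::finite)^('i + 'e) \<Rightarrow> real^('i + 'e) \<Rightarrow> real^('i + 'e) \<Rightarrow> bool" where
  "lcp_solution H h z \<longleftrightarrow>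
     (\<forall>i. 0 \<le> z $ Inl i \<and> 0 \<le> (H *v z + h) $ Inl i \<and> z $ Inl i * (H *v z + h) $ Inl i = 0) \<and>
     (\<forall>j. (H *v z + h) $ Inr j = 0)"

definition positive_semidefinite :: "real^'n^'n \<Rightarrow> bool" where
  "positive_semidefinite H \<longleftrightarrow> transpose H = H \<and> (\<forall>u. 0 \<le> u \<bullet> (H *v u))"

text \<open>
  The matrix \<open>H\<close> is singular if the constraint rows are dependent. LICQ only provides definiteness on
  the vectors supported where the gradient \<open>H z + h\<close> vanishes.
\<close>

definition nondegenerate :: "real^('i::finite + 'e::finite)^('i + 'e) \<Rightarrow> real^('i + 'e) \<Rightarrow> real^('i + 'e) \<Rightarrow> bool" where
  "nondegenerate H h z \<longleftrightarrow>
     (\<forall>u. (\<forall>i. (H *v z + h) $ Inl i \<noteq> 0 \<longrightarrow> u $ Inl i = 0) \<and> u \<bullet> (H *v u) = 0 \<longrightarrow> u = 0)"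

lemma quadratic_expansion:
  fixes H :: "real^'n^'n"
  assumes "transpose H = H"
  shows "1/2 * ((z + d) \<bullet> (H *v (z + d))) + h \<bullet> (z + d) =
    (1/2 * (z \<bullet> (H *v z)) + h \<bullet> z) + (H *v z + h) \<bullet> d + 1/2 * (d \<bullet> (H *v d))"
  using symmetric_matrix_dot[OF assms, of z d]
  by (simp add: matrix_vector_right_distrib inner_add_left inner_add_right inner_commute field_simps)

text \<open>
  A negative slope at \<open>0\<close> would dominate the quadratic term for small \<open>t\<close>.
\<close>

lemma first_order_condition:
  fixes H :: "real^'n^'n"
  assumes sym: "transpose H = H" and "t0 > 0"
    and min: "\<And>t. 0 < t \<Longrightarrow> t \<le> t0 \<Longrightarrow>
      1/2 * (z \<bullet> (H *v z)) + h \<bullet> z \<le> 1/2 * ((z + t *\<^sub>R d) \<bullet> (H *v (z + t *\<^sub>R d))) + h \<bullet> (z + t *\<^sub>R d)"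
  shows "0 \<le> (H *v z + h) \<bullet> d"
proof (rule ccontr)
  define a where "a = (H *v z + h) \<bullet> d"
  define c where "c = \<bar>d \<bullet> (H *v d)\<bar> / 2 + 1"
  assume "\<not> 0 \<le> (H *v z + h) \<bullet> d"
  then have a: "a < 0" by (simp add: a_def)
  have c: "c > 0" by (simp add: c_def add_nonneg_pos)
  define t where "t = min t0 (- a / (2 * c))"
  have t: "0 < t" "t \<le> t0" using a c \<open>t0 > 0\<close> by (auto simp: t_def divide_neg_pos)
  have "t * c \<le> - a / 2"
    using c by (simp add: t_def min_def field_simps split: if_splits)
  have "0 \<le> t * a + t * t * (d \<bullet> (H *v d)) / 2"
    using min[OF t] unfolding quadratic_expansion[OF sym, of z "t *\<^sub>R d"]
    by (simp add: a_def matrix_vector_mult_scaleR)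
  also have "\<dots> \<le> t * a + t * t * c"
    using t by (simp add: c_def mult_left_mono)
  also have "\<dots> = t * (a + t * c)" by (simp add: algebra_simps)
  also have "\<dots> < 0"
    using t a \<open>t * c \<le> - a / 2\<close> by (intro mult_pos_neg) auto
  finally show False by simp
qed

text \<open>
  Necessity tests the minimiser with the directions along the coordinate axes that keep it in the
  cone. Sufficiency holds because the second-order term of the objective is nonnegative.
\<close>

lemma dual_optimizer_iff_lcp_solution:
  assumes "positive_semidefinite H"
  shows "dual_optimizer H h z \<longleftrightarrow> lcp_solution H h z"
proof -
  let ?f = "\<lambda>z. 1/2 * (z \<bullet> (H *v z)) + h \<bullet> z"
  let ?s = "H *v z + h"
  have sym: "transpose H = H" and pos: "0 \<le> u \<bullet> (H *v u)" for u
    using assms by (auto simp: positive_semidefinite_def)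
  show ?thesis
  proof
    assume opt: "dual_optimizer H h z"
    then have z: "0 \<le> z $ Inl i" for i
      unfolding dual_optimizer_def is_arg_min_def E_mat_nonneg_iff by auto
    have dir: "0 \<le> ?s \<bullet> d" if "\<And>i. 0 \<le> (z + d) $ Inl i" for d
    proof (rule first_order_condition[OF sym, of 1])
      fix t :: real assume t: "0 < t" "t \<le> 1"
      have "0 \<le> (z + t *\<^sub>R d) $ Inl i" for i
      proof -
        have "(z + t *\<^sub>R d) $ Inl i = (1 - t) * z $ Inl i + t * (z + d) $ Inl i"
          by (simp add: algebra_simps)
        then show ?thesis using t z[of i] that[of i] by simp
      qed
      then show "?f z \<le> ?f (z + t *\<^sub>R d)"
        using opt unfolding dual_optimizer_def is_arg_min_def E_mat_nonneg_iff not_less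
        by (meson linorder_not_less)
    qed simp
    have ax: "?s \<bullet> (c *\<^sub>R axis r 1) = c * ?s $ r" for c r
      by (simp add: inner_axis)
    have "?s $ Inr j = 0" for j
      using dir[of "1 *\<^sub>R axis (Inr j) 1"] dir[of "(-1) *\<^sub>R axis (Inr j) 1"] z
      unfolding ax by (simp add: axis_def)
    moreover have "0 \<le> ?s $ Inl i" for i
      using dir[of "1 *\<^sub>R axis (Inl i) 1"] z unfolding ax by (simp add: axis_def)
    moreover have "z $ Inl i * ?s $ Inl i \<le> 0" for i
      using dir[of "(- z $ Inl i) *\<^sub>R axis (Inl i) 1"] z unfolding ax by (simp add: axis_def)
    ultimately show "lcp_solution H h z"
      using z unfolding lcp_solution_def by (smt (verit) mult_nonneg_nonneg)
  next
    assume lcp: "lcp_solution H h z"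
    have "?f z \<le> ?f z'" if z': "\<And>i. 0 \<le> z' $ Inl i" for z'
    proof -
      have "0 \<le> ?s $ r * (z' - z) $ r" for r
      proof (cases r)
        case (Inl i)
        have "0 \<le> ?s $ Inl i" "?s $ Inl i * z $ Inl i = 0"
          using lcp unfolding lcp_solution_def by (metis mult.commute)+
        then have "0 \<le> ?s $ Inl i * z' $ Inl i - ?s $ Inl i * z $ Inl i"
          using mult_nonneg_nonneg[OF _ z', of "?s $ Inl i" i] by linarith
        then show ?thesis
          unfolding Inl vector_minus_component right_diff_distrib .
      qed (use lcp in \<open>auto simp: lcp_solution_def\<close>)
      then have "0 \<le> ?s \<bullet> (z' - z)"
        unfolding inner_vec_def by (intro sum_nonneg) simp
      then show ?thesis
        using quadratic_expansion[OF sym, of z "z' - z" h] pos[of "z' - z"] by simp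
    qed
    then show "dual_optimizer H h z"
      using lcp unfolding dual_optimizer_def is_arg_min_def E_mat_nonneg_iff lcp_solution_def
      by (meson not_less)
  qed
qed

text \<open>
  By complementarity, \<open>- (z - z') \<bullet> (s - s')\<close> is a sum of nonnegative cross products, so it bounds each
  of them. The data of the two problems may differ, which makes the estimate fit for perturbations.
\<close>

lemma lcp_solution_cross:
  assumes "lcp_solution H h z" "lcp_solution H' h' z'"
  defines "s \<equiv> H *v z + h" and "s' \<equiv> H' *v z' + h'"
  shows "z $ Inl i * s' $ Inl i + z' $ Inl i * s $ Inl i \<le> - ((z - z') \<bullet> (s - s'))"
proof -
  have lcp: "0 \<le> z $ Inl i" "0 \<le> s $ Inl i" "z $ Inl i * s $ Inl i = 0" "s $ Inr j = 0"
    "0 \<le> z' $ Inl i" "0 \<le> s' $ Inl i" "z' $ Inl i * s' $ Inl i = 0" "s' $ Inr j = 0" for i j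
    using assms(1,2) unfolding lcp_solution_def s_def[symmetric] s'_def[symmetric] by blast+
  have comp: "- ((z - z') $ r * (s - s') $ r) = z $ r * s' $ r + z' $ r * s $ r" for r
  proof (cases r)
    case (Inl i)
    have "- ((z - z') $ r * (s - s') $ r) = z $ r * s' $ r + z' $ r * s $ r - z $ r * s $ r - z' $ r * s' $ r"
      by (simp add: algebra_simps)
    then show ?thesis using lcp(3)[of i] lcp(7)[of i] unfolding Inl by linarith
  qed (use lcp in simp)
  have nn: "0 \<le> z $ r * s' $ r + z' $ r * s $ r" for r
    using lcp by (cases r) (simp_all add: add_nonneg_nonneg)
  have "- ((z - z') \<bullet> (s - s')) = (\<Sum>r\<in>UNIV. z $ r * s' $ r + z' $ r * s $ r)"
    unfolding inner_vec_def by (simp add: comp[symmetric] sum_negf)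
  moreover have "z $ Inl i * s' $ Inl i + z' $ Inl i * s $ Inl i \<le> (\<Sum>r\<in>UNIV. z $ r * s' $ r + z' $ r * s $ r)"
    by (rule member_le_sum[where f = "\<lambda>r. z $ r * s' $ r + z' $ r * s $ r"]) (use nn in auto)
  ultimately show ?thesis by (simp only:)
qed

lemma lcp_solution_monotone:
  fixes z z' :: "real^('i::finite + 'e::finite)"
  assumes "lcp_solution H h z" "lcp_solution H' h' z'"
  shows "(z - z') \<bullet> ((H *v z + h) - (H' *v z' + h')) \<le> 0"
proof -
  fix i :: 'i
  have "0 \<le> z $ Inl i" "0 \<le> z' $ Inl i" "0 \<le> (H' *v z' + h') $ Inl i" "0 \<le> (H *v z + h) $ Inl i"
    using assms unfolding lcp_solution_def by blast+
  then have "0 \<le> z $ Inl i * (H' *v z' + h') $ Inl i + z' $ Inl i * (H *v z + h) $ Inl i"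
    by (intro add_nonneg_nonneg mult_nonneg_nonneg)
  from order_trans[OF this lcp_solution_cross[OF assms]] show ?thesis
    by (simp only: neg_0_le_iff_le)
qed

text \<open>
  For equal data, \<open>s - s' = H (z - z')\<close>. Monotonicity gives \<open>z - z'\<close> zero energy, and then the
  vanishing cross products show that \<open>z - z'\<close> is zero wherever the gradient is not.
\<close>

lemma lcp_solution_unique:
  assumes "positive_semidefinite H" "nondegenerate H h z" "lcp_solution H h z" "lcp_solution H h z'"
  shows "z' = z"
proof -
  let ?s = "H *v z + h"
  let ?s' = "H *v z' + h"
  have eq: "(z - z') \<bullet> (?s - ?s') = (z - z') \<bullet> (H *v (z - z'))"
    by (simp add: matrix_vector_mult_diff_distrib)
  have "(z - z') \<bullet> (H *v (z - z')) = 0"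
    using lcp_solution_monotone[OF assms(3,4)] assms(1) eq unfolding positive_semidefinite_def
    by (metis order_antisym)
  moreover have "(z - z') $ Inl i = 0" if "?s $ Inl i \<noteq> 0" for i
  proof -
    have "z $ Inl i * ?s' $ Inl i + z' $ Inl i * ?s $ Inl i \<le> 0"
      using lcp_solution_cross[OF assms(3,4), of i] eq calculation by simp
    moreover have "0 \<le> z $ Inl i * ?s' $ Inl i" "0 \<le> z' $ Inl i * ?s $ Inl i"
      using assms(3,4) by (auto simp: lcp_solution_def)
    ultimately have "z' $ Inl i * ?s $ Inl i = 0" by linarith
    with that have "z' $ Inl i = 0" by simp
    moreover have "z $ Inl i = 0"
      using that assms(3) by (auto simp: lcp_solution_def)
    ultimately show ?thesis by simp
  qed
  ultimately have "z - z' = 0"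
    using assms(2) unfolding nondegenerate_def by blast
  then show ?thesis by simp
qed

section \<open>The primal program and its multipliers\<close>

lemma positive_definite_bounded_below:
  fixes Q :: "real^'n^'n"
  assumes "positive_definite Q"
  obtains m where "m > 0" "\<And>v. m * (norm v)\<^sup>2 \<le> v \<bullet> (Q *v v)"
proof -
  have "continuous_on (sphere 0 1) (\<lambda>v. v \<bullet> (Q *v v))"
    by (intro continuous_intros)
  moreover have "sphere (0::real^'n) 1 \<noteq> {}" by simp
  ultimately obtain v0 where v0: "v0 \<in> sphere 0 1"
    and min: "\<And>v. v \<in> sphere 0 1 \<Longrightarrow> v0 \<bullet> (Q *v v0) \<le> v \<bullet> (Q *v v)"
    using continuous_attains_inf[of "sphere (0::real^'n) 1"] compact_sphere by blast
  have "v0 \<noteq> 0" using v0 by auto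
  then have "v0 \<bullet> (Q *v v0) > 0"
    using assms by (simp add: positive_definite_def)
  moreover have "v0 \<bullet> (Q *v v0) * (norm v)\<^sup>2 \<le> v \<bullet> (Q *v v)" for v
  proof (cases "v = 0")
    case False
    have "v0 \<bullet> (Q *v v0) \<le> (v /\<^sub>R norm v) \<bullet> (Q *v (v /\<^sub>R norm v))"
      using False by (intro min) simp
    also have "\<dots> = (v \<bullet> (Q *v v)) / (norm v)\<^sup>2"
      by (simp add: matrix_vector_mult_scaleR power2_eq_square field_simps)
    finally show ?thesis using False by (simp add: field_simps)
  qed simp
  ultimately show ?thesis using that by blast
qed

text \<open>
  The quadratic term dominates at infinity, so the objective has bounded sublevel sets.
\<close>

lemma primal_optimizer_exists:
  assumes Q: "positive_definite Q" and feas: "primal_feasible F \<phi> G g y1"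
  shows "\<exists>y. primal_optimizer Q q F \<phi> G g y"
proof -
  define f where "f y = 1/2 * (y \<bullet> (Q *v y)) + q \<bullet> y" for y
  obtain m where m: "m > 0" "\<And>v. m * (norm v)\<^sup>2 \<le> v \<bullet> (Q *v v)"
    using positive_definite_bounded_below[OF Q] by blast
  define S where "S = {y. primal_feasible F \<phi> G g y} \<inter> {y. f y \<le> f y1}"
  have cont: "continuous_on UNIV f"
    unfolding f_def by (intro continuous_intros)
  have "closed {y. G *v y \<le> g}"
    by (simp add: less_eq_vec_def Collect_all_eq closed_INT closed_Collect_le continuous_intros)
  moreover have "closed {y. F *v y = \<phi>}"
    by (intro closed_Collect_eq continuous_intros)
  moreover have "{y. primal_feasible F \<phi> G g y} = {y. F *v y = \<phi>} \<inter> {y. G *v y \<le> g}"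
    by (auto simp: primal_feasible_def)
  moreover have "closed {y. f y \<le> f y1}"
    by (intro closed_Collect_le cont continuous_intros)
  ultimately have "closed S" by (auto simp: S_def)
  moreover have "bounded S"
  proof (rule boundedI)
    fix y assume "y \<in> S"
    then have "f y \<le> f y1" by (simp add: S_def)
    then have "m * (norm y)\<^sup>2 / 2 - norm q * norm y \<le> f y1"
      using m(2)[of y] Cauchy_Schwarz_ineq2[of q y] by (simp add: f_def abs_le_iff)
    then have bound: "m * (norm y)\<^sup>2 \<le> 2 * norm q * norm y + 2 * \<bar>f y1\<bar>" by simp
    show "norm y \<le> (2 * norm q + 2 * \<bar>f y1\<bar>) / m + 1"
    proof (cases "norm y \<le> 1")
      case True
      then show ?thesis using m(1) by (simp add: add_increasing)
    next
      case False
      then have "2 * \<bar>f y1\<bar> \<le> 2 * \<bar>f y1\<bar> * norm y"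
        using mult_left_mono[of 1 "norm y" "2 * \<bar>f y1\<bar>"] by simp
      then have "m * norm y * norm y \<le> (2 * norm q + 2 * \<bar>f y1\<bar>) * norm y"
        using bound by (simp add: power2_eq_square algebra_simps)
      then have "m * norm y \<le> 2 * norm q + 2 * \<bar>f y1\<bar>"
        using False zero_less_norm_iff[of y] by (auto simp: mult_le_cancel_right)
      then have "norm y \<le> (2 * norm q + 2 * \<bar>f y1\<bar>) / m"
        using m(1) by (simp add: field_simps)
      then show ?thesis by simp
    qed
  qed
  moreover have "y1 \<in> S" using feas by (simp add: S_def)
  ultimately obtain y where "y \<in> S" and min: "\<And>y'. y' \<in> S \<Longrightarrow> f y \<le> f y'"
    using continuous_attains_inf[of S f] continuous_on_subset[OF cont]
    by (metis compact_eq_bounded_closed empty_iff subset_UNIV)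
  have "f y \<le> f y'" if "primal_feasible F \<phi> G g y'" for y'
  proof (cases "f y' \<le> f y1")
    case False
    then show ?thesis using min[OF \<open>y1 \<in> S\<close>] by simp
  qed (use min that in \<open>auto simp: S_def\<close>)
  then show ?thesis
    using \<open>y \<in> S\<close> unfolding primal_optimizer_def is_arg_min_def S_def f_def
    by (auto simp: not_less)
qed

lemma transpose_mult_as_row_sum:
  fixes M :: "real^'n^'m"
  shows "transpose M *v u = (\<Sum>r\<in>UNIV. u $ r *\<^sub>R row r M)"
  by (simp add: vec_eq_iff matrix_vector_mult_def transpose_def row_def mult.commute)

lemma row_inner: "row r M \<bullet> v = (M *v v) $ r" for M :: "real^'n^'m"
  by (simp add: matrix_mult_dot row_def)

definition active_rows :: "real^'y^'e \<Rightarrow> real^'y^'i \<Rightarrow> real^'i \<Rightarrow> real^'y \<Rightarrow> ('i::finite + 'e::finite) set" where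
  "active_rows F G g y = {Inl i |i. (G *v y) $ i = g $ i} \<union> range Inr"

lemma licq_altdef:
  "licq F G g y \<longleftrightarrow> inj_on (\<lambda>r. row r (stack_vec G F)) (active_rows F G g y) \<and>
     independent ((\<lambda>r. row r (stack_vec G F)) ` active_rows F G g y)"
  by (simp add: licq_def active_rows_def Let_def)

lemma licq_transpose_injective:
  assumes licq: "licq F G g y" and u: "\<And>r. r \<notin> active_rows F G g y \<Longrightarrow> u $ r = 0"
    and zero: "transpose (stack_vec G F) *v u = 0"
  shows "u = 0"
proof -
  define rw where "rw = (\<lambda>r. row r (stack_vec G F))"
  let ?K = "active_rows F G g y"
  have inj: "inj_on rw ?K" and ind: "independent (rw ` ?K)"
    using licq by (simp_all add: licq_altdef rw_def)
  have "0 = (\<Sum>r\<in>UNIV. u $ r *\<^sub>R rw r)"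
    using zero by (simp add: transpose_mult_as_row_sum rw_def)
  also have "\<dots> = (\<Sum>r\<in>?K. u $ r *\<^sub>R rw r)"
    by (rule sum.mono_neutral_right) (use u in auto)
  also have "\<dots> = (\<Sum>a\<in>rw ` ?K. u $ (inv_into ?K rw a) *\<^sub>R a)"
    using inj by (simp add: sum.reindex)
  finally have "\<forall>a\<in>rw ` ?K. u $ (inv_into ?K rw a) = 0"
    using ind[unfolded independent_explicit_finite_subsets, rule_format, of "rw ` ?K" "\<lambda>a. u $ (inv_into ?K rw a)"]
    by simp
  then have "u $ r = 0" if "r \<in> ?K" for r
    using that inj by simp
  then show ?thesis
    using u by (metis vec_eq_iff zero_index)
qed

text \<open>
  The component of the negative gradient orthogonal to all active rows is a feasible direction of
  descent, so it vanishes and the negative gradient is a combination of active rows. Linear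
  independence also gives the signs: some direction leaves the constraint \<open>i\<close> inwards and stays on all
  the other active ones, and the objective cannot decrease along it.
\<close>

lemma primal_optimizer_multipliers:
  assumes Q: "positive_definite Q" and opt: "primal_optimizer Q q F \<phi> G g y" and licq: "licq F G g y"
  obtains u :: "real^('i::finite + 'e::finite)" where "Q *v y + q + transpose (stack_vec G F) *v u = 0"
    "\<And>i. 0 \<le> u $ Inl i" "\<And>i. (G *v y) $ i \<noteq> g $ i \<Longrightarrow> u $ Inl i = 0"
proof -
  define M where "M = stack_vec G F"
  define d where "d = Q *v y + q"
  let ?K = "active_rows F G g y"
  define rw where "rw = (\<lambda>r. row r M)"
  have inj: "inj_on rw ?K" and ind: "independent (rw ` ?K)"
    using licq by (simp_all add: licq_altdef rw_def M_def)
  have sym: "transpose Q = Q" using Q by (simp add: positive_definite_def)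
  have feas: "F *v y = \<phi>" "(G *v y) $ i \<le> g $ i" for i
    using opt by (auto simp: primal_optimizer_def is_arg_min_def primal_feasible_def less_eq_vec_def)
  have rw: "rw (Inl i) \<bullet> v = (G *v v) $ i" "rw (Inr j) \<bullet> v = (F *v v) $ j" for i j v
    by (simp_all add: rw_def row_inner M_def stack_vec_mult_vec)
  have descent: "0 \<le> d \<bullet> v"
    if act: "\<And>i. Inl i \<in> ?K \<Longrightarrow> rw (Inl i) \<bullet> v \<le> 0" and eq: "\<And>j. rw (Inr j) \<bullet> v = 0" for v
  proof -
    have "\<exists>t0>0. \<forall>t. 0 < t \<and> t \<le> t0 \<longrightarrow> (G *v (y + t *\<^sub>R v)) $ i \<le> g $ i" for i
    proof (cases "(G *v y) $ i = g $ i")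
      case True
      then have "(G *v v) $ i \<le> 0" using act[of i] rw(1) by (simp add: active_rows_def)
      then show ?thesis
        using True by (intro exI[of _ 1])
          (simp add: matrix_vector_right_distrib matrix_vector_mult_scaleR mult_nonneg_nonpos)
    next
      case False
      define c where "c = g $ i - (G *v y) $ i"
      have c: "c > 0" using False feas(2)[of i] by (simp add: c_def)
      have "t * (G *v v) $ i \<le> c" if t: "0 < t" "t \<le> c / (\<bar>(G *v v) $ i\<bar> + 1)" for t
      proof -
        have "t * (G *v v) $ i \<le> t * (\<bar>(G *v v) $ i\<bar> + 1)"
          using t(1) by (intro mult_left_mono) auto
        also have "\<dots> \<le> c" using t(2) by (simp add: field_simps)
        finally show ?thesis .
      qed
      then show ?thesis
        using c by (intro exI[of _ "c / (\<bar>(G *v v) $ i\<bar> + 1)"])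
          (force simp: matrix_vector_right_distrib matrix_vector_mult_scaleR c_def add_nonneg_pos)
    qed
    then obtain t0 where t0: "\<And>i. t0 i > 0"
      "\<And>i t. 0 < t \<Longrightarrow> t \<le> t0 i \<Longrightarrow> (G *v (y + t *\<^sub>R v)) $ i \<le> g $ i"
      by metis
    have "0 \<le> (Q *v y + q) \<bullet> v"
    proof (rule first_order_condition[OF sym, of "Min (range t0)"])
      show "0 < Min (range t0)" using t0(1) by (subst Min_gr_iff) auto
      fix t assume t: "0 < t" "t \<le> Min (range t0)"
      have "F *v v = 0" using eq rw(2) by (simp add: vec_eq_iff)
      then have "primal_feasible F \<phi> G g (y + t *\<^sub>R v)"
        using t t0(2) feas(1)
        by (simp add: primal_feasible_def less_eq_vec_def matrix_vector_right_distrib matrix_vector_mult_scaleR)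
      then show "1/2 * (y \<bullet> (Q *v y)) + q \<bullet> y \<le> 1/2 * ((y + t *\<^sub>R v) \<bullet> (Q *v (y + t *\<^sub>R v))) + q \<bullet> (y + t *\<^sub>R v)"
        using opt unfolding primal_optimizer_def is_arg_min_def by (meson not_less)
    qed
    then show ?thesis by (simp add: d_def)
  qed
  have "- d \<in> span (rw ` ?K)"
  proof -
    obtain p v where p: "p \<in> span (rw ` ?K)" and v: "\<And>w. w \<in> span (rw ` ?K) \<Longrightarrow> orthogonal v w"
      and pv: "- d = p + v"
      using orthogonal_subspace_decomp_exists[of "rw ` ?K" "- d"] by metis
    have "rw r \<bullet> v = 0" if "r \<in> ?K" for r
      using v[of "rw r"] that by (simp add: orthogonal_def inner_commute span_base)
    then have "0 \<le> d \<bullet> v"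
      by (intro descent) (auto simp: active_rows_def)
    moreover have "p \<bullet> v = 0" using v[OF p] by (simp add: orthogonal_def inner_commute)
    then have "d \<bullet> v = - (v \<bullet> v)"
      using arg_cong[OF pv, of "\<lambda>x. x \<bullet> v"] by (simp add: inner_add_left)
    ultimately have "v = 0" by (metis inner_eq_zero_iff inner_ge_zero neg_0_le_iff_le order_antisym)
    with p pv show ?thesis by simp
  qed
  then obtain c where c: "- d = (\<Sum>a\<in>rw ` ?K. c a *\<^sub>R a)"
    using span_finite[of "rw ` ?K"] by auto
  define u where "u = (\<chi> r. if r \<in> ?K then c (rw r) else 0)"
  have "transpose M *v u = (\<Sum>r\<in>?K. u $ r *\<^sub>R rw r)"
    unfolding transpose_mult_as_row_sum rw_def
    by (rule sum.mono_neutral_right) (auto simp: u_def)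
  also have "\<dots> = - d"
    unfolding c by (simp add: sum.reindex[OF inj] u_def)
  finally have Mu: "transpose M *v u = - d" .
  show ?thesis
  proof (rule that[of u])
    show "Q *v y + q + transpose (stack_vec G F) *v u = 0"
      using Mu by (simp add: M_def d_def)
    show "u $ Inl i = 0" if "(G *v y) $ i \<noteq> g $ i" for i
      using that by (auto simp: u_def active_rows_def)
    show "0 \<le> u $ Inl i" for i
    proof (cases "Inl i \<in> ?K")
      case True
      \<comment> \<open>The part \<open>v\<close> of row \<open>i\<close> orthogonal to the other active rows is nonzero; moving along \<open>- v\<close> relaxes
          constraint \<open>i\<close> only.\<close>
      let ?R = "rw ` (?K - {Inl i})"
      have "rw (Inl i) \<notin> span ?R"
        using ind True inj by (auto simp: dependent_def inj_on_image_set_diff[OF inj])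
      obtain p v where p: "p \<in> span ?R" and v: "\<And>w. w \<in> span ?R \<Longrightarrow> orthogonal v w"
        and pv: "rw (Inl i) = p + v"
        using orthogonal_subspace_decomp_exists[of ?R "rw (Inl i)"] by metis
      have "v \<noteq> 0" using p pv \<open>rw (Inl i) \<notin> span ?R\<close> by auto
      have other: "rw r \<bullet> v = 0" if "r \<in> ?K" "r \<noteq> Inl i" for r
        using v[of "rw r"] that by (simp add: orthogonal_def inner_commute span_base)
      have "p \<bullet> v = 0" using v[OF p] by (simp add: orthogonal_def inner_commute)
      then have self: "rw (Inl i) \<bullet> v = v \<bullet> v" by (simp add: pv inner_add_left)
      have "0 \<le> d \<bullet> (- v)"
      proof (rule descent)
        show "rw (Inl k) \<bullet> (- v) \<le> 0" if "Inl k \<in> ?K" for k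
          using other[OF that] self by (cases "k = i") auto
        show "rw (Inr j) \<bullet> (- v) = 0" for j
          using other[of "Inr j"] by (simp add: active_rows_def)
      qed
      also have "d \<bullet> (- v) = (transpose M *v u) \<bullet> v" by (simp add: Mu)
      also have "\<dots> = (\<Sum>r\<in>UNIV. u $ r * (rw r \<bullet> v))"
        by (simp add: transpose_mult_as_row_sum inner_sum_left rw_def)
      also have "\<dots> = (\<Sum>r\<in>{Inl i}. u $ r * (rw r \<bullet> v))"
        by (rule sum.mono_neutral_right) (use other in \<open>auto simp: u_def\<close>)
      finally have "0 \<le> u $ Inl i * (v \<bullet> v)" by (simp add: self)
      then show ?thesis using inner_gt_zero_iff[of v] \<open>v \<noteq> 0\<close> by (simp add: zero_le_mult_iff del: inner_gt_zero_iff)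
    qed (simp add: u_def)
  qed
qed

text \<open>
  The link between the two programs: dual gradient and primal slack coincide at the stationary point
  of the Lagrangian.
\<close>

lemma dual_slack:
  assumes Q: "positive_definite Q" and y: "Q *v y + q + transpose (stack_vec G F) *v z = 0"
  shows "dual_H Q F G *v z + dual_h Q q F \<phi> G g = stack_vec g \<phi> - stack_vec G F *v y"
proof -
  have "matrix_inv Q *v (transpose (stack_vec G F) *v z + q) = matrix_inv Q *v (Q *v (- y))"
    using y by (intro arg_cong[of _ _ "(*v) (matrix_inv Q)"])
      (simp add: mult_minus_vec eq_neg_iff_add_eq_0 add_ac)
  also have "\<dots> = - y"
    by (rule matrix_inv_vec[OF positive_definite_invertible[OF Q]])
  finally have inv: "matrix_inv Q *v (transpose (stack_vec G F) *v z + q) = - y" .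
  have "dual_H Q F G *v z + dual_h Q q F \<phi> G g =
      stack_vec G F *v (matrix_inv Q *v (transpose (stack_vec G F) *v z + q)) + stack_vec g \<phi>"
    unfolding dual_H_factorisation dual_h_factorisation matrix_vector_mul_assoc[symmetric]
      matrix_vector_right_distrib by (simp only: add.assoc)
  then show ?thesis
    by (simp add: inv mult_minus_vec)
qed

lemma stationary_point:
  assumes "positive_definite Q"
  obtains y where "Q *v y + q + transpose (stack_vec G F) *v z = 0"
proof
  let ?a = "q + transpose (stack_vec G F) *v z"
  show "Q *v (matrix_inv Q *v (- ?a)) + q + transpose (stack_vec G F) *v z = 0"
    by (simp only: matrix_inv_vec[OF positive_definite_invertible[OF assms]] add.assoc) simp
qed

lemma multipliers_imp_lcp_solution:
  assumes Q: "positive_definite Q" and opt: "primal_optimizer Q q F \<phi> G g y"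
    and y: "Q *v y + q + transpose (stack_vec G F) *v z = 0"
    and z: "\<And>i. 0 \<le> z $ Inl i" "\<And>i. (G *v y) $ i \<noteq> g $ i \<Longrightarrow> z $ Inl i = 0"
  shows "lcp_solution (dual_H Q F G) (dual_h Q q F \<phi> G g) z"
  using opt z unfolding lcp_solution_def dual_slack[OF Q y]
  by (auto simp: stack_vec_mult_vec primal_optimizer_def is_arg_min_def primal_feasible_def less_eq_vec_def)

lemma dual_H_quadratic_form:
  fixes F :: "real^'y^'e" and G :: "real^'y^'i"
  assumes Q: "positive_definite Q"
  defines "x \<equiv> \<lambda>u. matrix_inv Q *v (transpose (stack_vec G F) *v u)"
  shows "u \<bullet> (dual_H Q F G *v v) = x u \<bullet> (Q *v x v)"
proof -
  have inv: "Q *v x v = transpose (stack_vec G F) *v v" for v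
    unfolding x_def by (rule matrix_inv_vec[OF positive_definite_invertible[OF Q]])
  have "u \<bullet> (dual_H Q F G *v v) = (transpose (stack_vec G F) *v u) \<bullet> x v"
    unfolding dual_H_factorisation x_def matrix_vector_mul_assoc[symmetric]
    by (rule dot_matrix_transpose)
  also have "\<dots> = x u \<bullet> (Q *v x v)"
    unfolding inv[symmetric] using Q
    by (intro symmetric_matrix_dot[symmetric]) (simp add: positive_definite_def)
  finally show ?thesis .
qed

lemma dual_H_positive_semidefinite:
  assumes Q: "positive_definite Q"
  shows "positive_semidefinite (dual_H Q F G)"
proof -
  have "u \<bullet> (dual_H Q F G *v v) = (dual_H Q F G *v u) \<bullet> v" for u v
    unfolding dual_H_quadratic_form[OF Q] inner_commute[of "dual_H Q F G *v u"]
    using symmetric_matrix_dot[of Q] Q unfolding positive_definite_def by (metis inner_commute)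
  then have "transpose (dual_H Q F G) *v u = dual_H Q F G *v u" for u
    by (metis dot_matrix_transpose vector_eq_rdot)
  then have "transpose (dual_H Q F G) = dual_H Q F G"
    by (simp add: matrix_eq)
  moreover have "0 \<le> u \<bullet> (dual_H Q F G *v u)" for u
    unfolding dual_H_quadratic_form[OF Q] using Q
    by (metis inner_zero_left less_imp_le order_refl positive_definite_def)
  ultimately show ?thesis by (simp add: positive_semidefinite_def)
qed

text \<open>
  Zero energy means that \<open>M\<^sup>T u\<close> vanishes, because \<open>Q\<close> is definite; the gradient vanishes exactly at the
  active constraints, so \<open>u\<close> is a vanishing combination of active rows.
\<close>

lemma licq_imp_nondegenerate:
  assumes Q: "positive_definite Q" and y: "Q *v y + q + transpose (stack_vec G F) *v z = 0"
    and licq: "licq F G g y"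
  shows "nondegenerate (dual_H Q F G) (dual_h Q q F \<phi> G g) z"
  unfolding nondegenerate_def
proof (intro allI impI, elim conjE)
  fix u
  assume supp: "\<forall>i. (dual_H Q F G *v z + dual_h Q q F \<phi> G g) $ Inl i \<noteq> 0 \<longrightarrow> u $ Inl i = 0"
    and quad: "u \<bullet> (dual_H Q F G *v u) = 0"
  have "matrix_inv Q *v (transpose (stack_vec G F) *v u) = 0"
    using quad Q unfolding dual_H_quadratic_form[OF Q] positive_definite_def by (metis less_irrefl)
  then have 1: "transpose (stack_vec G F) *v u = 0"
    using matrix_inv_vec(1)[OF positive_definite_invertible[OF Q]] by (metis matrix_vector_mult_0_right)
  have 2: "u $ r = 0" if "r \<notin> active_rows F G g y" for r
    using that supp unfolding dual_slack[OF Q y] active_rows_def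
    by (cases r) (auto simp: stack_vec_mult_vec)
  show "u = 0" by (rule licq_transpose_injective[OF licq 2 1])
qed

lemma dual_solution_exists:
  assumes Q: "positive_definite Q" and feas: "primal_feasible F \<phi> G g y0"
    and licq: "\<And>y. primal_optimizer Q q F \<phi> G g y \<Longrightarrow> licq F G g y"
  shows "\<exists>z. lcp_solution (dual_H Q F G) (dual_h Q q F \<phi> G g) z \<and>
    nondegenerate (dual_H Q F G) (dual_h Q q F \<phi> G g) z"
proof -
  obtain y where y: "primal_optimizer Q q F \<phi> G g y"
    using primal_optimizer_exists[OF Q feas] by blast
  obtain u where u: "Q *v y + q + transpose (stack_vec G F) *v u = 0"
    "\<And>i. 0 \<le> u $ Inl i" "\<And>i. (G *v y) $ i \<noteq> g $ i \<Longrightarrow> u $ Inl i = 0"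
    by (rule primal_optimizer_multipliers[OF Q y licq[OF y]]) blast
  then show ?thesis
    by (intro exI[of _ u] conjI multipliers_imp_lcp_solution[OF Q y] licq_imp_nondegenerate[OF Q _ licq[OF y]])
qed

section \<open>Locally Lipschitz maps and matrix inversion\<close>

lemma tendsto_det:
  fixes A :: "'a \<Rightarrow> real^'n^'n"
  assumes "(A \<longlongrightarrow> A0) F"
  shows "((\<lambda>t. det (A t)) \<longlongrightarrow> det A0) F"
  unfolding det_def by (intro tendsto_intros assms)

text \<open>
  By Cramer's rule the entries of the inverse are quotients of determinants.
\<close>

lemma tendsto_matrix_inv:
  fixes A :: "'a \<Rightarrow> real^'n^'n"
  assumes A: "(A \<longlongrightarrow> A0) F" and inv: "invertible A0"
  shows "((\<lambda>t. matrix_inv (A t)) \<longlongrightarrow> matrix_inv A0) F"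
proof -
  define c where "c B i j = det (\<chi> k l. if l = i then axis j 1 $ k else B $ k $ l) / det B"
    for B :: "real^'n^'n" and i j
  have entry: "matrix_inv B $ i $ j = c B i j" if "det B \<noteq> 0" for B :: "real^'n^'n" and i j
  proof -
    have "invertible B" using that by (simp add: invertible_det_nz)
    then have "matrix_inv B *v axis j 1 = (\<chi> i. c B i j)"
      using cramer[OF that, of "matrix_inv B *v axis j 1" "axis j 1"] matrix_inv_vec(1)[of B]
      by (simp add: c_def)
    then have "(matrix_inv B *v axis j 1) $ i = c B i j" by simp
    then show ?thesis by (simp add: matrix_vector_mult_basis column_def)
  qed
  have nz: "det A0 \<noteq> 0" using inv by (simp add: invertible_det_nz)
  have ev: "\<forall>\<^sub>F t in F. det (A t) \<noteq> 0"
    using tendsto_imp_eventually_ne[OF tendsto_det[OF A] nz] .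
  have "((\<lambda>t. c (A t) i j) \<longlongrightarrow> c A0 i j) F" for i j
    unfolding c_def
    by (intro tendsto_divide tendsto_det A nz tendsto_vec_lambda) (auto intro!: tendsto_intros A)
  then have "((\<lambda>t. matrix_inv (A t) $ i $ j) \<longlongrightarrow> matrix_inv A0 $ i $ j) F" for i j
    unfolding entry[OF nz] by (rule Lim_transform_eventually)
      (use ev in \<open>auto elim!: eventually_mono simp: entry\<close>)
  then show ?thesis by (intro vec_tendstoI)
qed

lemma eventually_invertible:
  fixes A :: "'a \<Rightarrow> real^'n^'n"
  assumes "(A \<longlongrightarrow> A0) F" "invertible A0"
  shows "\<forall>\<^sub>F t in F. invertible (A t)"
  using tendsto_imp_eventually_ne[OF tendsto_det[OF assms(1)]] assms(2)
  by (simp add: invertible_det_nz)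

lemma matrix_inv_diff:
  fixes A B :: "real^'n^'n"
  assumes "invertible A" "invertible B"
  shows "matrix_inv A - matrix_inv B = - (matrix_inv A ** (A - B) ** matrix_inv B)"
proof -
  have "(matrix_inv A - matrix_inv B) *v x = - (matrix_inv A ** (A - B) ** matrix_inv B) *v x" for x
    by (simp add: matrix_vector_mul_assoc[symmetric] matrix_vector_mult_diff_rdistrib
        matrix_vector_mult_diff_distrib matrix_inv_vec assms mult_minus_vec
        matrix_vector_mult_diff_rdistrib[of 0, simplified])
  then show ?thesis by (simp add: matrix_eq)
qed

lemma bounded_bilinear_matrix_vector_mult:
  "bounded_bilinear ((*v) :: real^'n^'m \<Rightarrow> real^'n \<Rightarrow> real^'m)"
  by (rule bilinear_conv_bounded_bilinear[THEN iffD1])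
    (auto simp: bilinear_def intro!: linearI simp: algebra_simps scaleR_matrix_vector_assoc
      vec_eq_iff matrix_vector_mult_def sum_distrib_left sum.distrib)

lemma bounded_bilinear_matrix_matrix_mult:
  "bounded_bilinear ((**) :: real^'n^'m \<Rightarrow> real^'k^'n \<Rightarrow> real^'k^'m)"
  by (rule bilinear_conv_bounded_bilinear[THEN iffD1])
    (auto simp: bilinear_def intro!: linearI simp: algebra_simps
      vec_eq_iff matrix_matrix_mult_def sum_distrib_left sum.distrib)

lemmas tendsto_matrix_vector_mult = bounded_bilinear.tendsto[OF bounded_bilinear_matrix_vector_mult]
lemmas tendsto_matrix_matrix_mult = bounded_bilinear.tendsto[OF bounded_bilinear_matrix_matrix_mult]

lemma bounded_linear_transpose: "bounded_linear (transpose :: real^'n^'m \<Rightarrow> real^'m^'n)"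
  by (intro linear_conv_bounded_linear[THEN iffD1] linearI) (simp_all add: vec_eq_iff transpose_def)

lemma locally_lipschitz_on_altdef:
  "locally_lipschitz_on S f \<longleftrightarrow> (\<forall>x\<in>S. \<exists>r>0. \<exists>L\<ge>0. \<forall>y\<in>S \<inter> ball x r. \<forall>z\<in>S \<inter> ball x r.
     dist (f y) (f z) \<le> L * dist y z)"
  unfolding locally_lipschitz_on_def lipschitz_on_def by meson

lemma locally_lipschitz_on_imp_continuous_on:
  "locally_lipschitz_on S f \<Longrightarrow> continuous_on S f"
  unfolding continuous_on_def
proof
  fix x assume "locally_lipschitz_on S f" "x \<in> S"
  then obtain r L where r: "r > 0" and "L-lipschitz_on (S \<inter> ball x r) f"
    unfolding locally_lipschitz_on_def by blast
  then have "continuous_on (S \<inter> ball x r) f" by (rule_tac lipschitz_on_continuous_on)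
  then have "(f \<longlongrightarrow> f x) (at x within (S \<inter> ball x r))"
    using \<open>x \<in> S\<close> r by (simp add: continuous_on_def)
  then show "(f \<longlongrightarrow> f x) (at x within S)"
    using at_within_nhd[of x "ball x r" "S \<inter> ball x r" S] r by simp
qed

lemma locally_lipschitz_on_subset:
  "locally_lipschitz_on S f \<Longrightarrow> T \<subseteq> S \<Longrightarrow> locally_lipschitz_on T f"
  unfolding locally_lipschitz_on_def by (meson Int_mono lipschitz_on_subset order_refl subsetD)

text \<open>
  The local estimates for sums, bilinear products and inverses all have this shape.
\<close>

lemma locally_lipschitz_on_comparison:
  assumes f: "locally_lipschitz_on S f" and g: "locally_lipschitz_on S g"
    and cmp: "\<And>x. x \<in> S \<Longrightarrow> \<exists>r>0. \<exists>C\<ge>0. \<forall>y\<in>S \<inter> ball x r. \<forall>z\<in>S \<inter> ball x r.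
      dist (k y) (k z) \<le> C * (dist (f y) (f z) + dist (g y) (g z))"
  shows "locally_lipschitz_on S k"
  unfolding locally_lipschitz_on_altdef
proof
  fix x assume x: "x \<in> S"
  obtain r1 L1 where 1: "r1 > 0" "L1 \<ge> 0"
    "\<forall>y\<in>S \<inter> ball x r1. \<forall>z\<in>S \<inter> ball x r1. dist (f y) (f z) \<le> L1 * dist y z"
    using f x unfolding locally_lipschitz_on_altdef by meson
  obtain r2 L2 where 2: "r2 > 0" "L2 \<ge> 0"
    "\<forall>y\<in>S \<inter> ball x r2. \<forall>z\<in>S \<inter> ball x r2. dist (g y) (g z) \<le> L2 * dist y z"
    using g x unfolding locally_lipschitz_on_altdef by meson
  obtain r3 C where 3: "r3 > 0" "C \<ge> 0" "\<forall>y\<in>S \<inter> ball x r3. \<forall>z\<in>S \<inter> ball x r3.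
      dist (k y) (k z) \<le> C * (dist (f y) (f z) + dist (g y) (g z))"
    using cmp[OF x] by meson
  have "dist (k y) (k z) \<le> (C * (L1 + L2)) * dist y z"
    if "y \<in> S \<inter> ball x (min r1 (min r2 r3))" "z \<in> S \<inter> ball x (min r1 (min r2 r3))" for y z
  proof -
    have "dist (f y) (f z) + dist (g y) (g z) \<le> L1 * dist y z + L2 * dist y z"
      using 1(3) 2(3) that by (intro add_mono) auto
    then have "C * (dist (f y) (f z) + dist (g y) (g z)) \<le> C * (L1 * dist y z + L2 * dist y z)"
      using 3(2) by (rule mult_left_mono)
    moreover have "dist (k y) (k z) \<le> C * (dist (f y) (f z) + dist (g y) (g z))"
      using 3(3) that by auto
    ultimately show ?thesis by (simp add: algebra_simps)
  qed
  then show "\<exists>r>0. \<exists>L\<ge>0. \<forall>y\<in>S \<inter> ball x r. \<forall>z\<in>S \<inter> ball x r. dist (k y) (k z) \<le> L * dist y z"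
    using 1 2 3 by (intro exI[of _ "min r1 (min r2 r3)"] conjI exI[of _ "C * (L1 + L2)"]) auto
qed

lemma continuous_on_locally_bounded:
  fixes f :: "'a::metric_space \<Rightarrow> 'b::real_normed_vector"
  assumes "continuous_on S f" "x \<in> S"
  obtains r B where "r > 0" "B > 0" "\<And>y. y \<in> S \<inter> ball x r \<Longrightarrow> norm (f y) \<le> B"
proof -
  obtain r where r: "r > 0" "\<And>y. y \<in> S \<Longrightarrow> dist y x < r \<Longrightarrow> dist (f y) (f x) < 1"
    using assms unfolding continuous_on_iff by (metis zero_less_one)
  have "norm (f y) \<le> norm (f x) + 1" if "y \<in> S \<inter> ball x r" for y
    using r(2)[of y] that norm_triangle_ineq2[of "f y" "f x"] by (simp add: dist_commute[of _ x]) (simp add: dist_norm)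
  then show ?thesis using r(1) by (intro that[of r "norm (f x) + 1"]) (auto simp: add_nonneg_pos)
qed

lemma locally_lipschitz_on_bilinear:
  assumes p: "bounded_bilinear p" and f: "locally_lipschitz_on S f" and g: "locally_lipschitz_on S g"
  shows "locally_lipschitz_on S (\<lambda>x. p (f x) (g x))"
proof (rule locally_lipschitz_on_comparison[OF f g])
  fix x assume x: "x \<in> S"
  obtain r1 B1 where 1: "r1 > 0" "B1 > 0" "\<And>y. y \<in> S \<inter> ball x r1 \<Longrightarrow> norm (f y) \<le> B1"
    using continuous_on_locally_bounded[OF locally_lipschitz_on_imp_continuous_on[OF f] x] by metis
  obtain r2 B2 where 2: "r2 > 0" "B2 > 0" "\<And>y. y \<in> S \<inter> ball x r2 \<Longrightarrow> norm (g y) \<le> B2"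
    using continuous_on_locally_bounded[OF locally_lipschitz_on_imp_continuous_on[OF g] x] by metis
  obtain K where K: "K > 0" "\<And>a b. norm (p a b) \<le> norm a * norm b * K"
    using bounded_bilinear.pos_bounded[OF p] by blast
  have "dist (p (f y) (g y)) (p (f z) (g z)) \<le> (K * (B1 + B2)) * (dist (f y) (f z) + dist (g y) (g z))"
    if "y \<in> S \<inter> ball x (min r1 r2)" "z \<in> S \<inter> ball x (min r1 r2)" for y z
  proof -
    have "p (f y) (g y) - p (f z) (g z) = p (f y - f z) (g y) + p (f z) (g y - g z)"
      by (simp add: bounded_bilinear.diff_left[OF p] bounded_bilinear.diff_right[OF p])
    then have "norm (p (f y) (g y) - p (f z) (g z)) \<le>
        norm (f y - f z) * norm (g y) * K + norm (f z) * norm (g y - g z) * K"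
      by (simp only:) (rule order_trans[OF norm_triangle_ineq add_mono[OF K(2) K(2)]])
    also have "\<dots> \<le> norm (f y - f z) * (B1 + B2) * K + (B1 + B2) * norm (g y - g z) * K"
      using that 1(2) 1(3)[of z] 2(2) 2(3)[of y] K(1)
      by (intro add_mono mult_right_mono mult_mono) (auto intro: order_trans)
    finally show ?thesis by (simp add: dist_norm algebra_simps)
  qed
  then show "\<exists>r>0. \<exists>C\<ge>0. \<forall>y\<in>S \<inter> ball x r. \<forall>z\<in>S \<inter> ball x r.
      dist (p (f y) (g y)) (p (f z) (g z)) \<le> C * (dist (f y) (f z) + dist (g y) (g z))"
    using 1(1,2) 2(1,2) K(1)
    by (intro exI[of _ "min r1 r2"] conjI exI[of _ "K * (B1 + B2)"]) auto
qed

lemma locally_lipschitz_on_add: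
  fixes f g :: "'a::metric_space \<Rightarrow> 'b::real_normed_vector"
  assumes "locally_lipschitz_on S f" "locally_lipschitz_on S g"
  shows "locally_lipschitz_on S (\<lambda>x. f x + g x)"
  by (rule locally_lipschitz_on_comparison[OF assms])
    (intro exI[of _ 1] conjI ballI, auto simp: dist_triangle_add)

lemma locally_lipschitz_on_linear:
  assumes p: "bounded_linear p" and f: "locally_lipschitz_on S f"
  shows "locally_lipschitz_on S (\<lambda>x. p (f x))"
proof (rule locally_lipschitz_on_comparison[OF f f])
  fix x assume x: "x \<in> S"
  obtain K where K: "K > 0" "\<And>a. norm (p a) \<le> norm a * K"
    using bounded_linear.pos_bounded[OF p] by blast
  have "dist (p (f y)) (p (f z)) \<le> K * (dist (f y) (f z) + dist (f y) (f z))" for y z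
  proof -
    have "0 \<le> norm (f y - f z) * K" using K(1) by simp
    then have "norm (p (f y - f z)) \<le> norm (f y - f z) * K + norm (f y - f z) * K"
      using K(2)[of "f y - f z"] by linarith
    then show ?thesis
      by (simp only: dist_norm linear_diff[OF bounded_linear.linear[OF p]] distrib_left mult.commute)
  qed
  then show "\<exists>r>0. \<exists>C\<ge>0. \<forall>y\<in>S \<inter> ball x r. \<forall>z\<in>S \<inter> ball x r.
      dist (p (f y)) (p (f z)) \<le> C * (dist (f y) (f z) + dist (f y) (f z))"
    using K(1) by (intro exI[of _ 1] conjI exI[of _ K]) auto
qed

lemma locally_lipschitz_on_snd:
  fixes f :: "'a::metric_space \<Rightarrow> 'c::metric_space" and S :: "('b::metric_space \<times> 'a) set"
  assumes "locally_lipschitz_on UNIV f"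
  shows "locally_lipschitz_on S (\<lambda>x. f (snd x))"
  unfolding locally_lipschitz_on_altdef
proof
  fix x :: "'b \<times> 'a" assume "x \<in> S"
  obtain r L where r: "r > 0" "L \<ge> 0" "\<forall>y\<in>ball (snd x) r. \<forall>z\<in>ball (snd x) r. dist (f y) (f z) \<le> L * dist y z"
    using assms unfolding locally_lipschitz_on_altdef by (auto simp: Ball_def) metis
  have "dist (f (snd y)) (f (snd z)) \<le> L * dist y z" if "y \<in> S \<inter> ball x r" "z \<in> S \<inter> ball x r" for y z
  proof -
    have "snd y \<in> ball (snd x) r" "snd z \<in> ball (snd x) r"
      using that dist_snd_le[of x y] dist_snd_le[of x z] by auto
    then have "dist (f (snd y)) (f (snd z)) \<le> L * dist (snd y) (snd z)" using r(3) by blast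
    also have "\<dots> \<le> L * dist y z" using r(2) dist_snd_le by (intro mult_left_mono)
    finally show ?thesis .
  qed
  then show "\<exists>r>0. \<exists>L\<ge>0. \<forall>y\<in>S \<inter> ball x r. \<forall>z\<in>S \<inter> ball x r. dist (f (snd y)) (f (snd z)) \<le> L * dist y z"
    using r by blast
qed

lemma locally_lipschitz_on_matrix_inv:
  fixes A :: "'a::metric_space \<Rightarrow> real^'n^'n"
  assumes A: "locally_lipschitz_on S A" and inv: "\<And>x. x \<in> S \<Longrightarrow> invertible (A x)"
  shows "locally_lipschitz_on S (\<lambda>x. matrix_inv (A x))"
proof (rule locally_lipschitz_on_comparison[OF A A])
  fix x assume x: "x \<in> S"
  let ?I = "\<lambda>x. matrix_inv (A x)"
  have "continuous_on S ?I"
    using locally_lipschitz_on_imp_continuous_on[OF A] inv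
    unfolding continuous_on_def by (auto intro: tendsto_matrix_inv)
  then obtain r B where r: "r > 0" "B > 0" "\<And>y. y \<in> S \<inter> ball x r \<Longrightarrow> norm (?I y) \<le> B"
    using continuous_on_locally_bounded x by metis
  obtain K where K: "K > 0" "\<And>(a::real^'n^'n) (b::real^'n^'n). norm (a ** b) \<le> norm a * norm b * K"
    using bounded_bilinear.pos_bounded[OF bounded_bilinear_matrix_matrix_mult] by blast
  have "dist (?I y) (?I z) \<le> (B * B * K * K) * (dist (A y) (A z) + dist (A y) (A z))"
    if "y \<in> S \<inter> ball x r" "z \<in> S \<inter> ball x r" for y z
  proof -
    have "dist (?I y) (?I z) = norm (?I y ** (A y - A z) ** ?I z)"
      using that inv by (simp add: dist_norm matrix_inv_diff)
    also have "\<dots> \<le> norm (?I y ** (A y - A z)) * norm (?I z) * K" by (rule K(2))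
    also have "\<dots> \<le> (norm (?I y) * norm (A y - A z) * K) * norm (?I z) * K"
      using K by (intro mult_right_mono) auto
    also have "\<dots> \<le> (B * norm (A y - A z) * K) * B * K"
      using K(1) r that by (intro mult_right_mono mult_mono) auto
    also have "\<dots> = (B * B * K * K) * dist (A y) (A z)" by (simp add: dist_norm)
    also have "\<dots> \<le> (B * B * K * K) * (dist (A y) (A z) + dist (A y) (A z))"
      using K(1) r(2) by (intro mult_left_mono) auto
    finally show ?thesis .
  qed
  then show "\<exists>r>0. \<exists>C\<ge>0. \<forall>y\<in>S \<inter> ball x r. \<forall>z\<in>S \<inter> ball x r.
      dist (?I y) (?I z) \<le> C * (dist (A y) (A z) + dist (A y) (A z))"
    using r(1,2) K(1) by (intro exI[of _ r] conjI exI[of _ "B * B * K * K"]) auto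
qed

lemma LIMSEQ_if_dist_less_inverse_Suc:
  assumes "\<And>n. dist (X n) x < 1 / real (Suc n)"
  shows "X \<longlonglongrightarrow> x"
proof (rule metric_LIMSEQ_I)
  fix e :: real assume "e > 0"
  then obtain N where N: "1 / real (Suc N) < e" by (meson nat_approx_posE)
  have "dist (X n) x < e" if "n \<ge> N" for n
  proof -
    have "1 / real (Suc n) \<le> 1 / real (Suc N)" using that by (simp add: frac_le)
    then show ?thesis using N assms[of n] by simp
  qed
  then show "\<exists>N. \<forall>n\<ge>N. dist (X n) x < e" by blast
qed

section \<open>Lipschitz dependence of the dual solution\<close>

text \<open>
  The gradients differ by \<open>H (z - z')\<close> and by the perturbation \<open>\<beta>\<close> of the data at \<open>z'\<close>. The first part
  contributes the energy of \<open>z - z'\<close>, which is nonnegative; Cauchy-Schwarz bounds the second.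
\<close>

lemma lcp_solution_perturbation:
  assumes "positive_semidefinite H" and z: "lcp_solution H h z" and z': "lcp_solution H' h' z'"
  defines "\<beta> \<equiv> norm ((H - H') *v z' + (h - h'))"
  shows "(z - z') \<bullet> (H *v (z - z')) \<le> norm (z - z') * \<beta>"
    and "z $ Inl i * (H' *v z' + h') $ Inl i \<le> norm (z - z') * \<beta>"
proof -
  let ?s = "H *v z + h" and ?s' = "H' *v z' + h'"
  have "?s - ?s' = H *v (z - z') + ((H - H') *v z' + (h - h'))"
    by (simp add: algebra_simps)
  then have split: "(z - z') \<bullet> (?s - ?s') = (z - z') \<bullet> (H *v (z - z')) + (z - z') \<bullet> ((H - H') *v z' + (h - h'))"
    by (simp only: inner_add_right)
  have cs: "\<bar>(z - z') \<bullet> ((H - H') *v z' + (h - h'))\<bar> \<le> norm (z - z') * \<beta>"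
    unfolding \<beta>_def by (rule Cauchy_Schwarz_ineq2)
  show "(z - z') \<bullet> (H *v (z - z')) \<le> norm (z - z') * \<beta>"
    using lcp_solution_monotone[OF z z'] split cs by linarith
  have "0 \<le> z' $ Inl i" "0 \<le> ?s $ Inl i"
    using z z' unfolding lcp_solution_def by blast+
  then have "0 \<le> z' $ Inl i * ?s $ Inl i" by (rule mult_nonneg_nonneg)
  moreover have "0 \<le> (z - z') \<bullet> (H *v (z - z'))" using \<open>positive_semidefinite H\<close> by (simp add: positive_semidefinite_def)
  ultimately show "z $ Inl i * ?s' $ Inl i \<le> norm (z - z') * \<beta>"
    using lcp_solution_cross[OF z z', of i] split cs by linarith
qed

text \<open>
  A limit of the unit vectors \<open>u n\<close> would have zero energy and be supported where the gradient vanishes.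
  The lemma is applied to normalised differences of solutions, for continuity and for the Lipschitz
  estimate.
\<close>

lemma nondegenerate_no_null_directions:
  fixes u :: "nat \<Rightarrow> real^('i::finite + 'e::finite)"
  assumes nd: "nondegenerate H0 h0 z0" and positive_semidefinite: "positive_semidefinite H0" and H: "H \<longlonglongrightarrow> H0"
    and unit: "\<And>n. norm (u n) = 1" and quad: "\<And>n. u n \<bullet> (H n *v u n) \<le> \<epsilon> n" and \<epsilon>: "\<epsilon> \<longlonglongrightarrow> 0"
    and supp: "\<And>i. (H0 *v z0 + h0) $ Inl i \<noteq> 0 \<Longrightarrow> (\<lambda>n. u n $ Inl i) \<longlonglongrightarrow> 0"
  shows False
proof -
  have "bounded (range u)" using unit by (intro boundedI[of _ 1]) auto
  then obtain v r where r: "strict_mono r" and v: "(u \<circ> r) \<longlonglongrightarrow> v"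
    using bounded_imp_convergent_subsequence by blast
  have "(\<lambda>n. (u \<circ> r) n \<bullet> ((H \<circ> r) n *v (u \<circ> r) n)) \<longlonglongrightarrow> v \<bullet> (H0 *v v)"
    by (intro tendsto_inner tendsto_matrix_vector_mult v LIMSEQ_subseq_LIMSEQ[OF H r])
  then have "v \<bullet> (H0 *v v) \<le> 0"
    by (rule LIMSEQ_le[OF _ LIMSEQ_subseq_LIMSEQ[OF \<epsilon> r]]) (use quad in auto)
  then have "v \<bullet> (H0 *v v) = 0" using positive_semidefinite by (simp add: positive_semidefinite_def order_antisym)
  moreover have "v $ Inl i = 0" if "(H0 *v z0 + h0) $ Inl i \<noteq> 0" for i
    using LIMSEQ_unique[OF LIMSEQ_subseq_LIMSEQ[OF supp[OF that] r]] tendsto_vec_nth[OF v, of "Inl i"]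
    by (simp add: o_def)
  ultimately have "v = 0" using nd unfolding nondegenerate_def by blast
  moreover have "norm v = 1"
    using LIMSEQ_unique[OF tendsto_norm[OF v]] unit by simp
  ultimately show False by simp
qed

text \<open>
  The dual programs of the whole family, reduced to their Hessians, linear terms and nondegenerate
  solutions.
\<close>

locale parametric_lcp =
  fixes Y :: "'a::euclidean_space set"
    and H :: "'a \<Rightarrow> real^('i::finite + 'e::finite)^('i + 'e)" and h :: "'a \<Rightarrow> real^('i + 'e)"
    and z :: "'a \<Rightarrow> real^('i + 'e)"
  assumes H_lipschitz: "locally_lipschitz_on Y H" and h_lipschitz: "locally_lipschitz_on Y h"
    and positive_semidefinite: "\<And>x. x \<in> Y \<Longrightarrow> positive_semidefinite (H x)"
    and solution: "\<And>x. x \<in> Y \<Longrightarrow> lcp_solution (H x) (h x) (z x)"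
    and nondegenerate: "\<And>x. x \<in> Y \<Longrightarrow> nondegenerate (H x) (h x) (z x)"
begin

lemma tendsto_H: "(\<And>n. X n \<in> Y) \<Longrightarrow> X \<longlonglongrightarrow> x \<Longrightarrow> x \<in> Y \<Longrightarrow> (\<lambda>n. H (X n)) \<longlonglongrightarrow> H x"
  and tendsto_h: "(\<And>n. X n \<in> Y) \<Longrightarrow> X \<longlonglongrightarrow> x \<Longrightarrow> x \<in> Y \<Longrightarrow> (\<lambda>n. h (X n)) \<longlonglongrightarrow> h x"
  using locally_lipschitz_on_imp_continuous_on[OF H_lipschitz]
    locally_lipschitz_on_imp_continuous_on[OF h_lipschitz]
  unfolding continuous_on_sequentially by (auto simp: o_def)

text \<open>
  A difference to \<open>z x\<close> of length at least \<open>\<rho>\<close> has, after normalisation, energy at most \<open>\<beta> / \<rho>\<close>. Where the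
  gradient at \<open>x\<close> is positive, \<open>z x\<close> is zero and the cross product estimate bounds the component.
\<close>

lemma solution_continuous: "continuous_on Y z"
proof (rule ccontr)
  assume "\<not> continuous_on Y z"
  then obtain x \<rho> where x: "x \<in> Y" and \<rho>: "\<rho> > 0"
    and far: "\<And>d. d > 0 \<Longrightarrow> \<exists>y\<in>Y. dist y x < d \<and> \<rho> \<le> dist (z y) (z x)"
    unfolding continuous_on_iff by (metis not_less)
  have "\<exists>y\<in>Y. dist y x < 1 / real (Suc n) \<and> \<rho> \<le> dist (z y) (z x)" for n
    by (rule far) simp
  then obtain X where X: "\<And>n. X n \<in> Y" "\<And>n. dist (X n) x < 1 / real (Suc n)"
    "\<And>n. \<rho> \<le> dist (z (X n)) (z x)"
    by metis
  have lim: "X \<longlonglongrightarrow> x"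
    using X(2) by (rule LIMSEQ_if_dist_less_inverse_Suc)
  define d where "d n = norm (z (X n) - z x)" for n
  define \<beta> where "\<beta> n = norm ((H (X n) - H x) *v z x + (h (X n) - h x))" for n
  define u where "u n = (z (X n) - z x) /\<^sub>R d n" for n
  have d: "\<rho> \<le> d n" "0 < d n" for n
    using X(3)[of n] \<rho> by (auto simp: d_def dist_norm)
  have "\<beta> \<longlonglongrightarrow> norm ((H x - H x) *v z x + (h x - h x))"
    unfolding \<beta>_def
    by (intro tendsto_intros tendsto_matrix_vector_mult tendsto_H tendsto_h X lim x)
  then have \<beta>: "\<beta> \<longlonglongrightarrow> 0" by simp
  have ratio: "\<beta> n / d n \<le> \<beta> n / \<rho>" for n
    using d[of n] \<rho> by (intro divide_left_mono) (auto simp: \<beta>_def)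
  show False
  proof (rule nondegenerate_no_null_directions[OF nondegenerate[OF x] positive_semidefinite[OF x] tendsto_H[OF X(1) lim x]])
    show "norm (u n) = 1" for n using d(2)[of n] by (simp add: u_def d_def)
    show "(\<lambda>n. \<beta> n / \<rho>) \<longlonglongrightarrow> 0" using tendsto_divide[OF \<beta> tendsto_const[of \<rho>]] \<rho> by simp
    show "u n \<bullet> (H (X n) *v u n) \<le> \<beta> n / \<rho>" for n
    proof -
      have "u n \<bullet> (H (X n) *v u n) = ((z (X n) - z x) \<bullet> (H (X n) *v (z (X n) - z x))) / (d n * d n)"
        unfolding u_def by (simp add: matrix_vector_mult_scaleR divide_inverse mult_ac)
      also have "\<dots> \<le> (d n * \<beta> n) / (d n * d n)"
        unfolding d_def \<beta>_def
        by (intro divide_right_mono lcp_solution_perturbation(1)[OF positive_semidefinite solution solution] X x) simp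
      also have "\<dots> \<le> \<beta> n / \<rho>" using ratio[of n] d(2)[of n] by simp
      finally show ?thesis .
    qed
    fix i assume i: "(H x *v z x + h x) $ Inl i \<noteq> 0"
    define s where "s = (H x *v z x + h x) $ Inl i"
    have "0 \<le> s" "z x $ Inl i * s = 0"
      using solution[OF x] unfolding lcp_solution_def s_def by blast+
    then have s: "s > 0" and zx: "z x $ Inl i = 0" using i by (auto simp: s_def)
    have u: "u n $ Inl i = z (X n) $ Inl i / d n" for n
      by (simp add: u_def zx field_simps)
    show "(\<lambda>n. u n $ Inl i) \<longlonglongrightarrow> 0"
    proof (rule tendsto_sandwich[OF _ _ tendsto_const])
      show "(\<lambda>n. \<beta> n / s) \<longlonglongrightarrow> 0"
        using tendsto_divide[OF \<beta> tendsto_const[of s]] s by simp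
      have "0 \<le> z (X n) $ Inl i" for n
        using solution[OF X(1)] unfolding lcp_solution_def by blast
      then show "\<forall>\<^sub>F n in sequentially. 0 \<le> u n $ Inl i"
        using d(2) by (simp add: u less_imp_le)
      have "u n $ Inl i \<le> \<beta> n / s" for n
      proof -
        have "z (X n) $ Inl i * s \<le> d n * \<beta> n"
          unfolding s_def d_def \<beta>_def
          by (intro lcp_solution_perturbation(2) positive_semidefinite solution X x)
        then show ?thesis
          using s d(2)[of n] by (simp add: u field_simps)
      qed
      then show "\<forall>\<^sub>F n in sequentially. u n $ Inl i \<le> \<beta> n / s" by simp
    qed
  qed
qed

lemma tendsto_z: "(\<And>n. X n \<in> Y) \<Longrightarrow> X \<longlonglongrightarrow> x \<Longrightarrow> x \<in> Y \<Longrightarrow> (\<lambda>n. z (X n)) \<longlonglongrightarrow> z x"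
  using solution_continuous unfolding continuous_on_sequentially by (auto simp: o_def)

text \<open>
  Unbounded difference quotients near \<open>x\<close> would give normalised differences of energy at most
  \<open>C / (n + 1)\<close>. By continuity, both solutions vanish where the gradient at \<open>x\<close> is positive.
\<close>

lemma solution_lipschitz: "locally_lipschitz_on Y z"
proof (rule ccontr)
  assume "\<not> locally_lipschitz_on Y z"
  then obtain x where x: "x \<in> Y" and bad: "\<And>r L. r > 0 \<Longrightarrow> L \<ge> 0 \<Longrightarrow>
      \<exists>y\<in>Y \<inter> ball x r. \<exists>y'\<in>Y \<inter> ball x r. L * dist y y' < dist (z y) (z y')"
    unfolding locally_lipschitz_on_altdef by (meson not_less)
  obtain r1 L1 where 1: "r1 > 0" "L1 \<ge> 0"
    "\<And>y y'. y \<in> Y \<inter> ball x r1 \<Longrightarrow> y' \<in> Y \<inter> ball x r1 \<Longrightarrow> dist (H y) (H y') \<le> L1 * dist y y'"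
    using H_lipschitz x unfolding locally_lipschitz_on_altdef by meson
  obtain r2 L2 where 2: "r2 > 0" "L2 \<ge> 0"
    "\<And>y y'. y \<in> Y \<inter> ball x r2 \<Longrightarrow> y' \<in> Y \<inter> ball x r2 \<Longrightarrow> dist (h y) (h y') \<le> L2 * dist y y'"
    using h_lipschitz x unfolding locally_lipschitz_on_altdef by meson
  obtain r3 B where 3: "r3 > 0" "B > 0" "\<And>y. y \<in> Y \<inter> ball x r3 \<Longrightarrow> norm (z y) \<le> B"
    using continuous_on_locally_bounded[OF solution_continuous x] by metis
  obtain K where K: "K > 0" "\<And>(A::real^('i+'e)^('i+'e)) v. norm (A *v v) \<le> norm A * norm v * K"
    using bounded_bilinear.pos_bounded[OF bounded_bilinear_matrix_vector_mult] by blast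
  define \<rho> where "\<rho> n = min (min r1 (min r2 r3)) (1 / real (Suc n))" for n
  have \<rho>: "\<rho> n > 0" for n using 1(1) 2(1) 3(1) by (simp add: \<rho>_def)
  have "\<exists>y y'. y \<in> Y \<inter> ball x (\<rho> n) \<and> y' \<in> Y \<inter> ball x (\<rho> n) \<and> real (Suc n) * dist y y' < dist (z y) (z y')" for n
    using bad[OF \<rho>[of n], of "real (Suc n)"] of_nat_0_le_iff by blast
  then obtain X X' where X: "\<And>n. X n \<in> Y \<inter> ball x (\<rho> n)" and X': "\<And>n. X' n \<in> Y \<inter> ball x (\<rho> n)"
    and gap: "\<And>n. real (Suc n) * dist (X n) (X' n) < dist (z (X n)) (z (X' n))"
    by metis
  have inY: "X n \<in> Y" "X' n \<in> Y" for n using X X' by auto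
  have lim: "S \<longlonglongrightarrow> x" if "\<And>n. S n \<in> Y \<inter> ball x (\<rho> n)" for S
    using that by (intro LIMSEQ_if_dist_less_inverse_Suc) (auto simp: \<rho>_def dist_commute)
  define d where "d n = norm (z (X n) - z (X' n))" for n
  define \<beta> where "\<beta> n = norm ((H (X n) - H (X' n)) *v z (X' n) + (h (X n) - h (X' n)))" for n
  define u where "u n = (z (X n) - z (X' n)) /\<^sub>R d n" for n
  define C where "C = L1 * B * K + L2"
  have C: "C \<ge> 0" using 1 2 3 K by (simp add: C_def)
  have d: "0 < d n" "real (Suc n) * dist (X n) (X' n) \<le> d n" for n
  proof -
    have "0 \<le> real (Suc n) * dist (X n) (X' n)" by simp
    then show "0 < d n" "real (Suc n) * dist (X n) (X' n) \<le> d n"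
      using gap[of n] unfolding d_def dist_norm by linarith+
  qed
  have \<beta>: "\<beta> n \<le> C * dist (X n) (X' n)" for n
  proof -
    have "\<beta> n \<le> norm ((H (X n) - H (X' n)) *v z (X' n)) + norm (h (X n) - h (X' n))"
      unfolding \<beta>_def by (rule norm_triangle_ineq)
    also have "\<dots> \<le> norm (H (X n) - H (X' n)) * norm (z (X' n)) * K + norm (h (X n) - h (X' n))"
      using K(2) by (rule add_right_mono)
    also have "\<dots> \<le> (L1 * dist (X n) (X' n)) * B * K + L2 * dist (X n) (X' n)"
    proof (intro add_mono mult_right_mono mult_mono)
      show "norm (H (X n) - H (X' n)) \<le> L1 * dist (X n) (X' n)"
        using 1(3)[of "X n" "X' n"] X[of n] X'[of n] by (simp add: dist_norm \<rho>_def)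
      show "norm (h (X n) - h (X' n)) \<le> L2 * dist (X n) (X' n)"
        using 2(3)[of "X n" "X' n"] X[of n] X'[of n] by (simp add: dist_norm \<rho>_def)
      show "norm (z (X' n)) \<le> B"
        using 3(3)[of "X' n"] X'[of n] by (simp add: \<rho>_def)
    qed (use K 1 in auto)
    finally show ?thesis by (simp add: C_def algebra_simps)
  qed
  have ratio: "\<beta> n / d n \<le> C / real (Suc n)" for n
  proof -
    have "real (Suc n) * \<beta> n \<le> C * (real (Suc n) * dist (X n) (X' n))"
      using mult_left_mono[OF \<beta>[of n], of "real (Suc n)"] by (simp only: mult.left_commute of_nat_0_le_iff)
    also have "\<dots> \<le> C * d n" by (intro mult_left_mono d C)
    finally show ?thesis using d(1)[of n] by (simp add: field_simps)
  qed
  show False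
  proof (rule nondegenerate_no_null_directions[OF nondegenerate[OF x] positive_semidefinite[OF x] tendsto_H[OF inY(1) lim[OF X] x]])
    show "norm (u n) = 1" for n using d(1)[of n] by (simp add: u_def d_def)
    show "(\<lambda>n. C / real (Suc n)) \<longlonglongrightarrow> 0"
      using LIMSEQ_Suc[OF lim_const_over_n[of C]] .
    show "u n \<bullet> (H (X n) *v u n) \<le> C / real (Suc n)" for n
    proof -
      have "u n \<bullet> (H (X n) *v u n) = ((z (X n) - z (X' n)) \<bullet> (H (X n) *v (z (X n) - z (X' n)))) / (d n * d n)"
        unfolding u_def by (simp add: matrix_vector_mult_scaleR divide_inverse mult_ac)
      also have "\<dots> \<le> (d n * \<beta> n) / (d n * d n)"
        unfolding d_def \<beta>_def
        by (intro divide_right_mono lcp_solution_perturbation(1)[OF positive_semidefinite solution solution] inY) simp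
      also have "\<dots> \<le> C / real (Suc n)" using ratio[of n] d(1)[of n] by simp
      finally show ?thesis .
    qed
    fix i assume i: "(H x *v z x + h x) $ Inl i \<noteq> 0"
    have vanish: "\<forall>\<^sub>F n in sequentially. z (S n) $ Inl i = 0" if S: "\<And>n. S n \<in> Y \<inter> ball x (\<rho> n)" for S
    proof -
      have SY: "S n \<in> Y" for n using S by auto
      have "(\<lambda>n. (H (S n) *v z (S n) + h (S n)) $ Inl i) \<longlonglongrightarrow> (H x *v z x + h x) $ Inl i"
        by (intro tendsto_vec_nth tendsto_add tendsto_matrix_vector_mult tendsto_H tendsto_h tendsto_z SY lim[OF S] x)
      then have "\<forall>\<^sub>F n in sequentially. (H (S n) *v z (S n) + h (S n)) $ Inl i \<noteq> 0"
        using i by (rule tendsto_imp_eventually_ne)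
      then show ?thesis
      proof eventually_elim
        case (elim n)
        have "z (S n) $ Inl i * (H (S n) *v z (S n) + h (S n)) $ Inl i = 0"
          using solution[OF SY[of n]] unfolding lcp_solution_def by blast
        with elim show ?case by simp
      qed
    qed
    have "\<forall>\<^sub>F n in sequentially. u n $ Inl i = 0"
      using vanish[OF X] vanish[OF X'] by eventually_elim (simp add: u_def)
    then show "(\<lambda>n. u n $ Inl i) \<longlonglongrightarrow> 0" by (rule tendsto_eventually)
  qed
qed

end

section \<open>Calculus of definable sets\<close>

lemma polyfun_sum:
  "finite I \<Longrightarrow> (\<And>i. i \<in> I \<Longrightarrow> f i \<in> polyfun n) \<Longrightarrow> (\<lambda>xs. \<Sum>i\<in>I. f i xs) \<in> polyfun n"
  by (induction I rule: finite_induct) (auto intro: polyfun.intros)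

lemma polyfun_subst:
  assumes "f \<in> polyfun n" "\<And>i. i < n \<Longrightarrow> g i \<in> polyfun k"
  shows "(\<lambda>xs. f (map (\<lambda>i. g i xs) [0..<n])) \<in> polyfun k"
  using assms by (induction rule: polyfun.induct) (auto intro: polyfun.intros)

lemma polyfun_cong:
  assumes "f \<in> polyfun n" "f = g" shows "g \<in> polyfun n"
  using assms by simp

lemma polyfun_diff:
  assumes "f \<in> polyfun n" "g \<in> polyfun n"
  shows "(\<lambda>xs. f xs - g xs) \<in> polyfun n"
  by (rule polyfun_cong[OF polyfun.add[OF assms(1) polyfun.mult[OF polyfun.const[of "-1"] assms(2)]]]) auto

locale o_minimal_structure =
  fixes \<O> :: "nat \<Rightarrow> real list set set"
  assumes o_minimal: "o_minimal \<O>"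
begin

lemma subset_rspace: "A \<in> \<O> n \<Longrightarrow> A \<subseteq> rspace n"
  and empty_in: "{} \<in> \<O> n"
  and compl_in: "A \<in> \<O> n \<Longrightarrow> rspace n - A \<in> \<O> n"
  and union_in: "A \<in> \<O> n \<Longrightarrow> B \<in> \<O> n \<Longrightarrow> A \<union> B \<in> \<O> n"
  using conjunct1[OF o_minimal[unfolded o_minimal_def]] by blast+

lemma semialgebraic_in: "A \<in> semialgebraic n \<Longrightarrow> A \<in> \<O> n"
  using conjunct1[OF conjunct2[OF o_minimal[unfolded o_minimal_def]]] by blast

lemma product_in: "A \<in> \<O> n \<Longrightarrow> B \<in> \<O> m \<Longrightarrow> {xs @ ys |xs ys. xs \<in> A \<and> ys \<in> B} \<in> \<O> (n + m)"
  and take_in: "A \<in> \<O> (n + 1) \<Longrightarrow> take n ` A \<in> \<O> n"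
  using conjunct2[OF conjunct2[OF conjunct2[OF o_minimal[unfolded o_minimal_def]]]] by simp_all

lemma rspace_in: "rspace n \<in> \<O> n"
  using compl_in[OF empty_in] by simp

lemma inter_in:
  assumes "A \<in> \<O> n" "B \<in> \<O> n" shows "A \<inter> B \<in> \<O> n"
proof -
  have "A \<inter> B = rspace n - ((rspace n - A) \<union> (rspace n - B))"
    using subset_rspace assms by blast
  then show ?thesis using assms by (simp add: compl_in union_in)
qed

lemma finite_inter_in:
  "finite I \<Longrightarrow> (\<And>i. i \<in> I \<Longrightarrow> {xs \<in> rspace n. P i xs} \<in> \<O> n) \<Longrightarrow> {xs \<in> rspace n. \<forall>i\<in>I. P i xs} \<in> \<O> n"
proof (induction I rule: finite_induct)
  case (insert j I)
  have "{xs \<in> rspace n. \<forall>i\<in>insert j I. P i xs} = {xs \<in> rspace n. P j xs} \<inter> {xs \<in> rspace n. \<forall>i\<in>I. P i xs}"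
    by auto
  then show ?case using insert by (simp add: inter_in)
qed (simp add: rspace_in)

lemma polynomial_zero_in: "f \<in> polyfun n \<Longrightarrow> {xs \<in> rspace n. f xs = 0} \<in> \<O> n"
  and polynomial_pos_in: "f \<in> polyfun n \<Longrightarrow> {xs \<in> rspace n. f xs > 0} \<in> \<O> n"
  by (auto intro: semialgebraic_in semialgebraic.intros)

lemma projection_in: "A \<in> \<O> (m + n) \<Longrightarrow> take m ` A \<in> \<O> m"
proof (induction n arbitrary: A)
  case 0
  then have "take m xs = xs" if "xs \<in> A" for xs
    using subset_rspace[OF 0] that by (auto simp: rspace_def)
  then show ?case using 0 by simp
next
  case (Suc n)
  have "take (m + n) ` A \<in> \<O> (m + n)"
    using take_in[of A "m + n"] Suc.prems by simp
  from Suc.IH[OF this] show ?case by (simp add: image_image min_def)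
qed

lemma cylinder_in:
  assumes "A \<in> \<O> n"
  shows "{xs \<in> rspace (m + n). drop m xs \<in> A} \<in> \<O> (m + n)"
proof -
  have "{xs \<in> rspace (m + n). drop m xs \<in> A} = {xs @ ys |xs ys. xs \<in> rspace m \<and> ys \<in> A}"
    using subset_rspace[OF assms] by (auto simp: rspace_def) (metis append_take_drop_id length_take min_absorb2 le_add1)
  then show ?thesis using product_in[OF rspace_in assms] by simp
qed

lemma take_drop_as_map:
  assumes "xs \<in> rspace (m + n)"
  shows "take m xs = map (\<lambda>i. xs ! i) [0..<m]" "drop m xs = map (\<lambda>i. xs ! (m + i)) [0..<n]"
  using assms by (auto simp: rspace_def intro!: nth_equalityI)

text \<open>
  The image is a projection of the graph over \<open>A\<close>, and the graph of a polynomial map is semialgebraic.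
  Permutations of coordinates are a special case.
\<close>

lemma polynomial_image_in:
  assumes A: "A \<in> \<O> n" and f: "\<And>i. i < m \<Longrightarrow> f i \<in> polyfun n"
  shows "(\<lambda>xs. map (\<lambda>i. f i xs) [0..<m]) ` A \<in> \<O> m"
proof -
  define B where "B = {zs \<in> rspace (m + n). drop m zs \<in> A} \<inter>
    {zs \<in> rspace (m + n). \<forall>i\<in>{..<m}. zs ! i - f i (map (\<lambda>j. zs ! (m + j)) [0..<n]) = 0}"
  have "B \<in> \<O> (m + n)"
    unfolding B_def
    by (intro inter_in cylinder_in A finite_inter_in polynomial_zero_in polyfun_diff polyfun_subst f polyfun.var) auto
  then have "take m ` B \<in> \<O> m" by (rule projection_in)
  also have "take m ` B = (\<lambda>xs. map (\<lambda>i. f i xs) [0..<m]) ` A"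
  proof (intro set_eqI iffI)
    fix ys assume "ys \<in> take m ` B"
    then obtain zs where zs: "zs \<in> B" "ys = take m zs" by blast
    then have "ys = map (\<lambda>i. f i (drop m zs)) [0..<m]"
      by (auto simp: B_def take_drop_as_map intro!: map_cong)
    then show "ys \<in> (\<lambda>xs. map (\<lambda>i. f i xs) [0..<m]) ` A"
      using zs by (auto simp: B_def)
  next
    fix ys assume "ys \<in> (\<lambda>xs. map (\<lambda>i. f i xs) [0..<m]) ` A"
    then obtain xs where xs: "xs \<in> A" "ys = map (\<lambda>i. f i xs) [0..<m]" by blast
    have len: "length xs = n" using subset_rspace[OF A] xs(1) by (auto simp: rspace_def)
    have "ys @ xs \<in> rspace (m + n)" using xs(2) len by (simp add: rspace_def)
    moreover have "map (\<lambda>j. (ys @ xs) ! (m + j)) [0..<n] = xs"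
      using xs(2) len by (auto intro!: nth_equalityI simp: nth_append)
    ultimately have "ys @ xs \<in> B"
      using xs by (auto simp: B_def nth_append)
    then show "ys \<in> take m ` B" using xs(2) by (intro image_eqI[of _ _ "ys @ xs"]) auto
  qed
  finally show ?thesis .
qed

lemma polynomial_preimage_in:
  assumes A: "A \<in> \<O> m" and f: "\<And>i. i < m \<Longrightarrow> f i \<in> polyfun n"
  shows "{xs \<in> rspace n. map (\<lambda>i. f i xs) [0..<m] \<in> A} \<in> \<O> n"
proof -
  define B where "B = {zs \<in> rspace (n + m). drop n zs \<in> A} \<inter>
    {zs \<in> rspace (n + m). \<forall>i\<in>{..<m}. zs ! (n + i) - f i (map (\<lambda>j. zs ! j) [0..<n]) = 0}"
  have "B \<in> \<O> (n + m)"
    unfolding B_def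
    by (intro inter_in cylinder_in A finite_inter_in polynomial_zero_in polyfun_diff polyfun_subst f polyfun.var) auto
  then have "take n ` B \<in> \<O> n" by (rule projection_in)
  also have "take n ` B = {xs \<in> rspace n. map (\<lambda>i. f i xs) [0..<m] \<in> A}"
  proof (intro set_eqI iffI)
    fix xs assume "xs \<in> take n ` B"
    then obtain zs where zs: "zs \<in> B" "xs = take n zs" by blast
    then have "drop n zs = map (\<lambda>i. f i xs) [0..<m]"
      by (auto simp: B_def take_drop_as_map intro!: map_cong)
    then show "xs \<in> {xs \<in> rspace n. map (\<lambda>i. f i xs) [0..<m] \<in> A}"
      using zs by (auto simp: B_def rspace_def)
  next
    fix xs assume xs: "xs \<in> {xs \<in> rspace n. map (\<lambda>i. f i xs) [0..<m] \<in> A}"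
    then have len: "length xs = n" by (simp add: rspace_def)
    define zs where "zs = xs @ map (\<lambda>i. f i xs) [0..<m]"
    have "map (\<lambda>j. zs ! j) [0..<n] = xs"
      using len by (auto intro!: nth_equalityI simp: nth_append zs_def)
    moreover have "drop n zs = map (\<lambda>i. f i xs) [0..<m]" "length zs = n + m"
      "\<And>i. i < m \<Longrightarrow> zs ! (n + i) = f i xs"
      using len by (auto simp: zs_def nth_append)
    ultimately have "zs \<in> B"
      using xs by (auto simp: B_def rspace_def)
    then show "xs \<in> take n ` B" using len by (intro image_eqI[of _ _ zs]) (auto simp: zs_def)
  qed
  finally show ?thesis .
qed

end

lemma basis_enum: "distinct (basis_enum :: 'a::euclidean_space list)" "set (basis_enum :: 'a list) = Basis"
proof -
  have "\<exists>bs :: 'a list. distinct bs \<and> set bs = Basis"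
    using finite_distinct_list[OF finite_Basis] by blast
  from someI_ex[OF this] show "distinct (basis_enum :: 'a list)" "set (basis_enum :: 'a list) = Basis"
    unfolding basis_enum_def by auto
qed

lemma length_basis_enum [simp]: "length (basis_enum :: 'a::euclidean_space list) = DIM('a)"
  using distinct_card[OF basis_enum(1)[where 'a = 'a]] by (simp add: basis_enum(2))

lemma basis_enum_nth [simp]: "i < DIM('a) \<Longrightarrow> (basis_enum :: 'a::euclidean_space list) ! i \<in> Basis"
  by (metis basis_enum(2) length_basis_enum nth_mem)

lemma coords_in_rspace [simp]: "coords (x::'a::euclidean_space) \<in> rspace (DIM('a))"
  by (simp add: coords_def rspace_def)

lemma length_coords [simp]: "length (coords (x::'a::euclidean_space)) = DIM('a)"
  by (simp add: coords_def)

lemma coords_nth: "i < DIM('a) \<Longrightarrow> coords (x::'a::euclidean_space) ! i = x \<bullet> basis_enum ! i"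
  by (simp add: coords_def)

lemma sum_basis_enum:
  "(\<Sum>b\<in>Basis. f b) = (\<Sum>i<DIM('a). f ((basis_enum :: 'a::euclidean_space list) ! i))"
proof -
  have "bij_betw ((!) (basis_enum :: 'a list)) {..<DIM('a)} Basis"
    using bij_betw_nth[OF basis_enum(1)[where 'a = 'a], of "{..<DIM('a)}" Basis] by (simp add: basis_enum(2))
  then show ?thesis by (simp add: sum.reindex_bij_betw)
qed

lemma inj_coords: "inj (coords :: 'a::euclidean_space \<Rightarrow> real list)"
proof (rule injI)
  fix x y :: 'a assume eq: "coords x = coords y"
  have "x = (\<Sum>i<DIM('a). (x \<bullet> basis_enum ! i) *\<^sub>R basis_enum ! i)"
    using euclidean_representation[of x, symmetric] unfolding sum_basis_enum .
  also have "\<dots> = (\<Sum>i<DIM('a). (y \<bullet> basis_enum ! i) *\<^sub>R basis_enum ! i)"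
    by (rule sum.cong) (auto simp: coords_nth[symmetric] eq)
  also have "\<dots> = y"
    using euclidean_representation[of y] unfolding sum_basis_enum .
  finally show "x = y" .
qed

lemma range_coords: "range (coords :: 'a::euclidean_space \<Rightarrow> real list) = rspace (DIM('a))"
proof (intro subset_antisym subsetI)
  fix xs assume "xs \<in> rspace (DIM('a))"
  then have len: "length xs = DIM('a)" by (simp add: rspace_def)
  define x :: 'a where "x = (\<Sum>i<DIM('a). xs ! i *\<^sub>R basis_enum ! i)"
  have "x \<bullet> basis_enum ! j = xs ! j" if j: "j < DIM('a)" for j
  proof -
    have "basis_enum ! i \<bullet> (basis_enum ! j :: 'a) = (if i = j then 1 else 0)" if "i < DIM('a)" for i
      using that j basis_enum(1)[where 'a = 'a] by (simp add: inner_Basis nth_eq_iff_index_eq)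
    then have "x \<bullet> basis_enum ! j = (\<Sum>i<DIM('a). if i = j then xs ! i else 0)"
      unfolding x_def inner_sum_left by (intro sum.cong) auto
    then show ?thesis using j by simp
  qed
  then have "coords x = xs"
    using len by (auto intro!: nth_equalityI simp: coords_nth)
  then show "xs \<in> range (coords :: 'a \<Rightarrow> real list)" by (metis rangeI)
qed auto

lemma linear_functional_coords:
  fixes f :: "'a::euclidean_space \<Rightarrow> real"
  assumes "linear f"
  shows "f x = (\<Sum>i<DIM('a). coords x ! i * f (basis_enum ! i))"
proof -
  have "f x = (\<Sum>b\<in>Basis. (x \<bullet> b) * f b)"
    using linear_sum[OF assms, of "\<lambda>b. (x \<bullet> b) *\<^sub>R b" Basis] linear_scale[OF assms]
    by (simp add: euclidean_representation)
  then show ?thesis unfolding sum_basis_enum by (simp add: coords_nth)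
qed

lemma linear_functional_polyfun:
  fixes f :: "'a::euclidean_space \<Rightarrow> real"
  assumes "linear f"
  shows "\<exists>p\<in>polyfun (DIM('a)). \<forall>x. f x = p (coords x)"
  by (intro bexI[of _ "\<lambda>xs. \<Sum>i<DIM('a). xs ! i * f (basis_enum ! i)"] allI
      linear_functional_coords assms polyfun_sum polyfun.intros) auto

text \<open>
  The coordinates of a pair need not be listed as those of the first component followed by those of
  the second, so the passage between the two lists is made through linear functionals.
\<close>

lemma linear_functional_polyfun_pair:
  fixes f :: "'a::euclidean_space \<times> 'b::euclidean_space \<Rightarrow> real"
  assumes "linear f"
  shows "\<exists>p\<in>polyfun (DIM('a) + DIM('b)). \<forall>x y. f (x, y) = p (coords x @ coords y)"
proof -
  have lin: "linear (\<lambda>x. f (x, 0))" "linear (\<lambda>y. f (0, y))"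
    using linear_compose[OF _ assms, of "\<lambda>x. (x, 0)"] linear_compose[OF _ assms, of "\<lambda>y. (0, y)"]
    by (simp_all add: o_def linear_iff)
  define p where "p zs = (\<Sum>i<DIM('a). zs ! i * f (basis_enum ! i, 0)) +
    (\<Sum>j<DIM('b). zs ! (DIM('a) + j) * f (0, basis_enum ! j))" for zs
  have "p \<in> polyfun (DIM('a) + DIM('b))"
    unfolding p_def by (intro polyfun_sum polyfun.intros) auto
  moreover have "f (x, y) = p (coords x @ coords y)" for x y
  proof -
    have "f (x, y) = f (x, 0) + f (0, y)" using linear_add[OF assms, of "(x, 0)" "(0, y)"] by simp
    also have "\<dots> = p (coords x @ coords y)"
      unfolding p_def linear_functional_coords[OF lin(1), of x] linear_functional_coords[OF lin(2), of y]
      by (simp add: nth_append)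
    finally show ?thesis .
  qed
  ultimately show ?thesis by blast
qed

lemma polynomial_function_polyfun:
  fixes f :: "'a::euclidean_space \<Rightarrow> real"
  assumes "real_polynomial_function f"
  shows "\<exists>p\<in>polyfun (DIM('a)). \<forall>x. f x = p (coords x)"
  using assms
proof induction
  case (linear f)
  then show ?case by (intro linear_functional_polyfun bounded_linear.linear)
next
  case (const c)
  then show ?case by (auto intro!: bexI[of _ "\<lambda>_. c"] polyfun.const)
next
  case (add f g)
  then obtain p r where "p \<in> polyfun (DIM('a))" "\<forall>x. f x = p (coords x)"
    "r \<in> polyfun (DIM('a))" "\<forall>x. g x = r (coords x)" by blast
  then show ?case by (auto intro!: bexI[of _ "\<lambda>xs. p xs + r xs"] polyfun.add)
next
  case (mult f g)
  then obtain p r where "p \<in> polyfun (DIM('a))" "\<forall>x. f x = p (coords x)"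
    "r \<in> polyfun (DIM('a))" "\<forall>x. g x = r (coords x)" by blast
  then show ?case by (auto intro!: bexI[of _ "\<lambda>xs. p xs * r xs"] polyfun.mult)
qed

lemma linear_map_polyfun:
  fixes T :: "'a::euclidean_space \<Rightarrow> 'b::euclidean_space"
  assumes "linear T"
  obtains f where "\<And>i. f i \<in> polyfun (DIM('a))" "\<And>x. coords (T x) = map (\<lambda>i. f i (coords x)) [0..<DIM('b)]"
proof -
  have "\<exists>p\<in>polyfun (DIM('a)). \<forall>x. T x \<bullet> basis_enum ! i = p (coords x)" for i
    using assms by (intro linear_functional_polyfun) (simp add: linear_iff inner_add_left)
  then obtain f where "\<And>i. f i \<in> polyfun (DIM('a))" "\<And>i x. T x \<bullet> basis_enum ! i = f i (coords x)"
    by metis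
  then show ?thesis
    by (intro that[of f]) (auto intro!: nth_equalityI simp: coords_nth)
qed

context o_minimal_structure
begin

definition definable_set :: "'a::euclidean_space set \<Rightarrow> bool" where
  "definable_set S \<longleftrightarrow> coords ` S \<in> \<O> (DIM('a))"

lemma definable_set_linear_image:
  fixes T :: "'a::euclidean_space \<Rightarrow> 'b::euclidean_space"
  assumes "linear T" "definable_set S"
  shows "definable_set (T ` S)"
proof -
  obtain f where f: "\<And>i. f i \<in> polyfun (DIM('a))"
    "\<And>x. coords (T x) = map (\<lambda>i. f i (coords x)) [0..<DIM('b)]"
    using linear_map_polyfun[OF assms(1)] by metis
  have "coords ` T ` S = (\<lambda>xs. map (\<lambda>i. f i xs) [0..<DIM('b)]) ` coords ` S"
    by (simp add: image_image f(2))
  then show ?thesis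
    using polynomial_image_in[of "coords ` S" "DIM('a)" "DIM('b)" f] assms(2) f(1)
    by (simp add: definable_set_def)
qed

lemma definable_set_linear_vimage:
  fixes T :: "'a::euclidean_space \<Rightarrow> 'b::euclidean_space"
  assumes "linear T" "definable_set S"
  shows "definable_set {x. T x \<in> S}"
proof -
  obtain f where f: "\<And>i. f i \<in> polyfun (DIM('a))"
    "\<And>x. coords (T x) = map (\<lambda>i. f i (coords x)) [0..<DIM('b)]"
    using linear_map_polyfun[OF assms(1)] by metis
  have "coords ` {x. T x \<in> S} = {xs \<in> rspace (DIM('a)). map (\<lambda>i. f i xs) [0..<DIM('b)] \<in> coords ` S}"
    unfolding range_coords[symmetric] 

    by (auto simp: f(2)[symmetric] inj_eq[OF inj_coords] image_iff)
  then show ?thesis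
    using polynomial_preimage_in[of "coords ` S" "DIM('b)" f "DIM('a)"] assms(2) f(1)
    by (simp add: definable_set_def)
qed

lemma definable_set_conj:
  fixes P Q :: "'a::euclidean_space \<Rightarrow> bool"
  assumes "definable_set {x. P x}" "definable_set {x. Q x}"
  shows "definable_set {x. P x \<and> Q x}"
  using inter_in[of "coords ` {x. P x}" _ "coords ` {x. Q x}"] assms
  by (simp add: definable_set_def image_Int[OF inj_coords, symmetric] Collect_conj_eq)

lemma definable_set_all:
  fixes P :: "'i::finite \<Rightarrow> 'a::euclidean_space \<Rightarrow> bool"
  assumes "\<And>i. definable_set {x. P i x}"
  shows "definable_set {x. \<forall>i. P i x}"
proof -
  have "coords ` {x. \<forall>i. P i x} = {xs \<in> rspace (DIM('a)). \<forall>i\<in>UNIV. xs \<in> coords ` {x. P i x}}"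
    unfolding range_coords[symmetric] by (auto simp: inj_image_mem_iff[OF inj_coords])
  moreover have "{xs \<in> rspace (DIM('a)). xs \<in> coords ` {x. P i x}} \<in> \<O> (DIM('a))" for i
  proof -
    have "{xs \<in> rspace (DIM('a)). xs \<in> coords ` {x. P i x}} = coords ` {x. P i x}" by auto
    then show ?thesis using assms[of i] by (simp add: definable_set_def)
  qed
  ultimately show ?thesis
    unfolding definable_set_def
    using finite_inter_in[OF finite[of UNIV], of "DIM('a)" "\<lambda>i xs. xs \<in> coords ` {x. P i x}"] by simp
qed

lemma definable_set_eq_0:
  fixes f :: "'a::euclidean_space \<Rightarrow> real"
  assumes "real_polynomial_function f"
  shows "definable_set {x. f x = 0}"
proof -
  obtain p where p: "p \<in> polyfun (DIM('a))" "\<And>x. f x = p (coords x)"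
    using polynomial_function_polyfun[OF assms] by blast
  have "coords ` {x. f x = 0} = {xs \<in> rspace (DIM('a)). p xs = 0}"
    unfolding range_coords[symmetric] by (auto simp: p(2))
  then show ?thesis using polynomial_zero_in[OF p(1)] by (simp add: definable_set_def)
qed

lemma definable_set_nonneg:
  fixes f :: "'a::euclidean_space \<Rightarrow> real"
  assumes "real_polynomial_function f"
  shows "definable_set {x. 0 \<le> f x}"
proof -
  obtain p where p: "p \<in> polyfun (DIM('a))" "\<And>x. - f x = p (coords x)"
    using polynomial_function_polyfun[OF real_polynomial_function_minus[OF assms]] by blast
  have "coords ` {x. 0 \<le> f x} = rspace (DIM('a)) - {xs \<in> rspace (DIM('a)). p xs > 0}"
    unfolding range_coords[symmetric] by (auto simp: p(2)[symmetric] dest: injD[OF inj_coords])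
  then show ?thesis using compl_in[OF polynomial_pos_in[OF p(1)]] by (simp add: definable_set_def)
qed

lemma definable_set_polytope:
  fixes Y :: "'a::euclidean_space set"
  assumes "polytope Y"
  shows "definable_set Y"
proof -
  obtain \<F> where \<F>: "finite \<F>" "Y = \<Inter> \<F>" "\<And>h. h \<in> \<F> \<Longrightarrow> \<exists>a b. a \<noteq> 0 \<and> h = {x. a \<bullet> x \<le> b}"
    using polytope_imp_polyhedron[OF assms] unfolding polyhedron_def by blast
  have "definable_set h" if h: "h \<in> \<F>" for h
  proof -
    obtain a b where "h = {x. a \<bullet> x \<le> b}" using \<F>(3)[OF h] by blast
    then have "h = {x. 0 \<le> b - a \<bullet> x}" by auto
    moreover have "real_polynomial_function (\<lambda>x. b - a \<bullet> x)"
      by (intro real_polynomial_function_diff real_polynomial_function.intros(2)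
          real_polynomial_function.intros(1) bounded_linear_inner_right)
    ultimately show ?thesis using definable_set_nonneg by metis
  qed
  moreover have "coords ` Y = {xs \<in> rspace (DIM('a)). \<forall>h\<in>\<F>. xs \<in> coords ` h}"
    unfolding range_coords[symmetric] \<F>(2) by (auto simp: inj_image_mem_iff[OF inj_coords])
  moreover have "{xs \<in> rspace (DIM('a)). xs \<in> coords ` h} = coords ` h" for h :: "'a set" by auto
  ultimately show ?thesis
    unfolding definable_set_def by (simp only: finite_inter_in[OF \<F>(1)])
qed

text \<open>
  The graph in the product space and the set of concatenated coordinate lists are images of each
  other under linear changes of coordinates.
\<close>

lemma definable_on_iff_graph:
  fixes f :: "'a::euclidean_space \<Rightarrow> 'b::euclidean_space"
  shows "definable_on \<O> S f \<longleftrightarrow> definable_set ((\<lambda>x. (x, f x)) ` S)"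
proof
  assume def: "definable_on \<O> S f"
  have "\<exists>p\<in>polyfun (DIM('a) + DIM('b)). \<forall>x y. (x, y) \<bullet> (basis_enum ! i :: 'a \<times> 'b) = p (coords x @ coords y)" for i
    by (intro linear_functional_polyfun_pair) (simp add: linear_iff inner_add_left)
  then obtain p where p: "\<And>i. p i \<in> polyfun (DIM('a) + DIM('b))"
    "\<And>i x y. (x, y) \<bullet> (basis_enum ! i :: 'a \<times> 'b) = p i (coords x @ coords y)" by metis
  have "coords ` (\<lambda>x. (x, f x)) ` S =
      (\<lambda>xs. map (\<lambda>i. p i xs) [0..<DIM('a \<times> 'b)]) ` (\<lambda>x. coords x @ coords (f x)) ` S"
    unfolding image_image by (intro image_cong refl nth_equalityI) (auto simp: coords_nth p(2))
  then show "definable_set ((\<lambda>x. (x, f x)) ` S)"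
    using polynomial_image_in[OF def[unfolded definable_on_def], of "DIM('a \<times> 'b)" p] p(1)
    unfolding definable_set_def by simp
next
  assume def: "definable_set ((\<lambda>x. (x, f x)) ` S)"
  have "\<exists>p\<in>polyfun (DIM('a \<times> 'b)). \<forall>v :: 'a \<times> 'b. fst v \<bullet> (basis_enum ! i :: 'a) = p (coords v)" for i
    by (intro linear_functional_polyfun) (simp add: linear_iff inner_add_left)
  then obtain p where p: "\<And>i. p i \<in> polyfun (DIM('a \<times> 'b))"
    "\<And>i (v :: 'a \<times> 'b). fst v \<bullet> (basis_enum ! i :: 'a) = p i (coords v)" by metis
  have "\<exists>p\<in>polyfun (DIM('a \<times> 'b)). \<forall>v :: 'a \<times> 'b. snd v \<bullet> (basis_enum ! i :: 'b) = p (coords v)" for i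
    by (intro linear_functional_polyfun) (simp add: linear_iff inner_add_left)
  then obtain r where r: "\<And>i. r i \<in> polyfun (DIM('a \<times> 'b))"
    "\<And>i (v :: 'a \<times> 'b). snd v \<bullet> (basis_enum ! i :: 'b) = r i (coords v)" by metis
  define k where "k i = (if i < DIM('a) then p i else r (i - DIM('a)))" for i
  have "coords x @ coords y = map (\<lambda>i. k i (coords (x, y))) [0..<DIM('a) + DIM('b)]" for x :: 'a and y :: 'b
    using p(2)[of "(x, y)"] r(2)[of "(x, y)"]
    by (auto intro!: nth_equalityI simp: k_def nth_append coords_nth)
  then have "(\<lambda>x. coords x @ coords (f x)) ` S =
      (\<lambda>xs. map (\<lambda>i. k i xs) [0..<DIM('a) + DIM('b)]) ` coords ` (\<lambda>x. (x, f x)) ` S"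
    by (simp add: image_image)
  moreover have "k i \<in> polyfun (DIM('a \<times> 'b))" for i using p(1) r(1) by (simp only: k_def split: if_split) simp
  ultimately show "definable_on \<O> S f"
    using polynomial_image_in[OF def[unfolded definable_set_def], of "DIM('a) + DIM('b)" k]
    by (simp add: definable_on_def)
qed

end

section \<open>Definability of the dual solution\<close>

text \<open>
  Introducing the primal variable \<open>y\<close> removes the inverse of \<open>Q\<close> and makes the conditions polynomial.
\<close>

lemma lcp_solution_iff_primal_dual:
  assumes Q: "positive_definite Q"
  shows "lcp_solution (dual_H Q F G) (dual_h Q q F \<phi> G g) \<zeta> \<longleftrightarrow>
    (\<exists>y. Q *v y + q + transpose (stack_vec G F) *v \<zeta> = 0 \<and>
      (\<forall>i. 0 \<le> \<zeta> $ Inl i \<and> 0 \<le> g $ i - (G *v y) $ i \<and> \<zeta> $ Inl i * (g $ i - (G *v y) $ i) = 0) \<and>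
      (\<forall>j. \<phi> $ j - (F *v y) $ j = 0))"
    (is "?L \<longleftrightarrow> (\<exists>y. ?S y \<and> ?C y)")
proof -
  have eq: "?L \<longleftrightarrow> ?C y" if y: "?S y" for y
    unfolding lcp_solution_def dual_slack[OF Q y] by (simp add: stack_vec_mult_vec)
  show ?thesis
    using eq stationary_point[OF Q, of q G F \<zeta>] by metis
qed

lemma real_polynomial_function_component:
  fixes f :: "'a::euclidean_space \<Rightarrow> real^'n"
  assumes "linear f"
  shows "real_polynomial_function (\<lambda>v. f v $ k)"
  using assms by (intro real_polynomial_function.intros(1))
    (simp add: linear_conv_bounded_linear[symmetric] linear_iff)

lemma real_polynomial_function_entry:
  fixes f :: "'a::euclidean_space \<Rightarrow> real^'n^'m"
  assumes "linear f"
  shows "real_polynomial_function (\<lambda>v. f v $ k $ l)"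
  using assms by (intro real_polynomial_function.intros(1))
    (simp add: linear_conv_bounded_linear[symmetric] linear_iff)

text \<open>
  A point of the graph of the solution map, followed by \<open>y\<close> and by the values of \<open>Q\<close>, \<open>q\<close>, \<open>F\<close>, \<open>\<phi>\<close>, \<open>G\<close>
  and \<open>g\<close> at the parameter.
\<close>

type_synonym ('x, 'p, 'y, 'e, 'i) kkt_point =
  "(((real^'x) \<times> (real^'p)) \<times> (real^('i + 'e))) \<times> (real^'y) \<times> (real^'y^'y) \<times> (real^'y) \<times>
    (real^'y^'e) \<times> (real^'e) \<times> (real^'y^'i) \<times> (real^'i)"

context o_minimal_structure
begin

text \<open>
  The solution map inherits definability because its graph is a projection of the set of KKT points,
  and membership in that set is a conjunction of polynomial conditions on the entries with
  membership in the graphs of the data maps and in the polytope.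
\<close>

lemma definable_dual_solution:
  fixes Y :: "((real^'x) \<times> (real^'p)) set"
    and Q :: "real^'p \<Rightarrow> real^'y^'y" and q :: "(real^'x) \<times> (real^'p) \<Rightarrow> real^'y"
    and F :: "real^'p \<Rightarrow> real^'y^'e" and \<phi> :: "(real^'x) \<times> (real^'p) \<Rightarrow> real^'e"
    and G :: "real^'p \<Rightarrow> real^'y^'i" and g :: "(real^'x) \<times> (real^'p) \<Rightarrow> real^'i"
    and z :: "(real^'x) \<times> (real^'p) \<Rightarrow> real^('i + 'e)"
  assumes Y: "polytope Y"
    and Q: "\<And>x p. (x, p) \<in> Y \<Longrightarrow> positive_definite (Q p)"
    and definable:
      "definable_on \<O> UNIV Q" "definable_on \<O> UNIV q"
      "definable_on \<O> UNIV F" "definable_on \<O> UNIV \<phi>"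
      "definable_on \<O> UNIV G" "definable_on \<O> UNIV g"
    and z: "\<And>x p \<zeta>. (x, p) \<in> Y \<Longrightarrow>
      lcp_solution (dual_H (Q p) (F p) (G p)) (dual_h (Q p) (q (x, p)) (F p) (\<phi> (x, p)) (G p) (g (x, p))) \<zeta> \<longleftrightarrow>
      \<zeta> = z (x, p)"
  shows "definable_on \<O> Y z"
proof -
  define pb :: "('x, 'p, 'y, 'e, 'i) kkt_point \<Rightarrow> _" where "pb v = fst (fst v)" for v
  define \<zeta> :: "('x, 'p, 'y, 'e, 'i) kkt_point \<Rightarrow> _" where "\<zeta> v = snd (fst v)" for v
  define y :: "('x, 'p, 'y, 'e, 'i) kkt_point \<Rightarrow> _" where "y v = fst (snd v)" for v
  define Qm :: "('x, 'p, 'y, 'e, 'i) kkt_point \<Rightarrow> _" where "Qm v = fst (snd (snd v))" for v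
  define qv :: "('x, 'p, 'y, 'e, 'i) kkt_point \<Rightarrow> _" where "qv v = fst (snd (snd (snd v)))" for v
  define Fm :: "('x, 'p, 'y, 'e, 'i) kkt_point \<Rightarrow> _" where "Fm v = fst (snd (snd (snd (snd v))))" for v
  define \<phi>v :: "('x, 'p, 'y, 'e, 'i) kkt_point \<Rightarrow> _" where "\<phi>v v = fst (snd (snd (snd (snd (snd v)))))" for v
  define Gm :: "('x, 'p, 'y, 'e, 'i) kkt_point \<Rightarrow> _" where "Gm v = fst (snd (snd (snd (snd (snd (snd v))))))" for v
  define gv :: "('x, 'p, 'y, 'e, 'i) kkt_point \<Rightarrow> _" where "gv v = snd (snd (snd (snd (snd (snd (snd v))))))" for v
  note proj_defs = pb_def \<zeta>_def y_def Qm_def qv_def Fm_def \<phi>v_def Gm_def gv_def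
  have lin: "linear pb" "linear \<zeta>" "linear y" "linear Qm" "linear qv" "linear Fm" "linear \<phi>v" "linear Gm" "linear gv"
    by (simp_all add: linear_iff proj_defs)
  note poly = real_polynomial_function_component[OF lin(2)] real_polynomial_function_component[OF lin(3)]
    real_polynomial_function_component[OF lin(5)] real_polynomial_function_component[OF lin(7)]
    real_polynomial_function_component[OF lin(9)] real_polynomial_function_entry[OF lin(4)]
    real_polynomial_function_entry[OF lin(6)] real_polynomial_function_entry[OF lin(8)]
    real_polynomial_function.intros(3,4) real_polynomial_function_diff real_polynomial_function_sum[OF finite]
  have graph: "definable_set {v. (T v, U v) \<in> (\<lambda>x. (x, f x)) ` UNIV}"
    if "definable_on \<O> UNIV f" "linear T" "linear U"
    for f :: "'c::euclidean_space \<Rightarrow> 'd::euclidean_space" and T :: "'v::euclidean_space \<Rightarrow> 'c" and U :: "'v \<Rightarrow> 'd"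
    using that by (intro definable_set_linear_vimage) (simp_all add: definable_on_iff_graph linear_iff)
  have lin_snd: "linear (\<lambda>v. snd (pb v))" by (simp add: linear_iff pb_def)
  define S where "S = {v. pb v \<in> Y \<and>
    (snd (pb v), Qm v) \<in> (\<lambda>x. (x, Q x)) ` UNIV \<and> (pb v, qv v) \<in> (\<lambda>x. (x, q x)) ` UNIV \<and>
    (snd (pb v), Fm v) \<in> (\<lambda>x. (x, F x)) ` UNIV \<and> (pb v, \<phi>v v) \<in> (\<lambda>x. (x, \<phi> x)) ` UNIV \<and>
    (snd (pb v), Gm v) \<in> (\<lambda>x. (x, G x)) ` UNIV \<and> (pb v, gv v) \<in> (\<lambda>x. (x, g x)) ` UNIV \<and>
    (\<forall>k. (\<Sum>l\<in>UNIV. Qm v $ k $ l * y v $ l) + qv v $ k +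
      ((\<Sum>i\<in>UNIV. Gm v $ i $ k * \<zeta> v $ Inl i) + (\<Sum>j\<in>UNIV. Fm v $ j $ k * \<zeta> v $ Inr j)) = 0) \<and>
    (\<forall>i. 0 \<le> \<zeta> v $ Inl i \<and> 0 \<le> gv v $ i - (\<Sum>l\<in>UNIV. Gm v $ i $ l * y v $ l) \<and>
      \<zeta> v $ Inl i * (gv v $ i - (\<Sum>l\<in>UNIV. Gm v $ i $ l * y v $ l)) = 0) \<and>
    (\<forall>j. \<phi>v v $ j - (\<Sum>l\<in>UNIV. Fm v $ j $ l * y v $ l) = 0)}"
  have "definable_set S"
    unfolding S_def
    by (intro definable_set_conj definable_set_all definable_set_eq_0 definable_set_nonneg graph
        definable_set_linear_vimage definable_set_polytope Y definable lin lin_snd poly)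
  then have "definable_set (fst ` S)"
    by (intro definable_set_linear_image) (simp_all add: linear_iff)
  also have "fst ` S = (\<lambda>x. (x, z x)) ` Y"
  proof (intro set_eqI)
    fix w :: "((real^'x) \<times> (real^'p)) \<times> (real^('i + 'e))"
    obtain x p w' where w: "w = ((x, p), w')" by (metis prod.exhaust)
    have "w \<in> fst ` S \<longleftrightarrow> (\<exists>r. (w, r) \<in> S)" by force
    also have "\<dots> \<longleftrightarrow> (x, p) \<in> Y \<and>
        (\<exists>y. Q p *v y + q (x, p) + transpose (stack_vec (G p) (F p)) *v w' = 0 \<and>
          (\<forall>i. 0 \<le> w' $ Inl i \<and> 0 \<le> g (x, p) $ i - (G p *v y) $ i \<and> w' $ Inl i * (g (x, p) $ i - (G p *v y) $ i) = 0) \<and>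
          (\<forall>j. \<phi> (x, p) $ j - (F p *v y) $ j = 0))"
      unfolding S_def w proj_defs vec_eq_iff
      by (simp add: matrix_vector_mult_def transpose_def sum_UNIV_sum_type image_iff)
    also have "\<dots> \<longleftrightarrow> (x, p) \<in> Y \<and> w' = z (x, p)"
      using lcp_solution_iff_primal_dual[OF Q[of x p]] z[of x p w'] by meson
    also have "\<dots> \<longleftrightarrow> w \<in> (\<lambda>x. (x, z x)) ` Y" by (auto simp: w)
    finally show "w \<in> fst ` S \<longleftrightarrow> w \<in> (\<lambda>x. (x, z x)) ` Y" .
  qed
  finally show ?thesis by (simp add: definable_on_iff_graph)
qed

end

section \<open>Conservative Jacobians of locally linear functions\<close>

text \<open>
  Upper semicontinuity with compact values, in sequential form. It combines outer semicontinuity and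
  local boundedness into one condition that is stable under extracting subsequences, which suits
  set-valued maps built from several others.
\<close>

definition usco_on :: "'a::metric_space set \<Rightarrow> ('a \<Rightarrow> 'b::metric_space set) \<Rightarrow> bool" where
  "usco_on S J \<longleftrightarrow> (\<forall>x\<in>S. \<forall>X V. (\<forall>k::nat. X k \<in> S \<and> V k \<in> J (X k)) \<and> X \<longlonglongrightarrow> x \<longrightarrow>
     (\<exists>r v. strict_mono r \<and> v \<in> J x \<and> (V \<circ> r) \<longlonglongrightarrow> v))"

lemma usco_onE:
  fixes X :: "nat \<Rightarrow> 'a::metric_space"
  assumes "usco_on S J" "x \<in> S" "\<And>k. X k \<in> S" "\<And>k. V k \<in> J (X k)" "X \<longlonglongrightarrow> x"
  obtains r v where "strict_mono r" "v \<in> J x" "(V \<circ> r) \<longlonglongrightarrow> v"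
  using assms unfolding usco_on_def by meson

lemma usco_onI:
  assumes "\<And>x X V. x \<in> S \<Longrightarrow> (\<And>k::nat. X k \<in> S) \<Longrightarrow> (\<And>k. V k \<in> J (X k)) \<Longrightarrow> X \<longlonglongrightarrow> x \<Longrightarrow>
    \<exists>r v. strict_mono r \<and> v \<in> J x \<and> (V \<circ> r) \<longlonglongrightarrow> v"
  shows "usco_on S J"
  using assms unfolding usco_on_def by meson

lemma usco_on_iff:
  fixes J :: "'a::metric_space \<Rightarrow> 'b::{real_normed_vector, heine_borel} set"
  shows "usco_on S J \<longleftrightarrow>
    (\<forall>x\<in>S. \<forall>X V v. (\<forall>k::nat. X k \<in> S \<and> V k \<in> J (X k)) \<and> X \<longlonglongrightarrow> x \<and> V \<longlonglongrightarrow> v \<longrightarrow> v \<in> J x) \<and>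
    (\<forall>x\<in>S. \<exists>r>0. bounded (\<Union>y\<in>S \<inter> ball x r. J y))"
proof (intro iffI conjI)
  assume usco: "usco_on S J"
  show "\<forall>x\<in>S. \<forall>X V v. (\<forall>k::nat. X k \<in> S \<and> V k \<in> J (X k)) \<and> X \<longlonglongrightarrow> x \<and> V \<longlonglongrightarrow> v \<longrightarrow> v \<in> J x"
  proof (intro ballI allI impI, elim conjE)
    fix x X V v assume "x \<in> S" and XV: "\<forall>k::nat. X k \<in> S \<and> V k \<in> J (X k)" and lim: "X \<longlonglongrightarrow> x" "V \<longlonglongrightarrow> v"
    then obtain r v' where "strict_mono r" "v' \<in> J x" "(V \<circ> r) \<longlonglongrightarrow> v'"
      using usco_onE[OF usco, of x X V] by blast
    moreover have "(V \<circ> r) \<longlonglongrightarrow> v" using LIMSEQ_subseq_LIMSEQ[OF lim(2) \<open>strict_mono r\<close>] .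
    ultimately show "v \<in> J x" using LIMSEQ_unique by blast
  qed
  show "\<forall>x\<in>S. \<exists>r>0. bounded (\<Union>y\<in>S \<inter> ball x r. J y)"
  proof (rule ballI, rule ccontr)
    fix x assume x: "x \<in> S" and unb: "\<not> (\<exists>r>0. bounded (\<Union>y\<in>S \<inter> ball x r. J y))"
    have "\<exists>y v. y \<in> S \<and> dist y x < 1 / real (Suc n) \<and> v \<in> J y \<and> real n < norm v" for n
    proof -
      have "\<not> bounded (\<Union>y\<in>S \<inter> ball x (1 / real (Suc n)). J y)" using unb by simp
      then have "\<exists>v\<in>(\<Union>y\<in>S \<inter> ball x (1 / real (Suc n)). J y). \<not> norm v \<le> real n"
        unfolding bounded_iff by blast
      then show ?thesis by (auto simp: not_le dist_commute)
    qed
    then obtain X V where XV: "\<And>n. X n \<in> S" "\<And>n. dist (X n) x < 1 / real (Suc n)" "\<And>n. V n \<in> J (X n)"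
      "\<And>n. real n < norm (V n)" by metis
    obtain r v where r: "strict_mono r" "(V \<circ> r) \<longlonglongrightarrow> v"
      using usco_onE[OF usco x XV(1,3) LIMSEQ_if_dist_less_inverse_Suc[OF XV(2)]] by metis
    then obtain B where B: "\<And>n. norm ((V \<circ> r) n) \<le> B"
      using convergent_imp_Bseq[of "V \<circ> r"] by (auto simp: convergent_def Bseq_def)
    obtain n where "B < real n" using reals_Archimedean2 by blast
    also have "real n \<le> real (r n)" using seq_suble[OF r(1)] by simp
    also have "\<dots> < norm ((V \<circ> r) n)" using XV(4) by simp
    finally show False using B[of n] by simp
  qed
next
  assume R: "(\<forall>x\<in>S. \<forall>X V v. (\<forall>k::nat. X k \<in> S \<and> V k \<in> J (X k)) \<and> X \<longlonglongrightarrow> x \<and> V \<longlonglongrightarrow> v \<longrightarrow> v \<in> J x) \<and>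
    (\<forall>x\<in>S. \<exists>r>0. bounded (\<Union>y\<in>S \<inter> ball x r. J y))"
  show "usco_on S J"
  proof (rule usco_onI)
    fix x X V assume x: "x \<in> S" and X: "\<And>k::nat. X k \<in> S" and V: "\<And>k. V k \<in> J (X k)" and lim: "X \<longlonglongrightarrow> x"
    obtain \<rho> where \<rho>: "\<rho> > 0" "bounded (\<Union>y\<in>S \<inter> ball x \<rho>. J y)" using R x by blast
    obtain N where N: "\<And>n. n \<ge> N \<Longrightarrow> dist (X n) x < \<rho>"
      using metric_LIMSEQ_D[OF lim \<rho>(1)] by blast
    have "V (n + N) \<in> (\<Union>y\<in>S \<inter> ball x \<rho>. J y)" for n
      using N[of "n + N"] X[of "n + N"] V[of "n + N"] by (auto simp: dist_commute)
    then have "bounded (range (\<lambda>n. V (n + N)))"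
      by (intro bounded_subset[OF \<rho>(2)]) auto
    then obtain r v where r: "strict_mono r" "((\<lambda>n. V (n + N)) \<circ> r) \<longlonglongrightarrow> v"
      using bounded_imp_convergent_subsequence by blast
    define r' where "r' n = r n + N" for n
    have r': "strict_mono r'" using r(1) by (simp add: r'_def strict_mono_def)
    have lim': "(V \<circ> r') \<longlonglongrightarrow> v" using r(2) by (simp add: r'_def o_def)
    moreover have "v \<in> J x"
      using R x X V lim' LIMSEQ_subseq_LIMSEQ[OF lim r']
      by (metis (no_types, lifting) comp_apply)
    ultimately show "\<exists>r v. strict_mono r \<and> v \<in> J x \<and> (V \<circ> r) \<longlonglongrightarrow> v" using r' by blast
  qed
qed

lemma conservative_jacobian_onD:
  assumes "conservative_jacobian_on S f J"
  shows "x \<in> S \<Longrightarrow> J x \<noteq> {}" "usco_on S J"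
    "ac_path c \<Longrightarrow> c ` {0..1} \<subseteq> S \<Longrightarrow> AE t in lebesgue_on {0..1}. \<exists>d. (c has_vector_derivative d) (at t within {0..1}) \<and>
       (\<forall>v\<in>J (c t). ((\<lambda>s. f (c s)) has_vector_derivative blinfun_apply v d) (at t within {0..1}))"
  using assms unfolding conservative_jacobian_on_def usco_on_iff by blast+

lemma emeasure_lebesgue_on_unit_interval: "emeasure (lebesgue_on {0..1::real}) {0..1} = 1"
  by (simp add: emeasure_restrict_space)

lemma AE_unit_interval_witness:
  assumes "AE t in lebesgue_on {0..1::real}. P t"
  shows "\<exists>t\<in>{0..1}. P t"
proof (rule ccontr)
  assume no: "\<not> (\<exists>t\<in>{0..1}. P t)"
  obtain N where N: "{t \<in> space (lebesgue_on {0..1}). \<not> P t} \<subseteq> N" "emeasure (lebesgue_on {0..1}) N = 0"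
    "N \<in> sets (lebesgue_on {0..1})"
    using assms by (rule AE_E)
  have "{0..1} \<subseteq> N" using N(1) no by (auto simp: space_restrict_space)
  then have "emeasure (lebesgue_on {0..1::real}) {0..1} \<le> emeasure (lebesgue_on {0..1}) N"
    using N(3) by (rule emeasure_mono)
  then show False using N(2) by (simp add: emeasure_lebesgue_on_unit_interval)
qed

lemma ac_path_segment: "ac_path (\<lambda>t. a + t *\<^sub>R d)" for a d :: "'a::euclidean_space"
  unfolding ac_path_def
proof (intro conjI exI[of _ "\<lambda>_. d"])
  show "abs_cont_01 (\<lambda>t. a + t *\<^sub>R d)"
    unfolding abs_cont_01_def
  proof (intro allI impI)
    fix \<epsilon> :: real assume \<epsilon>: "\<epsilon> > 0"
    show "\<exists>\<delta>>0. \<forall>(n::nat) u v. (\<forall>i<n. 0 \<le> u i \<and> u i \<le> v i \<and> v i \<le> 1) \<and>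
       disjoint_family_on (\<lambda>i. {u i<..<v i}) {..<n} \<and> (\<Sum>i<n. v i - u i) < \<delta> \<longrightarrow>
       (\<Sum>i<n. norm ((a + v i *\<^sub>R d) - (a + u i *\<^sub>R d))) < \<epsilon>"
    proof (intro exI[of _ "\<epsilon> / (norm d + 1)"] conjI allI impI)
      show "0 < \<epsilon> / (norm d + 1)" using \<epsilon> by (simp add: add_nonneg_pos)
      fix n :: nat and u v :: "nat \<Rightarrow> real"
      assume A: "(\<forall>i<n. 0 \<le> u i \<and> u i \<le> v i \<and> v i \<le> 1) \<and>
        disjoint_family_on (\<lambda>i. {u i<..<v i}) {..<n} \<and> (\<Sum>i<n. v i - u i) < \<epsilon> / (norm d + 1)"
      have "(\<Sum>i<n. norm ((a + v i *\<^sub>R d) - (a + u i *\<^sub>R d))) = (\<Sum>i<n. (v i - u i) * norm d)"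
        using A by (intro sum.cong) (auto simp: scaleR_diff_left[symmetric])
      also have "\<dots> = (\<Sum>i<n. v i - u i) * norm d" by (simp add: sum_distrib_right)
      also have "\<dots> \<le> (\<Sum>i<n. v i - u i) * (norm d + 1)"
        using A by (intro mult_left_mono sum_nonneg) auto
      also have "\<dots> < \<epsilon>" using A by (simp add: pos_less_divide_eq add_nonneg_pos)
      finally show "(\<Sum>i<n. norm ((a + v i *\<^sub>R d) - (a + u i *\<^sub>R d))) < \<epsilon>" .
    qed
  qed
  show "AE t in lebesgue_on {0..1}. ((\<lambda>t. a + t *\<^sub>R d) has_vector_derivative d) (at t within {0..1})"
    by (intro AE_I2) (auto intro!: derivative_eq_intros)
  show "\<forall>t\<in>{0..1}. has_bochner_integral (lebesgue_on {0..t}) (\<lambda>_. d) (a + t *\<^sub>R d - (a + 0 *\<^sub>R d))"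
  proof
    fix t :: real assume t: "t \<in> {0..1}"
    have "has_bochner_integral lebesgue (\<lambda>s. indicator {0..t} s *\<^sub>R d) (t *\<^sub>R d)"
      using has_bochner_integral_scaleR_left[OF has_bochner_integral_real_indicator[of "{0..t}" lebesgue], of d] t
      by simp
    then show "has_bochner_integral (lebesgue_on {0..t}) (\<lambda>_. d) (a + t *\<^sub>R d - (a + 0 *\<^sub>R d))"
      by (simp add: has_bochner_integral_restrict_space)
  qed
qed

lemma has_vector_derivative_compose_linear:
  assumes "(f has_derivative D) (at (c t))" "(c has_vector_derivative d) (at t within I)"
  shows "((\<lambda>s. f (c s)) has_vector_derivative D d) (at t within I)"
  using vector_derivative_diff_chain_within[OF assms(2) has_derivative_at_withinI[OF assms(1)]]
  by (simp add: o_def)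

lemma unit_interval_derivative_unique:
  assumes "t \<in> {0..1::real}" "(f has_vector_derivative a) (at t within {0..1})"
    "(f has_vector_derivative b) (at t within {0..1})"
  shows "a = b"
  using vector_derivative_unique_within_closed_interval[of 0 1 t f a b] assms by simp

text \<open>
  On a segment in direction \<open>b\<close> inside \<open>\<Omega>\<close>, the chain rule gives a point at which all elements of \<open>J\<close>
  agree with \<open>D\<close> on \<open>b\<close>. Upper semicontinuity extends this approximately to a neighbourhood.
\<close>

lemma conservative_jacobian_nearly_derivative:
  fixes f :: "'a::euclidean_space \<Rightarrow> 'b::euclidean_space"
  assumes J: "conservative_jacobian_on UNIV f J" and \<Omega>: "open \<Omega>" "\<Omega> \<noteq> {}"
    and D: "\<And>x. x \<in> \<Omega> \<Longrightarrow> (f has_derivative blinfun_apply D) (at x)" and "\<delta> > 0"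
  shows "\<exists>\<Omega>'. open \<Omega>' \<and> \<Omega>' \<noteq> {} \<and> \<Omega>' \<subseteq> \<Omega> \<and> (\<forall>x\<in>\<Omega>'. \<forall>v\<in>J x. norm (v b - D b) < \<delta>)"
proof -
  obtain a where a: "a \<in> \<Omega>" using \<Omega>(2) by blast
  then obtain e where e: "e > 0" "ball a e \<subseteq> \<Omega>" using \<Omega>(1) open_contains_ball by blast
  define \<eta> where "\<eta> = e / (norm b + 1)"
  have \<eta>: "\<eta> > 0" "\<eta> * norm b < e"
    using e by (auto simp: \<eta>_def add_nonneg_pos divide_simps)
  define c where "c t = a + t *\<^sub>R (\<eta> *\<^sub>R b)" for t
  have c_in: "c t \<in> \<Omega>" if "t \<in> {0..1}" for t
  proof -
    have "dist a (c t) = t * (\<eta> * norm b)" using that \<eta>(1) by (simp add: c_def dist_norm)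
    also have "\<dots> \<le> 1 * (\<eta> * norm b)" using that \<eta>(1) by (intro mult_right_mono) auto
    finally show ?thesis using e(2) \<eta>(2) by auto
  qed
  have c: "ac_path c" using ac_path_segment[of a "\<eta> *\<^sub>R b"] by (simp add: c_def[abs_def])
  then obtain t d where t: "t \<in> {0..1}" and d: "(c has_vector_derivative d) (at t within {0..1})"
    and v: "\<And>v. v \<in> J (c t) \<Longrightarrow> ((\<lambda>s. f (c s)) has_vector_derivative blinfun_apply v d) (at t within {0..1})"
    using AE_unit_interval_witness[OF conservative_jacobian_onD(3)[OF J c subset_UNIV]] by blast
  have "(c has_vector_derivative \<eta> *\<^sub>R b) (at t within {0..1})"
    unfolding c_def by (auto intro!: derivative_eq_intros)
  then have d_eq: "d = \<eta> *\<^sub>R b" using unit_interval_derivative_unique t d by blast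
  have exact: "v b = D b" if "v \<in> J (c t)" for v
  proof -
    have "blinfun_apply v d = blinfun_apply D d"
      using unit_interval_derivative_unique[OF t v[OF that]
          has_vector_derivative_compose_linear[OF D[OF c_in[OF t]] d]] .
    then show ?thesis using \<eta>(1) by (simp add: d_eq blinfun.scaleR_right)
  qed
  have "\<exists>r>0. \<forall>x\<in>ball (c t) r. \<forall>v\<in>J x. norm (v b - D b) < \<delta>"
  proof (rule ccontr)
    assume no: "\<not> ?thesis"
    have "\<exists>x v. dist x (c t) < 1 / real (Suc n) \<and> v \<in> J x \<and> \<delta> \<le> norm (v b - D b)" for n
    proof -
      have "0 < 1 / real (Suc n)" by simp
      then have "\<not> (\<forall>x\<in>ball (c t) (1 / real (Suc n)). \<forall>v\<in>J x. norm (v b - D b) < \<delta>)"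
        using no by blast
      then obtain x v where "x \<in> ball (c t) (1 / real (Suc n))" "v \<in> J x" "\<not> norm (v b - D b) < \<delta>"
        by blast
      then show ?thesis
        by (intro exI[of _ x] exI[of _ v]) (simp add: dist_commute not_less del: of_nat_Suc)
    qed
    then obtain X V where XV: "\<And>n. dist (X n) (c t) < 1 / real (Suc n)" "\<And>n. V n \<in> J (X n)"
      "\<And>n. \<delta> \<le> norm (V n b - D b)" by metis
    obtain r v where r: "strict_mono r" "v \<in> J (c t)" "(V \<circ> r) \<longlonglongrightarrow> v"
      using usco_onE[OF conservative_jacobian_onD(2)[OF J] UNIV_I UNIV_I XV(2) LIMSEQ_if_dist_less_inverse_Suc[OF XV(1)]]
      by metis
    have "(\<lambda>n. norm ((V \<circ> r) n b - D b)) \<longlonglongrightarrow> norm (v b - D b)"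
      by (intro tendsto_intros r(3))
    then have "\<delta> \<le> norm (v b - D b)"
      by (rule tendsto_lowerbound) (use XV(3) in auto)
    then show False using exact[OF r(2)] \<open>\<delta> > 0\<close> by simp
  qed
  then obtain r where r: "r > 0" "\<forall>x\<in>ball (c t) r. \<forall>v\<in>J x. norm (v b - D b) < \<delta>" by blast
  have "c t \<in> \<Omega> \<inter> ball (c t) r" using c_in[OF t] r(1) by simp
  then show ?thesis
    using r(2) \<Omega>(1) by (intro exI[of _ "\<Omega> \<inter> ball (c t) r"]) auto
qed

text \<open>
  A segment controls one direction only. Since the good set for each direction contains an open set,
  shrinking the open set once per direction yields points that are good for all of them.
\<close>

lemma conservative_jacobian_nearly_derivative_finite:
  fixes f :: "'a::euclidean_space \<Rightarrow> 'b::euclidean_space"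
  assumes J: "conservative_jacobian_on UNIV f J" and "finite B" and \<Omega>: "open \<Omega>" "\<Omega> \<noteq> {}"
    and D: "\<And>x. x \<in> \<Omega> \<Longrightarrow> (f has_derivative blinfun_apply D) (at x)" and "\<delta> > 0"
  shows "\<exists>\<Omega>'. open \<Omega>' \<and> \<Omega>' \<noteq> {} \<and> \<Omega>' \<subseteq> \<Omega> \<and> (\<forall>x\<in>\<Omega>'. \<forall>v\<in>J x. \<forall>b\<in>B. norm (v b - D b) < \<delta>)"
  using \<open>finite B\<close>
proof (induction B rule: finite_induct)
  case empty
  then show ?case using \<Omega> by auto
next
  case (insert b B)
  then obtain \<Omega>1 where 1: "open \<Omega>1" "\<Omega>1 \<noteq> {}" "\<Omega>1 \<subseteq> \<Omega>" "\<forall>x\<in>\<Omega>1. \<forall>v\<in>J x. \<forall>b\<in>B. norm (v b - D b) < \<delta>"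
    by blast
  obtain \<Omega>2 where 2: "open \<Omega>2" "\<Omega>2 \<noteq> {}" "\<Omega>2 \<subseteq> \<Omega>1" "\<forall>x\<in>\<Omega>2. \<forall>v\<in>J x. norm (v b - D b) < \<delta>"
    using conservative_jacobian_nearly_derivative[OF J 1(1,2) D \<open>\<delta> > 0\<close>, of b] 1(3) by blast
  show ?case using 1 2 by (intro exI[of _ \<Omega>2]) auto
qed

text \<open>
  Here \<open>x\<close> may lie on the boundary of \<open>\<Omega>\<close>; elements of \<open>J\<close> that nearly agree with \<open>D\<close> on the whole basis
  exist arbitrarily close to \<open>x\<close>, and the graph of \<open>J\<close> is closed.
\<close>

lemma conservative_jacobian_contains_derivative_limit:
  fixes f :: "'a::euclidean_space \<Rightarrow> 'b::euclidean_space"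
  assumes J: "conservative_jacobian_on UNIV f J" and \<Omega>: "open \<Omega>"
    and D: "\<And>x. x \<in> \<Omega> \<Longrightarrow> (f has_derivative blinfun_apply D) (at x)" and x: "x \<in> closure \<Omega>"
  shows "D \<in> J x"
proof -
  have "\<exists>y v. dist y x < 1 / real (Suc n) \<and> v \<in> J y \<and> (\<forall>b\<in>Basis. dist (v b) (D b) < 1 / real (Suc n))" for n
  proof -
    have "\<Omega> \<inter> ball x (1 / real (Suc n)) \<noteq> {}"
      using x[unfolded closure_approachable, rule_format, of "1 / real (Suc n)"] by (auto simp: dist_commute)
    then obtain \<Omega>' where "\<Omega>' \<noteq> {}" "\<Omega>' \<subseteq> \<Omega> \<inter> ball x (1 / real (Suc n))"
      "\<forall>y\<in>\<Omega>'. \<forall>v\<in>J y. \<forall>b\<in>Basis. norm (v b - D b) < 1 / real (Suc n)"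
      using conservative_jacobian_nearly_derivative_finite[OF J finite_Basis _ _ D, of "\<Omega> \<inter> ball x (1 / real (Suc n))" "1 / real (Suc n)"]
      by (auto simp: open_Int \<Omega>)
    moreover obtain y where y: "y \<in> \<Omega>'" using \<open>\<Omega>' \<noteq> {}\<close> by blast
    moreover have "dist y x < 1 / real (Suc n)"
      using y calculation(2) by (subst dist_commute) (auto simp only: mem_ball)
    moreover obtain v where "v \<in> J y" using conservative_jacobian_onD(1)[OF J UNIV_I] by blast
    ultimately show ?thesis by (intro exI[of _ y] exI[of _ v]) (auto simp only: dist_norm[of "blinfun_apply _ _"])
  qed
  then obtain X V where XV: "\<And>n. dist (X n) x < 1 / real (Suc n)" "\<And>n. V n \<in> J (X n)"
    "\<And>n b. b \<in> Basis \<Longrightarrow> dist (V n b) (D b) < 1 / real (Suc n)" by metis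
  have "V \<longlonglongrightarrow> D"
    by (intro tendsto_componentwise1 LIMSEQ_if_dist_less_inverse_Suc XV(3))
  moreover have "X \<longlonglongrightarrow> x" using XV(1) by (rule LIMSEQ_if_dist_less_inverse_Suc)
  ultimately show ?thesis
    using J XV(2) unfolding conservative_jacobian_on_def by blast
qed

section \<open>The projector onto the dual cone\<close>

lemma proj_cone_nth:
  fixes w :: "real^('i::finite + 'e::finite)"
  shows "proj_cone w $ Inl i = max 0 (w $ Inl i)" "proj_cone w $ Inr j = w $ Inr j"
proof -
  define p :: "real^('i + 'e)" where "p = (\<chi> r. case r of Inl i \<Rightarrow> max 0 (w $ Inl i) | Inr j \<Rightarrow> w $ Inr j)"
  have cone: "dual_cone = {z :: real^('i + 'e). \<forall>i. 0 \<le> z $ Inl i}"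
    by (simp add: dual_cone_def E_mat_nonneg_iff)
  have "p = proj_cone w"
  proof (rule closest_point_unique)
    show "convex (dual_cone :: (real^('i + 'e)) set)"
      unfolding cone by (auto simp: convex_def)
    show "closed (dual_cone :: (real^('i + 'e)) set)"
      unfolding cone by (intro closed_Collect_all closed_Collect_le continuous_intros)
    show "p \<in> dual_cone" by (simp add: cone p_def)
    show "\<forall>z\<in>dual_cone. dist w p \<le> dist w z"
    proof
      fix z :: "real^('i + 'e)" assume z: "z \<in> dual_cone"
      have "norm ((w - p) $ r) \<le> norm ((w - z) $ r)" for r
      proof (cases r)
        case (Inl i)
        have "0 \<le> z $ Inl i" using z by (simp add: cone)
        then show ?thesis using Inl by (simp add: p_def max_def)
      qed (simp add: p_def)
      then show "dist w p \<le> dist w z"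
        unfolding dist_norm by (rule norm_le_componentwise_cart)
    qed
  qed
  then show "proj_cone w $ Inl i = max 0 (w $ Inl i)" "proj_cone w $ Inr j = w $ Inr j"
    by (simp_all add: p_def flip: \<open>p = proj_cone w\<close>)
qed

definition diag_map :: "real^'n \<Rightarrow> ((real^'n) \<Rightarrow>\<^sub>L (real^'n))" where
  "diag_map d = Blinfun (\<lambda>u. \<chi> r. d $ r * u $ r)"

lemma diag_map_nth [simp]:
  fixes d u :: "real^'n"
  shows "blinfun_apply (diag_map d) u $ r = d $ r * u $ r"
proof -
  have "linear (\<lambda>u :: real^'n. \<chi> r. d $ r * u $ r)"
    by (auto intro!: linearI simp: vec_eq_iff algebra_simps)
  then show ?thesis
    by (simp add: diag_map_def bounded_linear_Blinfun_apply linear_conv_bounded_linear)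
qed

text \<open>
  The projector acts on each component separately, by the positive part on sign-constrained ones.
  These vectors are the diagonals formed by its slopes at \<open>w\<close>, with any slope between 0 and 1 at a
  kink.
\<close>

definition projector_slopes :: "real^('i::finite + 'e::finite) \<Rightarrow> (real^('i + 'e)) set" where
  "projector_slopes w = {d. (\<forall>r. 0 \<le> d $ r \<and> d $ r \<le> 1) \<and>
     (\<forall>i. (0 < w $ Inl i \<longrightarrow> d $ Inl i = 1) \<and> (w $ Inl i < 0 \<longrightarrow> d $ Inl i = 0)) \<and> (\<forall>j. d $ Inr j = 1)}"

text \<open>
  At a kink the slope is multiplied by zero.
\<close>

lemma diag_map_slopes_self: "d \<in> projector_slopes w \<Longrightarrow> diag_map d w = proj_cone w"
  unfolding vec_eq_iff all_sum_type
proof (intro conjI allI)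
  fix i assume "d \<in> projector_slopes w"
  then show "diag_map d w $ Inl i = proj_cone w $ Inl i"
    by (cases "w $ Inl i" "0::real" rule: linorder_cases) (auto simp: proj_cone_nth projector_slopes_def)
qed (simp add: proj_cone_nth projector_slopes_def)

lemma diag_map_linear: "linear (diag_map :: real^'n \<Rightarrow> _)"
  by (auto intro!: linearI blinfun_eqI simp: vec_eq_iff algebra_simps blinfun.add_left blinfun.scaleR_left)

lemma tendsto_diag_map:
  assumes "(d \<longlongrightarrow> d0) F" shows "((\<lambda>k. diag_map (d k)) \<longlongrightarrow> diag_map d0) F"
  by (intro tendsto_componentwise1 vec_tendstoI) (auto intro!: tendsto_intros assms)

lemma convex_projector_slopes: "convex (projector_slopes w)"
proof (rule convexI)
  fix x y and u v :: real
  assume xy: "x \<in> projector_slopes w" "y \<in> projector_slopes w" and uv: "0 \<le> u" "0 \<le> v" "u + v = 1"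
  have "u * x $ r + v * y $ r \<le> 1" for r
  proof -
    have "u * x $ r + v * y $ r \<le> u * 1 + v * 1"
      using xy uv by (intro add_mono mult_left_mono) (auto simp: projector_slopes_def)
    then show ?thesis using uv by simp
  qed
  then show "u *\<^sub>R x + v *\<^sub>R y \<in> projector_slopes w"
    using xy uv by (auto simp: projector_slopes_def)
qed

lemma projector_slopes_limit:
  assumes "\<And>k. d k \<in> projector_slopes (w k)" "w \<longlonglongrightarrow> w0" "d \<longlonglongrightarrow> d0"
  shows "d0 \<in> projector_slopes w0"
proof -
  have lim: "(\<lambda>k. d k $ r) \<longlonglongrightarrow> d0 $ r" "(\<lambda>k. w k $ r) \<longlonglongrightarrow> w0 $ r" for r
    using assms by (auto intro: tendsto_vec_nth)
  have "0 \<le> d0 $ r" "d0 $ r \<le> 1" for r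
    using assms(1) by (auto intro!: LIMSEQ_le_const[OF lim(1)] LIMSEQ_le_const2[OF lim(1)] simp: projector_slopes_def)
  moreover have "d0 $ Inr j = 1" for j
    using LIMSEQ_unique[OF lim(1)[of "Inr j"], of 1] assms(1) by (simp add: projector_slopes_def)
  moreover have "d0 $ Inl i = 1" if "0 < w0 $ Inl i" for i
  proof -
    have "\<forall>\<^sub>F k in sequentially. d k $ Inl i = 1"
      using order_tendstoD(1)[OF lim(2) that] by eventually_elim (use assms(1) in \<open>auto simp: projector_slopes_def\<close>)
    then show ?thesis using LIMSEQ_unique[OF lim(1) tendsto_eventually] by blast
  qed
  moreover have "d0 $ Inl i = 0" if "w0 $ Inl i < 0" for i
  proof -
    have "\<forall>\<^sub>F k in sequentially. d k $ Inl i = 0"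
      using order_tendstoD(2)[OF lim(2) that] by eventually_elim (use assms(1) in \<open>auto simp: projector_slopes_def\<close>)
    then show ?thesis using LIMSEQ_unique[OF lim(1) tendsto_eventually] by blast
  qed
  ultimately show ?thesis by (simp add: projector_slopes_def)
qed

lemma bounded_projector_slopes: "\<exists>B. \<forall>w. \<forall>d\<in>projector_slopes w. norm (d :: real^('i::finite + 'e::finite)) \<le> B"
proof (intro exI allI ballI)
  fix w d :: "real^('i + 'e)" assume "d \<in> projector_slopes w"
  then have "norm (d $ r) \<le> norm ((1 :: real^('i + 'e)) $ r)" for r
    by (simp add: projector_slopes_def)
  then show "norm d \<le> norm (1 :: real^('i + 'e))" by (rule norm_le_componentwise_cart)
qed

lemma usco_projector_slopes: "usco_on UNIV projector_slopes"
proof (rule usco_onI)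
  fix x and X V :: "nat \<Rightarrow> real^('a + 'b)"
  assume V: "\<And>k. V k \<in> projector_slopes (X k)" and X: "X \<longlonglongrightarrow> x"
  have "bounded (range V)"
    using bounded_projector_slopes V unfolding bounded_iff by blast
  then obtain r v where r: "strict_mono r" "(V \<circ> r) \<longlonglongrightarrow> v"
    using bounded_imp_convergent_subsequence by blast
  then have "v \<in> projector_slopes x"
    using projector_slopes_limit[OF _ LIMSEQ_subseq_LIMSEQ[OF X r(1)], of "V \<circ> r"] V by simp
  with r show "\<exists>r v. strict_mono r \<and> v \<in> projector_slopes x \<and> (V \<circ> r) \<longlonglongrightarrow> v" by blast
qed

text \<open>
  Component \<open>r\<close> of the projector depends on component \<open>r\<close> of its argument only, so a derivative is
  diagonal. Its entries are limits of difference quotients of the positive part.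
\<close>

lemma proj_cone_derivative_slopes:
  fixes x :: "real^('i::finite + 'e::finite)"
  assumes D: "(proj_cone has_derivative blinfun_apply D) (at x)"
  shows "\<exists>d\<in>projector_slopes x. D = diag_map d"
proof -
  define d where "d = (\<chi> r. D (axis r 1) $ r)"
  have lim: "((\<lambda>t. (proj_cone (x + t *\<^sub>R u) $ r - proj_cone x $ r) / t) \<longlongrightarrow> D u $ r) (at 0)" for u r
  proof -
    have D0: "(proj_cone has_derivative blinfun_apply D) (at (x + 0 *\<^sub>R u))" using D by simp
    have "((\<lambda>t. x + t *\<^sub>R u) has_vector_derivative u) (at 0)"
      by (auto intro!: derivative_eq_intros)
    from has_vector_derivative_compose_linear[OF D0 this]
    have "((\<lambda>t. proj_cone (x + t *\<^sub>R u) $ r) has_vector_derivative D u $ r) (at 0)"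
      using bounded_linear.has_vector_derivative[OF bounded_linear_vec_nth] by blast
    then show ?thesis
      unfolding has_real_derivative_iff_has_vector_derivative[symmetric] has_field_derivative_def[symmetric]
        DERIV_def by simp
  qed
  have decouple: "D u $ r = 0" if "u $ r = 0" for u r
  proof -
    have "proj_cone (x + t *\<^sub>R u) $ r = proj_cone x $ r" for t
      using that by (cases r) (simp_all add: proj_cone_nth)
    then have "((\<lambda>t::real. 0) \<longlongrightarrow> D u $ r) (at 0)" using lim[of u r] by simp
    then show ?thesis using tendsto_unique[OF _ _ tendsto_const] by (metis at_neq_bot)
  qed
  have diag: "D u $ r = d $ r * u $ r" for u r
  proof -
    have "D (u - u $ r *\<^sub>R axis r 1) $ r = 0"
      by (rule decouple) simp
    then show ?thesis by (simp add: d_def blinfun.diff_right blinfun.scaleR_right)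
  qed
  then have "D = diag_map d" by (intro blinfun_eqI) (simp add: vec_eq_iff)
  moreover have "d \<in> projector_slopes x"
  proof -
    define q where "q r t = (proj_cone (x + t *\<^sub>R axis r 1) $ r - proj_cone x $ r) / t" for r t
    have q: "(q r \<longlongrightarrow> d $ r) (at 0)" for r
      using lim[where u = "axis r 1" and r = r] by (simp add: q_def[abs_def] d_def)
    have q_Inl: "q (Inl i) t = (max 0 (x $ Inl i + t) - max 0 (x $ Inl i)) / t" for i t
      by (simp add: q_def proj_cone_nth)
    have q_Inr: "q (Inr j) t = t / t" for j t
      by (simp add: q_def proj_cone_nth)
    have bounds: "0 \<le> q r t \<and> q r t \<le> 1" for r t
    proof (cases r)
      case (Inl i)
      then show ?thesis
        by (cases t "0::real" rule: linorder_cases) (auto simp: q_Inl max_def divide_simps)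
    qed (simp add: q_Inr)
    have "0 \<le> d $ r" "d $ r \<le> 1" for r
      using tendsto_lowerbound[OF q always_eventually] tendsto_upperbound[OF q always_eventually] bounds
      by (auto simp: trivial_limit_at)
    moreover have "d $ Inr j = 1" for j
    proof -
      have "\<forall>\<^sub>F t in at 0. q (Inr j) t = 1"
        by (auto simp: q_Inr eventually_at intro!: exI[of _ 1])
      then show ?thesis using tendsto_unique[OF _ q tendsto_eventually] by (metis at_neq_bot)
    qed
    moreover have "d $ Inl i = 1" if "0 < x $ Inl i" for i
    proof -
      have "\<forall>\<^sub>F t in at 0. q (Inl i) t = 1"
        using that by (auto simp: q_Inl eventually_at dist_real_def intro!: exI[of _ "x $ Inl i"])
      then show ?thesis using tendsto_unique[OF _ q tendsto_eventually] by (metis at_neq_bot)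
    qed
    moreover have "d $ Inl i = 0" if "x $ Inl i < 0" for i
    proof -
      have "\<forall>\<^sub>F t in at 0. q (Inl i) t = 0"
        using that by (auto simp: q_Inl eventually_at dist_real_def intro!: exI[of _ "- x $ Inl i"])
      then show ?thesis using tendsto_unique[OF _ q tendsto_eventually] by (metis at_neq_bot)
    qed
    ultimately show ?thesis by (simp add: projector_slopes_def)
  qed
  ultimately show ?thesis by blast
qed

lemma clarke_jacobian_proj_cone_subset:
  "clarke_jacobian proj_cone w \<subseteq> diag_map ` projector_slopes w"
  unfolding clarke_jacobian_def
proof (rule hull_minimal)
  show "convex (diag_map ` projector_slopes w)"
    by (intro convex_linear_image diag_map_linear convex_projector_slopes)
  show "{v. \<exists>X D. (\<forall>k::nat. (proj_cone has_derivative blinfun_apply (D k)) (at (X k))) \<and> X \<longlonglongrightarrow> w \<and> D \<longlonglongrightarrow> v}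
    \<subseteq> diag_map ` projector_slopes w"
  proof (clarify)
    fix v X D assume D: "\<forall>k::nat. (proj_cone has_derivative blinfun_apply (D k)) (at (X k))"
      and X: "X \<longlonglongrightarrow> w" and lim: "D \<longlonglongrightarrow> v"
    then obtain d where d: "\<And>k. d k \<in> projector_slopes (X k)" "\<And>k. D k = diag_map (d k)"
      using proj_cone_derivative_slopes[OF D[rule_format]] by metis
    obtain r d0 where r: "strict_mono r" "d0 \<in> projector_slopes w" "(d \<circ> r) \<longlonglongrightarrow> d0"
      using usco_onE[OF usco_projector_slopes UNIV_I UNIV_I d(1) X] by metis
    have "(D \<circ> r) \<longlonglongrightarrow> diag_map d0"
      using tendsto_diag_map[OF r(3)] by (simp add: o_def d(2))
    then have "v = diag_map d0"
      using LIMSEQ_unique LIMSEQ_subseq_LIMSEQ[OF lim r(1)] by blast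
    then show "v \<in> diag_map ` projector_slopes w" using r(2) by blast
  qed
qed

text \<open>
  Pushing the nonnegative components of \<open>w\<close> slightly upwards leads into an open orthant on which the
  projector is linear. Its derivative there is an element of both sets.
\<close>

lemma conservative_clarke_element:
  fixes w :: "real^('i::finite + 'e::finite)"
  assumes J: "conservative_jacobian_on UNIV proj_cone J"
  shows "J w \<inter> clarke_jacobian proj_cone w \<noteq> {}"
proof -
  define d :: "real^('i + 'e)" where "d = (\<chi> r. case r of Inl i \<Rightarrow> if w $ Inl i < 0 then 0 else 1 | Inr j \<Rightarrow> 1)"
  define \<Omega> where "\<Omega> = {x :: real^('i + 'e). \<forall>i. if w $ Inl i < 0 then x $ Inl i < 0 else 0 < x $ Inl i}"
  define X where "X n = w + (1 / real (Suc n)) *\<^sub>R (\<chi> r. if w $ r < 0 then 0 else 1)" for n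
  have "open {x::real^('i + 'e). if w $ Inl i < 0 then x $ Inl i < 0 else 0 < x $ Inl i}" for i
    by (cases "w $ Inl i < 0") (auto intro!: open_Collect_less continuous_intros)
  then have op: "open \<Omega>" 
    unfolding \<Omega>_def Collect_all_eq by (intro open_INT) auto
  have local: "proj_cone x = diag_map d x" if "x \<in> \<Omega>" for x
  proof -
    have "proj_cone x $ Inl i = diag_map d x $ Inl i" for i
    proof (cases "w $ Inl i < 0")
      case True
      then have "x $ Inl i < 0" using that by (simp add: \<Omega>_def)
      then show ?thesis using True by (simp add: proj_cone_nth d_def)
    next
      case False
      then have "0 < x $ Inl i" using that by (simp add: \<Omega>_def)
      then show ?thesis using False by (simp add: proj_cone_nth d_def)
    qed
    then show ?thesis
      unfolding vec_eq_iff all_sum_type by (simp add: proj_cone_nth d_def)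
  qed
  have D: "(proj_cone has_derivative diag_map d) (at x)" if "x \<in> \<Omega>" for x
    by (rule has_derivative_transform_within_open[OF
          bounded_linear_imp_has_derivative[OF blinfun.bounded_linear_right] op that])
      (simp add: local)
  have X_in: "X n \<in> \<Omega>" for n
    by (auto simp: X_def \<Omega>_def add_nonneg_pos)
  have "(\<lambda>n. 1 / real (Suc n)) \<longlonglongrightarrow> 0"
    using LIMSEQ_Suc[OF lim_const_over_n[of 1]] by simp
  then have "X \<longlonglongrightarrow> w + 0 *\<^sub>R (\<chi> r. if w $ r < 0 then 0 else 1)"
    unfolding X_def by (intro tendsto_intros)
  then have X: "X \<longlonglongrightarrow> w" by simp
  have "w \<in> closure \<Omega>"
    using X X_in closure_sequential by blast
  from conservative_jacobian_contains_derivative_limit[OF J op D this]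
  have "diag_map d \<in> J w" .
  moreover have "diag_map d \<in> clarke_jacobian proj_cone w"
    unfolding clarke_jacobian_def
    by (intro hull_inc CollectI exI[of _ X] exI[of _ "\<lambda>_. diag_map d"]) (auto intro!: D X_in X)
  ultimately show ?thesis by blast
qed

section \<open>Derivatives along paths\<close>

lemma countable_isolated_points:
  fixes A :: "'a::second_countable_topology set"
  shows "countable {x. x isolated_in A}"
proof -
  obtain \<B> :: "'a set set" where \<B>: "countable \<B>" "topological_basis \<B>"
    using ex_countable_basis by blast
  have "\<exists>B\<in>\<B>. B \<inter> A = {x}" if "x isolated_in A" for x
  proof -
    obtain T where "x \<in> A" "open T" "T \<inter> A = {x}" using isolated_inE[OF \<open>x isolated_in A\<close>] .
    moreover from this obtain B where "B \<in> \<B>" "x \<in> B" "B \<subseteq> T"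
      using topological_basisE[OF \<B>(2), of T x] by blast
    ultimately show ?thesis by blast
  qed
  then obtain b where b: "\<And>x. x isolated_in A \<Longrightarrow> b x \<in> \<B> \<and> b x \<inter> A = {x}" by metis
  have "inj_on b {x. x isolated_in A}"
    using b by (intro inj_onI) (metis mem_Collect_eq singleton_inject)
  moreover have "b ` {x. x isolated_in A} \<subseteq> \<B>" using b by blast
  ultimately show ?thesis using \<B>(1) countable_image_inj_on countable_subset by metis
qed

lemma has_vector_derivative_iff_quotient:
  fixes f :: "real \<Rightarrow> 'a::real_normed_vector"
  shows "(f has_vector_derivative d) (at t within I) \<longleftrightarrow>
    ((\<lambda>s. (f s - f t) /\<^sub>R (s - t)) \<longlongrightarrow> d) (at t within I)"
proof -
  have "norm ((1 / norm (s - t)) *\<^sub>R (f s - (f t + (s - t) *\<^sub>R d))) = norm ((f s - f t) /\<^sub>R (s - t) - d)"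
    if "s \<noteq> t" for s
  proof -
    have "(f s - f t) /\<^sub>R (s - t) - d = inverse (s - t) *\<^sub>R (f s - (f t + (s - t) *\<^sub>R d))"
      using that by (simp add: scaleR_diff_right scaleR_add_right)
    then show ?thesis by (simp add: divide_inverse abs_inverse)
  qed
  then have "((\<lambda>s. norm ((1 / norm (s - t)) *\<^sub>R (f s - (f t + (s - t) *\<^sub>R d)))) \<longlongrightarrow> 0) (at t within I) \<longleftrightarrow>
    ((\<lambda>s. norm ((f s - f t) /\<^sub>R (s - t) - d)) \<longlongrightarrow> 0) (at t within I)"
    by (intro Lim_cong_within) auto
  then show ?thesis
    unfolding has_vector_derivative_def has_derivative_within tendsto_norm_zero_iff LIM_zero_iff
    by (simp add: bounded_linear_scaleR_left)
qed

lemma isolated_zero: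
  fixes f :: "real \<Rightarrow> 'a::real_normed_vector"
  assumes d: "(f has_vector_derivative d) (at t within I)" "d \<noteq> 0" and t: "t \<in> I" "f t = 0"
  shows "t isolated_in {s \<in> I. f s = 0}"
proof -
  have "\<forall>\<^sub>F s in at t within I. (f s - f t) /\<^sub>R (s - t) \<noteq> 0"
    by (rule tendsto_imp_eventually_ne[OF d(1)[unfolded has_vector_derivative_iff_quotient] d(2)])
  then have "\<forall>\<^sub>F s in at t. s \<notin> {s \<in> I. f s = 0}"
    unfolding eventually_at_filter by eventually_elim (use t in auto)
  then show ?thesis using t by (simp add: isolated_in_altdef)
qed

text \<open>
  The formulas that occur arbitrarily close to \<open>t\<close> agree with \<open>f\<close> at \<open>t\<close>. If two of them have different
  derivatives at \<open>t\<close>, then \<open>t\<close> is an isolated point of the set where they agree; this happens for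
  countably many \<open>t\<close> only. Otherwise they share one derivative, and \<open>f\<close> has it too because there are
  finitely many formulas.
\<close>

lemma selection_differentiable:
  fixes f :: "real \<Rightarrow> 'a::real_normed_vector" and g :: "'k::finite \<Rightarrow> real \<Rightarrow> 'a"
  assumes sel: "\<And>t. t \<in> I \<Longrightarrow> f t = g (p t) t" and T: "T \<subseteq> I"
    and diff: "\<And>t k. t \<in> T \<Longrightarrow> t \<in> closure {s \<in> I. p s = k} \<Longrightarrow>
      g k t = f t \<and> (\<exists>d. (g k has_vector_derivative d) (at t within I))"
  shows "\<exists>E. countable E \<and> (\<forall>t\<in>T - E. \<exists>d. (f has_vector_derivative d) (at t within I))"
proof -
  let ?E = "\<Union>k k'. {t. t isolated_in {s \<in> I. g k s - g k' s = 0}}"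
  have "\<exists>d. (f has_vector_derivative d) (at t within I)" if t: "t \<in> T - ?E" for t
  proof -
    have tI: "t \<in> I" using t T by auto
    have self: "t \<in> closure {s \<in> I. p s = p t}"
      by (rule subsetD[OF closure_subset]) (use tI in simp)
    then obtain d where d: "(g (p t) has_vector_derivative d) (at t within I)"
      using diff[OF _ self] t by auto
    have same: "(g k has_vector_derivative d) (at t within I)" if k: "t \<in> closure {s \<in> I. p s = k}" for k
    proof -
      obtain d' where d': "(g k has_vector_derivative d') (at t within I)"
        using diff[OF _ k] t by auto
      have "d' - d = 0"
      proof (rule ccontr)
        assume "d' - d \<noteq> 0"
        moreover have "((\<lambda>s. g k s - g (p t) s) has_vector_derivative d' - d) (at t within I)"
          by (rule has_vector_derivative_diff[OF d' d])
        moreover have "g k t - g (p t) t = 0" using diff[of t k] diff[of t "p t"] t k self by simp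
        ultimately have "t isolated_in {s \<in> I. g k s - g (p t) s = 0}"
          using isolated_zero[where f = "\<lambda>s. g k s - g (p t) s"] tI by blast
        then show False using t by blast
      qed
      then show ?thesis using d' by simp
    qed
    have "((\<lambda>s. (f s - f t) /\<^sub>R (s - t)) \<longlongrightarrow> d) (at t within I)"
    proof (rule tendstoI)
      fix e :: real assume e: "e > 0"
      have "\<forall>\<^sub>F s in at t within I. p s = k \<longrightarrow> dist ((f s - f t) /\<^sub>R (s - t)) d < e" for k
      proof (cases "t \<in> closure {s \<in> I. p s = k}")
        case True
        have "\<forall>\<^sub>F s in at t within I. dist ((g k s - g k t) /\<^sub>R (s - t)) d < e"
          using same[OF True] e by (auto simp: has_vector_derivative_iff_quotient dest: tendstoD)
        moreover have "\<forall>\<^sub>F s in at t within I. s \<in> I" by (simp add: eventually_at_filter)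
        ultimately show ?thesis
          by eventually_elim (use sel diff[of t k] t True in auto)
      next
        case False
        then have "\<forall>\<^sub>F s in nhds t. s \<notin> closure {s \<in> I. p s = k}"
          using eventually_nhds_in_open[of "- closure {s \<in> I. p s = k}" t] by auto
        then show ?thesis
          unfolding eventually_at_filter
          by eventually_elim (use closure_subset[of "{s \<in> I. p s = k}"] in auto)
      qed
      then have "\<forall>\<^sub>F s in at t within I. \<forall>k. p s = k \<longrightarrow> dist ((f s - f t) /\<^sub>R (s - t)) d < e"
        by (intro eventually_all_finite)
      then show "\<forall>\<^sub>F s in at t within I. dist ((f s - f t) /\<^sub>R (s - t)) d < e"
        by eventually_elim blast
    qed
    then show ?thesis unfolding has_vector_derivative_iff_quotient by blast
  qed
  moreover have "countable ?E" by (intro countable_UN countable_isolated_points) auto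
  ultimately show ?thesis by blast
qed

lemma has_vector_derivative_matrix_inv:
  fixes A :: "real \<Rightarrow> real^'n^'n"
  assumes A: "(A has_vector_derivative A') (at t within I)" and inv: "invertible (A t)"
  shows "((\<lambda>s. matrix_inv (A s)) has_vector_derivative - (matrix_inv (A t) ** A' ** matrix_inv (A t))) (at t within I)"
  unfolding has_vector_derivative_iff_quotient
proof (rule Lim_transform_eventually)
  have cont: "(A \<longlongrightarrow> A t) (at t within I)"
    using has_vector_derivative_continuous[OF A] by (simp add: continuous_within)
  then have "((\<lambda>s. matrix_inv (A s)) \<longlongrightarrow> matrix_inv (A t)) (at t within I)"
    by (rule tendsto_matrix_inv[OF _ inv])
  moreover have "((\<lambda>s. (A s - A t) /\<^sub>R (s - t)) \<longlongrightarrow> A') (at t within I)"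
    using A by (simp add: has_vector_derivative_iff_quotient)
  ultimately show "((\<lambda>s. - (matrix_inv (A s) ** ((A s - A t) /\<^sub>R (s - t)) ** matrix_inv (A t))) \<longlongrightarrow>
      - (matrix_inv (A t) ** A' ** matrix_inv (A t))) (at t within I)"
    by (intro tendsto_minus tendsto_matrix_matrix_mult tendsto_const)
  show "\<forall>\<^sub>F s in at t within I. - (matrix_inv (A s) ** ((A s - A t) /\<^sub>R (s - t)) ** matrix_inv (A t)) =
      (matrix_inv (A s) - matrix_inv (A t)) /\<^sub>R (s - t)"
    using eventually_invertible[OF cont inv]
  proof eventually_elim
    case (elim s)
    show ?case
      unfolding matrix_inv_diff[OF elim inv]
        bounded_bilinear.scaleR_right[OF bounded_bilinear_matrix_matrix_mult]
        bounded_bilinear.scaleR_left[OF bounded_bilinear_matrix_matrix_mult] scaleR_minus_right ..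
  qed
qed

lemma AE_lebesgue_on_not_in_countable:
  assumes "countable E" "S \<in> sets lebesgue"
  shows "AE t in lebesgue_on S. (t :: 'a::euclidean_space) \<notin> E"
proof -
  have "AE t in lebesgue. t \<notin> E"
    by (intro AE_completion AE_not_in countable_imp_null_set_lborel assms)
  then show ?thesis
    using assms(2) by (subst AE_restrict_space_iff) (auto elim: AE_mp)
qed

text \<open>
  A zero of \<open>u\<close> at which \<open>u'\<close> does not vanish is isolated; the last claim treats the other zeros.
\<close>

lemma positive_part_derivative:
  fixes u :: "real \<Rightarrow> real"
  assumes t: "t \<in> {0..1}" and u: "(u has_vector_derivative u') (at t within {0..1})"
    and v: "((\<lambda>s. max 0 (u s)) has_vector_derivative v') (at t within {0..1})"
  shows "0 < u t \<Longrightarrow> v' = u'" "u t < 0 \<Longrightarrow> v' = 0" "u t = 0 \<Longrightarrow> u' = 0 \<Longrightarrow> v' = 0"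
proof -
  let ?F = "at t within {0..1::real}"
  have cont: "(u \<longlongrightarrow> u t) ?F"
    using has_vector_derivative_continuous[OF u] by (simp add: continuous_within)
  note quot = u[unfolded has_vector_derivative_iff_quotient]
  {
    assume pos: "0 < u t"
    have "\<forall>\<^sub>F s in ?F. (u s - u t) /\<^sub>R (s - t) = (max 0 (u s) - max 0 (u t)) /\<^sub>R (s - t)"
      using order_tendstoD(1)[OF cont pos] by eventually_elim (use pos in simp)
    then have "((\<lambda>s. max 0 (u s)) has_vector_derivative u') ?F"
      unfolding has_vector_derivative_iff_quotient by (rule Lim_transform_eventually[OF quot])
    then show "v' = u'" by (rule unit_interval_derivative_unique[OF t v])
  next
    assume neg: "u t < 0"
    have "\<forall>\<^sub>F s in ?F. (max 0 (u s) - max 0 (u t)) /\<^sub>R (s - t) = 0"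
      using order_tendstoD(2)[OF cont neg] by eventually_elim (use neg in simp)
    then have "((\<lambda>s. max 0 (u s)) has_vector_derivative 0) ?F"
      unfolding has_vector_derivative_iff_quotient by (rule tendsto_eventually)
    then show "v' = 0" by (rule unit_interval_derivative_unique[OF t v])
  next
    assume zero: "u t = 0" "u' = 0"
    have "((\<lambda>s. (max 0 (u s) - max 0 (u t)) /\<^sub>R (s - t)) \<longlongrightarrow> 0) ?F"
    proof (rule Lim_null_comparison)
      show "((\<lambda>s. norm ((u s - u t) /\<^sub>R (s - t))) \<longlongrightarrow> 0) ?F"
        using tendsto_norm[OF quot] zero by simp
      show "\<forall>\<^sub>F s in ?F. norm ((max 0 (u s) - max 0 (u t)) /\<^sub>R (s - t)) \<le> norm ((u s - u t) /\<^sub>R (s - t))"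
        by (intro always_eventually allI) (auto simp: zero abs_mult intro!: mult_left_mono)
    qed
    then have "((\<lambda>s. max 0 (u s)) has_vector_derivative 0) ?F"
      unfolding has_vector_derivative_iff_quotient .
    then show "v' = 0" by (rule unit_interval_derivative_unique[OF t v])
  }
qed

section \<open>The sensitivity formula\<close>

lemma matrix_blinfun_mult: "matrix (blinfun_apply P) *v u = blinfun_apply P u"
  for P :: "(real^'n) \<Rightarrow>\<^sub>L (real^'m)"
  by (simp add: bounded_linear.linear[OF blinfun.bounded_linear_right])

lemma U_mat_mult: "U_mat \<gamma> H P *v u = P (u - \<gamma> *\<^sub>R (H *v u)) - u"
  by (simp add: U_mat_def matrix_vector_mult_diff_rdistrib matrix_vector_mul_assoc[symmetric]
      matrix_blinfun_mult scaleR_matrix_vector_assoc)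

lemma V_map_apply:
  fixes A :: "'a::real_normed_vector \<Rightarrow>\<^sub>L (real^'n^'n)"
  shows "V_map \<gamma> P A B z \<delta> = - (\<gamma> *\<^sub>R P (A \<delta> *v z + B \<delta>))"
proof -
  have "bounded_linear (\<lambda>\<delta>. A \<delta> *v z)"
    by (intro bounded_linear_compose[OF bounded_bilinear.bounded_linear_left[OF bounded_bilinear_matrix_vector_mult]]
        blinfun.bounded_linear_right)
  then show ?thesis
    by (simp add: V_map_def jac_times_vec_def bounded_linear_Blinfun_apply blinfun.add_left blinfun.scaleR_left
        blinfun.minus_left)
qed

lemma blinfun_of_mat_apply [simp]: "blinfun_of_mat M x = M *v x" for M :: "real^'n^'m"
  by (simp add: blinfun_of_mat_def bounded_linear_Blinfun_apply)

lemma tendsto_U_mat: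
  fixes H :: "'a \<Rightarrow> real^'n^'n"
  assumes "(H \<longlongrightarrow> H0) F" "(P \<longlongrightarrow> P0) F"
  shows "((\<lambda>k. U_mat \<gamma> (H k) (P k)) \<longlongrightarrow> U_mat \<gamma> H0 P0) F"
proof -
  have "((\<lambda>k. matrix (blinfun_apply (P k)) $ i $ j) \<longlongrightarrow> matrix (blinfun_apply P0) $ i $ j) F" for i j
    unfolding matrix_def by (simp, intro tendsto_intros assms)
  then have "((\<lambda>k. matrix (blinfun_apply (P k))) \<longlongrightarrow> matrix (blinfun_apply P0)) F"
    by (intro vec_tendstoI)
  then show ?thesis
    unfolding U_mat_def by (intro tendsto_intros tendsto_matrix_matrix_mult assms)
qed

locale sensitivity = parametric_lcp Y H h z
  for Y :: "'a::euclidean_space set"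
    and H :: "'a \<Rightarrow> real^('i::finite + 'e::finite)^('i + 'e)" and h :: "'a \<Rightarrow> real^('i + 'e)"
    and z :: "'a \<Rightarrow> real^('i + 'e)" +
  fixes \<gamma> :: real
  assumes \<gamma>: "\<gamma> > 0"
begin

text \<open>
  A gradient step of length \<open>\<gamma>\<close> for the dual objective. The solution is the fixed point of this step
  followed by the projection.
\<close>

definition dual_step :: "'a \<Rightarrow> real^('i + 'e)" where
  "dual_step x = z x - \<gamma> *\<^sub>R (H x *v z x + h x)"

lemma fixed_point:
  assumes "x \<in> Y" shows "proj_cone (dual_step x) = z x"
proof -
  let ?s = "H x *v z x + h x"
  have "max 0 (z x $ Inl i - \<gamma> * ?s $ Inl i) = z x $ Inl i" for i
  proof -
    have "0 \<le> z x $ Inl i" "0 \<le> ?s $ Inl i" "z x $ Inl i * ?s $ Inl i = 0"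
      using solution[OF assms] unfolding lcp_solution_def by blast+
    then show ?thesis
      using \<gamma> by (cases "?s $ Inl i = 0") (auto simp: max_def zero_le_mult_iff mult_le_0_iff simp del: vector_add_component)
  qed
  moreover have "?s $ Inr j = 0" for j
    using solution[OF assms] unfolding lcp_solution_def by blast
  ultimately show ?thesis
    unfolding vec_eq_iff all_sum_type by (simp add: proj_cone_nth dual_step_def del: vector_add_component)
qed

lemma inactive_slope:
  assumes x: "x \<in> Y" and d: "d \<in> projector_slopes (dual_step x)" and i: "(H x *v z x + h x) $ Inl i \<noteq> 0"
  shows "d $ Inl i = 0"
proof -
  let ?s = "H x *v z x + h x"
  have "0 \<le> ?s $ Inl i" "z x $ Inl i * ?s $ Inl i = 0"
    using solution[OF x] unfolding lcp_solution_def by blast+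
  then have "z x $ Inl i = 0" "0 < ?s $ Inl i" using i by auto
  then have "dual_step x $ Inl i < 0" using \<gamma> by (simp add: dual_step_def del: vector_add_component)
  then show ?thesis using d by (simp add: projector_slopes_def)
qed

text \<open>
  If \<open>U u = 0\<close>, then \<open>d (u - \<gamma> H u) = u\<close> holds componentwise. Since \<open>0 \<le> d \<le> 1\<close>, each product \<open>u (H u)\<close> is
  nonpositive, so \<open>u\<close> has no energy. At inactive constraints the slope is zero and so is \<open>u\<close>.
  Nondegeneracy leaves only \<open>u = 0\<close>.
\<close>

lemma U_mat_invertible:
  assumes x: "x \<in> Y" and d: "d \<in> projector_slopes (dual_step x)"
  shows "invertible (U_mat \<gamma> (H x) (diag_map d))"
  unfolding invertible_iff_no_kernel
proof (intro allI impI)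
  fix u assume "U_mat \<gamma> (H x) (diag_map d) *v u = 0"
  then have "diag_map d (u - \<gamma> *\<^sub>R (H x *v u)) $ r = u $ r" for r
    by (simp only: U_mat_mult right_minus_eq)
  then have eq: "d $ r * (u $ r - \<gamma> * (H x *v u) $ r) = u $ r" for r
    by simp
  have "u $ r * (H x *v u) $ r \<le> 0" for r
  proof (cases "d $ r = 0")
    case True
    then show ?thesis using eq[of r] by simp
  next
    case False
    have d01: "0 < d $ r" "d $ r \<le> 1" using d False by (auto simp: projector_slopes_def less_le)
    have "(d $ r * \<gamma>) * (u $ r * (H x *v u) $ r) = - (1 - d $ r) * (u $ r * u $ r)"
      using arg_cong[OF eq[of r], of "\<lambda>y. u $ r * y"] by (simp add: algebra_simps)
    also have "\<dots> \<le> 0" using d01 by (simp add: mult_nonpos_nonneg)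
    finally show ?thesis using d01(1) \<gamma> by (simp add: mult_le_0_iff)
  qed
  then have "u \<bullet> (H x *v u) \<le> 0"
    unfolding inner_vec_def by (intro sum_nonpos) simp
  then have "u \<bullet> (H x *v u) = 0"
    using positive_semidefinite[OF x] by (simp add: positive_semidefinite_def order_antisym)
  moreover have "u $ Inl i = 0" if "(H x *v z x + h x) $ Inl i \<noteq> 0" for i
    using inactive_slope[OF x d that] eq[of "Inl i"] by simp
  ultimately show "u = 0"
    using nondegenerate[OF x] unfolding nondegenerate_def by blast
qed

lemma tendsto_dual_step: "(\<And>n. X n \<in> Y) \<Longrightarrow> X \<longlonglongrightarrow> x \<Longrightarrow> x \<in> Y \<Longrightarrow> (\<lambda>n. dual_step (X n)) \<longlonglongrightarrow> dual_step x"
  unfolding dual_step_def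
  by (intro tendsto_intros tendsto_matrix_vector_mult tendsto_H tendsto_h tendsto_z)

text \<open>
  Formed with all admissible slopes rather than with a given Jacobian of the projector, so that
  it contains the formula for every Clarke element of the projector.
\<close>

definition sensitivity_jacobian ::
    "('a \<Rightarrow> ('a \<Rightarrow>\<^sub>L (real^('i + 'e)^('i + 'e))) set) \<Rightarrow> ('a \<Rightarrow> ('a \<Rightarrow>\<^sub>L (real^('i + 'e))) set) \<Rightarrow>
     'a \<Rightarrow> ('a \<Rightarrow>\<^sub>L (real^('i + 'e))) set" where
  "sensitivity_jacobian JH Jh x =
    {- (blinfun_of_mat (matrix_inv (U_mat \<gamma> (H x) (diag_map d))) o\<^sub>L V_map \<gamma> (diag_map d) A B (z x)) |d A B.
       d \<in> projector_slopes (dual_step x) \<and> A \<in> JH x \<and> B \<in> Jh x}"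

text \<open>
  Limits of the slopes, of \<open>A\<close> and of \<open>B\<close> are extracted one after the other. The limit of \<open>U\<close> is invertible,
  and the inverse is continuous there.
\<close>

lemma usco_sensitivity_jacobian:
  assumes JH: "usco_on Y JH" and Jh: "usco_on Y Jh"
  shows "usco_on Y (sensitivity_jacobian JH Jh)"
proof (rule usco_onI)
  fix x X N assume x: "x \<in> Y" and X: "\<And>k::nat. X k \<in> Y" and N: "\<And>k. N k \<in> sensitivity_jacobian JH Jh (X k)"
    and lim: "X \<longlonglongrightarrow> x"
  obtain d A B where dAB: "\<And>k. d k \<in> projector_slopes (dual_step (X k))" "\<And>k. A k \<in> JH (X k)" "\<And>k. B k \<in> Jh (X k)"
    and N_eq: "\<And>k. N k = - (blinfun_of_mat (matrix_inv (U_mat \<gamma> (H (X k)) (diag_map (d k)))) o\<^sub>L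
      V_map \<gamma> (diag_map (d k)) (A k) (B k) (z (X k)))"
    using N unfolding sensitivity_jacobian_def mem_Collect_eq by metis
  obtain r1 d0 where 1: "strict_mono r1" "d0 \<in> projector_slopes (dual_step x)" "(d \<circ> r1) \<longlonglongrightarrow> d0"
    using usco_onE[OF usco_projector_slopes UNIV_I UNIV_I dAB(1) tendsto_dual_step[OF X lim x]] by metis
  obtain r2 A0 where 2: "strict_mono r2" "A0 \<in> JH x" "((A \<circ> r1) \<circ> r2) \<longlonglongrightarrow> A0"
    using usco_onE[OF JH x, of "X \<circ> r1" "A \<circ> r1"] X dAB(2) LIMSEQ_subseq_LIMSEQ[OF lim 1(1)]
    by (metis comp_apply)
  obtain r3 B0 where 3: "strict_mono r3" "B0 \<in> Jh x" "((B \<circ> (r1 \<circ> r2)) \<circ> r3) \<longlonglongrightarrow> B0"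
    using usco_onE[OF Jh x, of "X \<circ> (r1 \<circ> r2)" "B \<circ> (r1 \<circ> r2)"] X dAB(3)
      LIMSEQ_subseq_LIMSEQ[OF lim strict_mono_o[OF 1(1) 2(1)]]
    by (metis comp_apply)
  define r where "r = r1 \<circ> r2 \<circ> r3"
  have r: "strict_mono r" using 1 2 3 by (simp add: r_def strict_mono_o)
  have XY: "X (r k) \<in> Y" for k by (rule X)
  have Xr: "(\<lambda>k. X (r k)) \<longlonglongrightarrow> x" using LIMSEQ_subseq_LIMSEQ[OF lim r] by (simp add: o_def)
  have dr: "(\<lambda>k. d (r k)) \<longlonglongrightarrow> d0"
    using LIMSEQ_subseq_LIMSEQ[OF 1(3) strict_mono_o[OF 2(1) 3(1)]] by (simp add: o_def r_def)
  have Ar: "(\<lambda>k. A (r k)) \<longlonglongrightarrow> A0"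
    using LIMSEQ_subseq_LIMSEQ[OF 2(3) 3(1)] by (simp add: o_def r_def)
  have Br: "(\<lambda>k. B (r k)) \<longlonglongrightarrow> B0" using 3(3) by (simp add: o_def r_def)
  define N0 where "N0 = - (blinfun_of_mat (matrix_inv (U_mat \<gamma> (H x) (diag_map d0))) o\<^sub>L
    V_map \<gamma> (diag_map d0) A0 B0 (z x))"
  have "(N \<circ> r) \<longlonglongrightarrow> N0"
  proof (rule tendsto_componentwise1)
    fix \<delta> :: 'a
    have "(\<lambda>k. - (matrix_inv (U_mat \<gamma> (H (X (r k))) (diag_map (d (r k)))) *v
        (- (\<gamma> *\<^sub>R diag_map (d (r k)) (A (r k) \<delta> *v z (X (r k)) + B (r k) \<delta>))))) \<longlonglongrightarrow>
      - (matrix_inv (U_mat \<gamma> (H x) (diag_map d0)) *v (- (\<gamma> *\<^sub>R diag_map d0 (A0 \<delta> *v z x + B0 \<delta>))))"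
      by (intro tendsto_intros tendsto_matrix_vector_mult tendsto_matrix_inv tendsto_U_mat tendsto_H tendsto_z
          tendsto_diag_map U_mat_invertible dr Ar Br XY Xr x 1(2))
    then show "(\<lambda>k. (N \<circ> r) k \<delta>) \<longlonglongrightarrow> N0 \<delta>"
      by (simp add: N_eq N0_def V_map_apply blinfun.minus_left)
  qed
  moreover have "N0 \<in> sensitivity_jacobian JH Jh x"
    using 1(2) 2(2) 3(2) unfolding sensitivity_jacobian_def N0_def by blast
  ultimately show "\<exists>r v. strict_mono r \<and> v \<in> sensitivity_jacobian JH Jh x \<and> (N \<circ> r) \<longlonglongrightarrow> v"
    using r by blast
qed


text \<open>
  For fixed slopes the fixed point equation is linear in \<open>z\<close>. Different admissible slopes at the same
  point give the same value.
\<close>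

lemma solution_formula:
  assumes x: "x \<in> Y" and d: "d \<in> projector_slopes (dual_step x)"
  shows "matrix_inv (U_mat \<gamma> (H x) (diag_map d)) *v (\<gamma> *\<^sub>R diag_map d (h x)) = z x"
proof -
  have "z x - \<gamma> *\<^sub>R (H x *v z x) = dual_step x + \<gamma> *\<^sub>R h x"
    by (simp add: dual_step_def scaleR_add_right)
  then have "U_mat \<gamma> (H x) (diag_map d) *v z x = diag_map d (dual_step x) + \<gamma> *\<^sub>R diag_map d (h x) - z x"
    by (simp add: U_mat_mult blinfun.add_right blinfun.scaleR_right)
  also have "\<dots> = \<gamma> *\<^sub>R diag_map d (h x)"
    by (simp add: diag_map_slopes_self[OF d] fixed_point[OF x])
  finally show ?thesis
    using matrix_inv_vec(2)[OF U_mat_invertible[OF x d], of "z x"] by simp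
qed

lemma solution_formula_differentiable:
  assumes x: "c t \<in> Y" and d: "d \<in> projector_slopes (dual_step (c t))"
    and H': "((\<lambda>s. H (c s)) has_vector_derivative H') (at t within I)"
    and h': "((\<lambda>s. h (c s)) has_vector_derivative h') (at t within I)"
  shows "\<exists>D. ((\<lambda>s. matrix_inv (U_mat \<gamma> (H (c s)) (diag_map d)) *v (\<gamma> *\<^sub>R diag_map d (h (c s))))
    has_vector_derivative D) (at t within I)"
proof -
  let ?M = "matrix (blinfun_apply (diag_map d))"
  have "((\<lambda>s. U_mat \<gamma> (H (c s)) (diag_map d)) has_vector_derivative (?M ** (0 - \<gamma> *\<^sub>R H') - 0)) (at t within I)"
    unfolding U_mat_def
    by (intro has_vector_derivative_diff has_vector_derivative_const H'
        bounded_linear.has_vector_derivative[OF bounded_bilinear.bounded_linear_right[OF bounded_bilinear_matrix_matrix_mult]]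
        bounded_linear.has_vector_derivative[OF bounded_linear_scaleR_right])
  note inv = has_vector_derivative_matrix_inv[OF this U_mat_invertible[OF x d]]
  have "((\<lambda>s. \<gamma> *\<^sub>R diag_map d (h (c s))) has_vector_derivative \<gamma> *\<^sub>R diag_map d h') (at t within I)"
    by (intro bounded_linear.has_vector_derivative[OF bounded_linear_scaleR_right]
        bounded_linear.has_vector_derivative[OF blinfun.bounded_linear_right] h')
  from bounded_bilinear.has_vector_derivative[OF bounded_bilinear_matrix_vector_mult inv this]
  show ?thesis by blast
qed

text \<open>
  At each time the solution is given by the formula for the current 0-1 slopes. Slopes that
  occur arbitrarily close to \<open>t\<close> are admissible at \<open>t\<close> by closedness, so there \<open>U\<close> is invertible and
  their formula is differentiable.
\<close>

lemma solution_path_differentiable: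
  assumes c: "c ` I \<subseteq> Y" and T: "T \<subseteq> I"
    and diff: "\<And>t. t \<in> T \<Longrightarrow> \<exists>c'. (c has_vector_derivative c') (at t within I)"
      "\<And>t. t \<in> T \<Longrightarrow> \<exists>H'. ((\<lambda>s. H (c s)) has_vector_derivative H') (at t within I)"
      "\<And>t. t \<in> T \<Longrightarrow> \<exists>h'. ((\<lambda>s. h (c s)) has_vector_derivative h') (at t within I)"
  shows "\<exists>E. countable E \<and> (\<forall>t\<in>T - E. \<exists>z'. ((\<lambda>s. z (c s)) has_vector_derivative z') (at t within I))"
proof -
  \<comment> \<open>0-1 slopes are encoded by Boolean functions, which form a finite type.\<close>
  define ind :: "('i + 'e \<Rightarrow> bool) \<Rightarrow> real^('i + 'e)" where "ind k = (\<chi> r. if k r then 1 else 0)" for k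
  define pat :: "real \<Rightarrow> 'i + 'e \<Rightarrow> bool" where "pat t = (\<lambda>r. case r of Inl i \<Rightarrow> \<not> dual_step (c t) $ Inl i < 0 | Inr j \<Rightarrow> True)" for t
  define g where "g k t = matrix_inv (U_mat \<gamma> (H (c t)) (diag_map (ind k))) *v
    (\<gamma> *\<^sub>R diag_map (ind k) (h (c t)))" for k t
  have pat: "ind (pat t) \<in> projector_slopes (dual_step (c t))" for t
    by (auto simp: ind_def pat_def projector_slopes_def split: sum.splits)
  show ?thesis
  proof (rule selection_differentiable[where g = g and p = pat, OF _ T])
    show "z (c t) = g (pat t) t" if "t \<in> I" for t
      using solution_formula[OF _ pat] c that by (auto simp: g_def)
    fix t k assume t: "t \<in> T" and cl: "t \<in> closure {s \<in> I. pat s = k}"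
    have tI: "t \<in> I" and ctY: "c t \<in> Y" using t T c by auto
    obtain s where s: "\<And>n. s n \<in> I" "\<And>n. pat (s n) = k" "s \<longlonglongrightarrow> t"
      using cl unfolding closure_sequential by auto
    have "continuous (at t within I) c"
      using diff(1)[OF t] has_vector_derivative_continuous by blast
    then have "(\<lambda>n. c (s n)) \<longlonglongrightarrow> c t"
      using s unfolding continuous_within_sequentially by (simp add: o_def)
    then have "(\<lambda>n. dual_step (c (s n))) \<longlonglongrightarrow> dual_step (c t)"
      using c s(1) ctY by (intro tendsto_dual_step) auto
    then have k: "ind k \<in> projector_slopes (dual_step (c t))"
      by (rule projector_slopes_limit[OF _ _ tendsto_const, rotated]) (use pat s(2) in metis)
    have "g k t = z (c t)" unfolding g_def by (rule solution_formula[OF ctY k])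
    moreover have "\<exists>D. (g k has_vector_derivative D) (at t within I)"
      using solution_formula_differentiable[where c = c and t = t, OF ctY k] diff(2,3)[OF t] unfolding g_def by blast
    ultimately show "g k t = z (c t) \<and> (\<exists>D. (g k has_vector_derivative D) (at t within I))" ..
  qed
qed

text \<open>
  This differentiates the fixed point equation along the path. The assumption \<open>crossing\<close> ensures that
  a component of the dual step that vanishes at \<open>t\<close> has derivative zero there, so its slope may be
  chosen freely.
\<close>

lemma sensitivity_formula:
  assumes t: "t \<in> {0..1}" and c: "c ` {0..1} \<subseteq> Y"
    and H': "((\<lambda>s. H (c s)) has_vector_derivative H') (at t within {0..1})"
    and h': "((\<lambda>s. h (c s)) has_vector_derivative h') (at t within {0..1})"
    and z': "((\<lambda>s. z (c s)) has_vector_derivative z') (at t within {0..1})"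
    and crossing: "\<And>i. \<not> t isolated_in {s \<in> {0..1}. dual_step (c s) $ Inl i = 0}"
    and d: "d \<in> projector_slopes (dual_step (c t))"
  shows "z' = matrix_inv (U_mat \<gamma> (H (c t)) (diag_map d)) *v (\<gamma> *\<^sub>R diag_map d (H' *v z (c t) + h'))"
proof -
  define w' where "w' = z' - \<gamma> *\<^sub>R ((H (c t) *v z' + H' *v z (c t)) + h')"
  have ct: "c s \<in> Y" if "s \<in> {0..1}" for s using c that by auto
  have w': "((\<lambda>s. dual_step (c s)) has_vector_derivative w') (at t within {0..1})"
    unfolding dual_step_def w'_def
    by (intro has_vector_derivative_diff has_vector_derivative_add z' h'
        bounded_linear.has_vector_derivative[OF bounded_linear_scaleR_right]
        bounded_bilinear.has_vector_derivative[OF bounded_bilinear_matrix_vector_mult H' z'])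
  have w'_nth: "((\<lambda>s. dual_step (c s) $ r) has_vector_derivative w' $ r) (at t within {0..1})" for r
    by (rule bounded_linear.has_vector_derivative[OF bounded_linear_vec_nth w'])
  have z'_nth: "((\<lambda>s. proj_cone (dual_step (c s)) $ r) has_vector_derivative z' $ r) (at t within {0..1})" for r
    using bounded_linear.has_vector_derivative[OF bounded_linear_vec_nth z', of r]
    by (rule has_vector_derivative_transform[OF t, rotated]) (simp add: fixed_point ct)
  have "z' $ Inr j = d $ Inr j * w' $ Inr j" for j
    using unit_interval_derivative_unique[OF t z'_nth[of "Inr j"]] w'_nth[of "Inr j"] d
    by (simp add: proj_cone_nth projector_slopes_def)
  moreover have "z' $ Inl i = d $ Inl i * w' $ Inl i" for i
  proof -
    have "w' $ Inl i = 0" if "dual_step (c t) $ Inl i = 0"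
      using isolated_zero[OF w'_nth _ t that] crossing by blast
    then show ?thesis
      using positive_part_derivative[OF t w'_nth[of "Inl i"] z'_nth[of "Inl i", unfolded proj_cone_nth]] d
      by (cases "dual_step (c t) $ Inl i" "0::real" rule: linorder_cases) (auto simp: projector_slopes_def)
  qed
  ultimately have z'_eq: "z' = diag_map d w'"
    unfolding vec_eq_iff all_sum_type by simp
  have "z' - \<gamma> *\<^sub>R (H (c t) *v z') = w' + \<gamma> *\<^sub>R (H' *v z (c t) + h')"
    by (simp add: w'_def scaleR_add_right)
  then have "U_mat \<gamma> (H (c t)) (diag_map d) *v z' = diag_map d w' + \<gamma> *\<^sub>R diag_map d (H' *v z (c t) + h') - z'"
    by (simp only: U_mat_mult blinfun.add_right blinfun.scaleR_right)
  then have "U_mat \<gamma> (H (c t)) (diag_map d) *v z' = \<gamma> *\<^sub>R diag_map d (H' *v z (c t) + h')"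
    using z'_eq by simp
  then show ?thesis
    using matrix_inv_vec(2)[OF U_mat_invertible[OF ct[OF t] d], of z'] by simp
qed

text \<open>
  The exceptional times of a path form a null set: the chain rule for \<open>H\<close> or \<open>h\<close> fails on a null set, and
  the times at which the selected formulas or the kinks cause trouble are countable.
\<close>

theorem conservative_sensitivity_jacobian:
  assumes JH: "conservative_jacobian_on Y H JH" and Jh: "conservative_jacobian_on Y h Jh"
  shows "conservative_jacobian_on Y z (sensitivity_jacobian JH Jh)"
proof -
  have nonempty: "sensitivity_jacobian JH Jh x \<noteq> {}" if x: "x \<in> Y" for x
  proof -
    obtain A B where "A \<in> JH x" "B \<in> Jh x"
      using conservative_jacobian_onD(1)[OF JH x] conservative_jacobian_onD(1)[OF Jh x] by blast
    moreover have "(\<chi> r. case r of Inl i \<Rightarrow> if dual_step x $ Inl i < 0 then 0 else 1 | Inr j \<Rightarrow> 1) \<in> projector_slopes (dual_step x)"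
      by (auto simp: projector_slopes_def split: sum.split)
    ultimately show ?thesis unfolding sensitivity_jacobian_def by blast
  qed
  have usco: "usco_on Y (sensitivity_jacobian JH Jh)"
    by (intro usco_sensitivity_jacobian conservative_jacobian_onD(2)[OF JH] conservative_jacobian_onD(2)[OF Jh])
  have path: "AE t in lebesgue_on {0..1}. \<exists>d. (c has_vector_derivative d) (at t within {0..1}) \<and>
      (\<forall>N\<in>sensitivity_jacobian JH Jh (c t). ((\<lambda>s. z (c s)) has_vector_derivative blinfun_apply N d) (at t within {0..1}))"
    if ac: "ac_path c" and c: "c ` {0..1} \<subseteq> Y" for c
  proof -
    define good where "good t d \<longleftrightarrow> (c has_vector_derivative d) (at t within {0..1}) \<and>
      (\<forall>A\<in>JH (c t). ((\<lambda>s. H (c s)) has_vector_derivative blinfun_apply A d) (at t within {0..1})) \<and>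
      (\<forall>B\<in>Jh (c t). ((\<lambda>s. h (c s)) has_vector_derivative blinfun_apply B d) (at t within {0..1}))" for t d
    have AE_good: "AE t in lebesgue_on {0..1}. \<exists>d. good t d"
      using conservative_jacobian_onD(3)[OF JH ac c] conservative_jacobian_onD(3)[OF Jh ac c] AE_space
    proof eventually_elim
      case (elim t)
      then have t: "t \<in> {0..1}" by (simp add: space_restrict_space)
      with elim show ?case
        unfolding good_def using unit_interval_derivative_unique[OF t] by blast
    qed
    define T where "T = {t \<in> {0..1}. \<exists>d. good t d}"
    have "\<exists>E. countable E \<and> (\<forall>t\<in>T - E. \<exists>z'. ((\<lambda>s. z (c s)) has_vector_derivative z') (at t within {0..1}))"
    proof (rule solution_path_differentiable[OF c])
      fix t assume "t \<in> T"
      then obtain d where d: "good t d" and "t \<in> {0..1}" unfolding T_def by blast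
      then have "c t \<in> Y" using c by blast
      then obtain A B where "A \<in> JH (c t)" "B \<in> Jh (c t)"
        using conservative_jacobian_onD(1)[OF JH] conservative_jacobian_onD(1)[OF Jh] by blast
      with d show "\<exists>c'. (c has_vector_derivative c') (at t within {0..1})"
        "\<exists>H'. ((\<lambda>s. H (c s)) has_vector_derivative H') (at t within {0..1})"
        "\<exists>h'. ((\<lambda>s. h (c s)) has_vector_derivative h') (at t within {0..1})"
        unfolding good_def by blast+
    qed (auto simp: T_def)
    then obtain E1 where E1: "countable E1"
      "\<And>t. t \<in> T - E1 \<Longrightarrow> \<exists>z'. ((\<lambda>s. z (c s)) has_vector_derivative z') (at t within {0..1})" by blast
    define E2 where "E2 = (\<Union>i. {t. t isolated_in {s \<in> {0..1}. dual_step (c s) $ Inl i = 0}})"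
    have "countable (E1 \<union> E2)"
      unfolding E2_def by (intro countable_Un E1 countable_UN countable_isolated_points) auto
    then have "AE t in lebesgue_on {0..1}. t \<notin> E1 \<union> E2"
      by (rule AE_lebesgue_on_not_in_countable) simp
    with AE_good AE_space show ?thesis
    proof eventually_elim
      case (elim t)
      then have t: "t \<in> {0..1}" by (simp add: space_restrict_space)
      obtain d where d: "good t d" using elim by blast
      then obtain z' where z': "((\<lambda>s. z (c s)) has_vector_derivative z') (at t within {0..1})"
        using E1(2)[of t] elim t by (auto simp: T_def)
      have crossing: "\<not> t isolated_in {s \<in> {0..1}. dual_step (c s) $ Inl i = 0}" for i
        using elim by (auto simp: E2_def)
      have "blinfun_apply N d = z'" if mem: "N \<in> sensitivity_jacobian JH Jh (c t)" for N
      proof -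
        obtain \<delta> A B where \<delta>: "\<delta> \<in> projector_slopes (dual_step (c t))" and AB: "A \<in> JH (c t)" "B \<in> Jh (c t)"
          and N: "N = - (blinfun_of_mat (matrix_inv (U_mat \<gamma> (H (c t)) (diag_map \<delta>))) o\<^sub>L
            V_map \<gamma> (diag_map \<delta>) A B (z (c t)))"
          using mem unfolding sensitivity_jacobian_def by blast
        have "z' = matrix_inv (U_mat \<gamma> (H (c t)) (diag_map \<delta>)) *v (\<gamma> *\<^sub>R diag_map \<delta> (A d *v z (c t) + B d))"
          using d AB by (intro sensitivity_formula[OF t c _ _ z' crossing \<delta>]) (auto simp: good_def)
        then show ?thesis
          by (simp add: N blinfun.minus_left V_map_apply mult_minus_vec)
      qed
      then show ?case using d z' unfolding good_def by blast
    qed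
  qed
  show ?thesis
    unfolding conservative_jacobian_on_def
    using solution_lipschitz nonempty usco path unfolding usco_on_iff by blast
qed

end

section \<open>Sensitivity of the dual optimizer\<close>

lemma locally_lipschitz_on_stack_vec:
  fixes G :: "'a::metric_space \<Rightarrow> 'v::euclidean_space^'i" and F :: "'a \<Rightarrow> 'v^'e"
  assumes "locally_lipschitz_on S G" "locally_lipschitz_on S F"
  shows "locally_lipschitz_on S (\<lambda>x. stack_vec (G x) (F x))"
proof -
  have "linear (\<lambda>G :: 'v^'i. stack_vec G (0 :: 'v^'e))" "linear (\<lambda>F :: 'v^'e. stack_vec (0 :: 'v^'i) F)"
    by (auto intro!: linearI simp: vec_eq_iff all_sum_type)
  then have "locally_lipschitz_on S (\<lambda>x. stack_vec (G x) 0 + stack_vec 0 (F x))"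
    by (intro locally_lipschitz_on_add locally_lipschitz_on_linear[of "\<lambda>G. stack_vec G 0"]
        locally_lipschitz_on_linear[of "\<lambda>F. stack_vec 0 F"] assms) (simp_all add: linear_conv_bounded_linear)
  then show ?thesis by (simp add: stack_vec_add)
qed

theorem theorem1:
  fixes \<O> :: "nat \<Rightarrow> real list set set"
    and Y :: "((real^'x) \<times> (real^'p)) set"
    and Q :: "real^'p \<Rightarrow> real^'y^'y"
    and q :: "(real^'x) \<times> (real^'p) \<Rightarrow> real^'y"
    and F :: "real^'p \<Rightarrow> real^'y^'e"
    and \<phi> :: "(real^'x) \<times> (real^'p) \<Rightarrow> real^'e"
    and G :: "real^'p \<Rightarrow> real^'y^'i"
    and g :: "(real^'x) \<times> (real^'p) \<Rightarrow> real^'i"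
    and H :: "(real^'x) \<times> (real^'p) \<Rightarrow> real^('i + 'e)^('i + 'e)"
    and h :: "(real^'x) \<times> (real^'p) \<Rightarrow> real^('i + 'e)"
    and \<gamma> :: real
  assumes o_minimal: "o_minimal \<O>"
    and \<gamma>: "\<gamma> > 0"
    and Y: "polytope Y"
    and pos_def: "\<And>x p. (x, p) \<in> Y \<Longrightarrow> positive_definite (Q p)"
    and feasible: "\<And>x p. (x, p) \<in> Y \<Longrightarrow>
          \<exists>y. primal_feasible (F p) (\<phi> (x, p)) (G p) (g (x, p)) y"
    and licq: "\<And>x p y. (x, p) \<in> Y \<Longrightarrow>
          primal_optimizer (Q p) (q (x, p)) (F p) (\<phi> (x, p)) (G p) (g (x, p)) y \<Longrightarrow>
          licq (F p) (G p) (g (x, p)) y"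
    and lipschitz:
      "locally_lipschitz_on UNIV Q" "locally_lipschitz_on UNIV q"
      "locally_lipschitz_on UNIV F" "locally_lipschitz_on UNIV \<phi>"
      "locally_lipschitz_on UNIV G" "locally_lipschitz_on UNIV g"
    and definable:
      "definable_on \<O> UNIV Q" "definable_on \<O> UNIV q"
      "definable_on \<O> UNIV F" "definable_on \<O> UNIV \<phi>"
      "definable_on \<O> UNIV G" "definable_on \<O> UNIV g"
    and H_eq: "\<And>x p. H (x, p) = dual_H (Q p) (F p) (G p)"
    and h_eq: "\<And>x p. h (x, p) = dual_h (Q p) (q (x, p)) (F p) (\<phi> (x, p)) (G p) (g (x, p))"
  shows "\<exists>z :: (real^'x) \<times> (real^'p) \<Rightarrow> real^('i + 'e).
    (\<forall>pb\<in>Y. \<forall>\<zeta>. dual_optimizer (H pb) (h pb) \<zeta> \<longleftrightarrow> \<zeta> = z pb) \<and>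
    locally_lipschitz_on Y z \<and>
    definable_on \<O> Y z \<and>
    (\<forall>JP JH Jh.
       conservative_jacobian_on UNIV proj_cone JP \<and>
       conservative_jacobian_on Y H JH \<and>
       conservative_jacobian_on Y h Jh \<longrightarrow>
       (\<exists>Jz. conservative_jacobian_on Y z Jz \<and>
          (\<forall>pb\<in>Y.
             let w = z pb - \<gamma> *\<^sub>R (H pb *v z pb + h pb);
                 JPw = JP w \<inter> clarke_jacobian proj_cone w
             in JPw \<noteq> {} \<and>
                (\<forall>P\<in>JPw. \<forall>A\<in>JH pb. \<forall>B\<in>Jh pb.
                   invertible (U_mat \<gamma> (H pb) P) \<and>
                   - (blinfun_of_mat (matrix_inv (U_mat \<gamma> (H pb) P)) o\<^sub>L V_map \<gamma> P A B (z pb))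
                     \<in> Jz pb))))"
proof -
  interpret o_minimal_structure \<O> by standard (rule o_minimal)
  have Q_pd: "positive_definite (Q (snd pb))" if "pb \<in> Y" for pb
    using pos_def[of "fst pb" "snd pb"] that by simp
  have H: "H pb = dual_H (Q (snd pb)) (F (snd pb)) (G (snd pb))"
    and h: "h pb = dual_h (Q (snd pb)) (q pb) (F (snd pb)) (\<phi> pb) (G (snd pb)) (g pb)" for pb
    using H_eq[of "fst pb" "snd pb"] h_eq[of "fst pb" "snd pb"] by simp_all
  have "\<exists>\<zeta>. lcp_solution (H pb) (h pb) \<zeta> \<and> nondegenerate (H pb) (h pb) \<zeta>" if pb: "pb \<in> Y" for pb
  proof -
    obtain y where "primal_feasible (F (snd pb)) (\<phi> pb) (G (snd pb)) (g pb) y"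
      using feasible[of "fst pb" "snd pb"] pb by auto
    then show ?thesis
      unfolding H h using licq[of "fst pb" "snd pb"] pb by (intro dual_solution_exists Q_pd) auto
  qed
  then obtain z where z: "\<And>pb. pb \<in> Y \<Longrightarrow> lcp_solution (H pb) (h pb) (z pb)"
    "\<And>pb. pb \<in> Y \<Longrightarrow> nondegenerate (H pb) (h pb) (z pb)" by metis
  have positive_semidefinite: "positive_semidefinite (H pb)" if "pb \<in> Y" for pb
    unfolding H by (rule dual_H_positive_semidefinite[OF Q_pd[OF that]])
  have unique: "lcp_solution (H pb) (h pb) \<zeta> \<longleftrightarrow> \<zeta> = z pb" if "pb \<in> Y" for pb \<zeta>
    using lcp_solution_unique[OF positive_semidefinite z(2,1)] z(1) that by blast
  have lip: "locally_lipschitz_on Y (\<lambda>pb. stack_vec (G (snd pb)) (F (snd pb)))"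
    "locally_lipschitz_on Y (\<lambda>pb. matrix_inv (Q (snd pb)))"
    by (intro locally_lipschitz_on_stack_vec locally_lipschitz_on_matrix_inv locally_lipschitz_on_snd lipschitz
        positive_definite_invertible Q_pd; assumption?)+
  have lip': "locally_lipschitz_on Y q" "locally_lipschitz_on Y \<phi>" "locally_lipschitz_on Y g"
    using lipschitz locally_lipschitz_on_subset by blast+
  have "locally_lipschitz_on Y H"
    unfolding H[abs_def] dual_H_factorisation
    by (intro locally_lipschitz_on_bilinear[OF bounded_bilinear_matrix_matrix_mult]
        locally_lipschitz_on_linear[OF bounded_linear_transpose] lip)
  moreover have "locally_lipschitz_on Y h"
    unfolding h[abs_def] dual_h_factorisation
    by (intro locally_lipschitz_on_add locally_lipschitz_on_bilinear[OF bounded_bilinear_matrix_vector_mult]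
        locally_lipschitz_on_stack_vec lip lip')
  ultimately interpret sensitivity Y H h z \<gamma>
    using positive_semidefinite z \<gamma> by unfold_locales
  have "definable_on \<O> Y z"
    by (rule definable_dual_solution[OF Y pos_def definable]) (use unique H_eq h_eq in auto)
  moreover have "\<forall>pb\<in>Y. \<forall>\<zeta>. dual_optimizer (H pb) (h pb) \<zeta> \<longleftrightarrow> \<zeta> = z pb"
    using unique dual_optimizer_iff_lcp_solution[OF positive_semidefinite] by blast
  moreover have "\<exists>Jz. conservative_jacobian_on Y z Jz \<and>
      (\<forall>pb\<in>Y.
         let w = z pb - \<gamma> *\<^sub>R (H pb *v z pb + h pb);
             JPw = JP w \<inter> clarke_jacobian proj_cone w
         in JPw \<noteq> {} \<and>
            (\<forall>P\<in>JPw. \<forall>A\<in>JH pb. \<forall>B\<in>Jh pb.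
               invertible (U_mat \<gamma> (H pb) P) \<and>
               - (blinfun_of_mat (matrix_inv (U_mat \<gamma> (H pb) P)) o\<^sub>L V_map \<gamma> P A B (z pb)) \<in> Jz pb))"
    if JP: "conservative_jacobian_on UNIV proj_cone JP" and JH: "conservative_jacobian_on Y H JH"
      and Jh: "conservative_jacobian_on Y h Jh" for JP JH Jh
  proof (intro exI[of _ "sensitivity_jacobian JH Jh"] conjI ballI)
    show "conservative_jacobian_on Y z (sensitivity_jacobian JH Jh)"
      by (rule conservative_sensitivity_jacobian[OF JH Jh])
    fix pb assume pb: "pb \<in> Y"
    have "\<exists>d\<in>projector_slopes (dual_step pb). P = diag_map d" if "P \<in> clarke_jacobian proj_cone (dual_step pb)" for P
      using clarke_jacobian_proj_cone_subset that by blast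
    then show "let w = z pb - \<gamma> *\<^sub>R (H pb *v z pb + h pb);
             JPw = JP w \<inter> clarke_jacobian proj_cone w
         in JPw \<noteq> {} \<and>
            (\<forall>P\<in>JPw. \<forall>A\<in>JH pb. \<forall>B\<in>Jh pb.
               invertible (U_mat \<gamma> (H pb) P) \<and>
               - (blinfun_of_mat (matrix_inv (U_mat \<gamma> (H pb) P)) o\<^sub>L V_map \<gamma> P A B (z pb))
                 \<in> sensitivity_jacobian JH Jh pb)"
      unfolding Let_def dual_step_def[symmetric] sensitivity_jacobian_def
      using conservative_clarke_element[OF JP, of "dual_step pb"] U_mat_invertible[OF pb] by blast
  qed
  ultimately show ?thesis
    using solution_lipschitz by (intro exI[of _ z]) blast
qed

end
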